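(* Fix ${\bf x}=({\bf x}_n)\in[0,1]^{\mathbb N}$ and $0<s<R\le\infty$. The algebra map $\alpha_{\bf x}:\mathcal Q_{\mathbb N}\to\mathrm{Func}(\mathcal W_{[-s,s]},\mathbb R)$ of $\mathbb R$-algebras can be extended continuously to $\mathcal Q_{\mathbb N,R}$ (with respect to the topology of $\bigcup_{k\ge0}\widehat{\mathcal Q}_k$, and uniform convergence in $\mathrm{Func}(\mathcal W_{[-s,s]},\mathbb R)$). Furthermore, $\alpha_{\bf x}$ is an embedding of $\mathbb R$-algebras if and only if the ${\bf x}_i$ are distinct.
   Context: $\mathcal W_{[-s,s]}$ is the set of symmetric measurable functions $f:[0,1]^2\to[-s,s]$, and $\mathrm{Func}(\mathcal W_{[-s,s]},\mathbb R)$ is the algebra of all real functions on it, with pointwise operations. Multigraphs are finite, undirected, without loops, possibly with multiple edges; an edge $e$ has endpoints $\{e_s,e_t\}$. A $k$-labelled multigraph is a multigraph $H$ with an injective label map $l_H:\{1,\dots,k\}\to V(H)$; isomorphisms preserve labels. $\mathcal H_{n,k}$ is the finite set of isomorphism classes of $k$-labelled multigraphs with $n$ edges and no unlabelled isolated vertices. $\mathcal Q_k$ is the real vector space with basis $\coprod_{n\ge0}\mathcal H_{n,k}$, a commutative unital algebra under the product $H_1H_2$ = disjoint union with equally labelled vertices identified (keeping all edges). $\mathcal H_{n,k}$ embeds into $\mathcal H_{n,k+1}$ by adding an isolated vertex labelled $k+1$; this gives $\mathcal Q_k\hookrightarrow\mathcal Q_{k+1}$, and $\mathcal Q_{\mathbb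 N}=\bigcup_{k\ge0}\mathcal Q_k$. For $H\in\mathcal H_{n,k}$ with set of unlabelled vertices $V_0$, $t_{\bf x}(H,f)=\int_{[0,1]^{V_0}}\prod_{e\in E(H)}f(x_{e_s},x_{e_t})\prod_{i\in V_0}dx_i$, where $x_v={\bf x}_{l_H^{-1}(v)}$ for labelled $v$; $\alpha_{\bf x}(H)=t_{\bf x}(H,-)$, extended linearly, is an algebra homomorphism on $\mathcal Q_{\mathbb N}$. $\widehat{\mathcal Q}_k=\prod_{n\ge0}\mathbb R^{\mathcal H_{n,k}}$ is the algebra of formal series $(a_H)$ (identified with the formal power series $\sum_n\sum_{H\in\mathcal H_{n,k}}a_Ht_{\bf x}(H,-)$), with termwise addition and product $(ab)_H=\sum_{(H_1,H_2):H_1H_2=H}a_{H_1}b_{H_2}$. It is the completion of $\mathcal Q_k$ under the metrizable topology defined by the grading by number of edges, in which the subspaces $\bigoplus_{n\ge N}\operatorname{span}_{\mathbb R}\mathcal H_{n,k}$ form a fundamental system of neighborhoods of $0$ in $\mathcal Q_k$. Extending $\alpha_{\bf x}$ continuously from $\mathcal Q_{\mathbb N}$ to $\mathcal Q_{\mathbb N,R}$ is equivalent to extending it continuously from $\mathcal Q_k$ to $\mathcal Q_{k,R}$ for each $k\ge0$. The radius of convergence $\rho$ of $(a_H)$ is given by $\rho^{-1}=\limsup_{n\to\infty}\left(\sum_{H\in\mathcal H_{n,k}}|a_H|\right)^{1/n}$. For $0<R\le\infty$, $\mathcal Q_{k,R}\subset\widehat{\mathcal Q}_k$ is the set of series whose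 radius of convergence is greater than $R$, and $\mathcal Q_{\mathbb N,R}=\bigcup_{k\ge0}\mathcal Q_{k,R}$, using the inclusions above.
   Formalization: Continuity in the grading topology fails (s^{-n} times n parallel edges tends to 0 but has value 1 at f=s); it is proved on each set where sum|a_H| r^n <= C for all n (r>s, any C), plus uniform convergence of truncations; for R=infinity, radius >R means infinite radius. *)

theory Defs
  imports "HOL-Analysis.Analysis"
begin

section \<open>Labelled multigraphs\<close>

text \<open>
  Every finite multigraph is isomorphic to one whose vertices are natural numbers. The edges form
  a multiset of two-element vertex sets, so parallel edges are recorded by their multiplicity.
  Only the values of \<open>lab\<close> on \<open>{1..nlab}\<close> matter.
\<close>

record lmgraph =
  nlab :: nat
  verts :: "nat set"
  edges :: "nat set multiset"
  lab :: "nat \<Rightarrow> nat"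

definition labelled_multigraph :: "nat \<Rightarrow> lmgraph \<Rightarrow> bool" where
  "labelled_multigraph k H \<longleftrightarrow>
     nlab H = k \<and> finite (verts H) \<and>
     (\<forall>e\<in>#edges H. e \<subseteq> verts H \<and> card e = 2) \<and>
     lab H ` {1..k} \<subseteq> verts H \<and> inj_on (lab H) {1..k}"

definition unlabelled :: "lmgraph \<Rightarrow> nat set" where
  "unlabelled H = verts H - lab H ` {1..nlab H}"

definition lmg_iso :: "lmgraph \<Rightarrow> lmgraph \<Rightarrow> bool" where
  "lmg_iso H H' \<longleftrightarrow> nlab H = nlab H' \<and>
     (\<exists>\<phi>. bij_betw \<phi> (verts H) (verts H') \<and>
          image_mset ((`) \<phi>) (edges H) = edges H' \<and>
          (\<forall>i\<in>{1..nlab H}. \<phi> (lab H i) = lab H' i))"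

definition add_label :: "lmgraph \<Rightarrow> lmgraph" where
  "add_label H = (let v = (LEAST v. v \<notin> verts H) in
     \<lparr>nlab = Suc (nlab H), verts = insert v (verts H), edges = edges H,
      lab = (lab H)(Suc (nlab H) := v)\<rparr>)"

text \<open>
  Isomorphism after identifying each graph with the ones obtained from it by adding isolated
  labelled vertices. On graphs with the same number of labels this is plain label-preserving
  isomorphism (lemma \<open>stable_iso_iff_iso\<close> below). Hence the classes of \<open>k\<close>-labelled graphs
  modulo \<open>stable_iso\<close> are the isomorphism classes of \<open>k\<close>-labelled graphs, and the embedding of
  \<open>k\<close>-labelled into \<open>(k+1)\<close>-labelled classes is a set inclusion.
\<close>

definition stable_iso :: "lmgraph \<Rightarrow> lmgraph \<Rightarrow> bool" where
  "stable_iso H H' \<longleftrightarrow> (\<exists>i j. lmg_iso ((add_label ^^ i) H) ((add_label ^^ j) H'))"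

type_synonym hclass = "lmgraph set"

definition hcls :: "lmgraph \<Rightarrow> hclass" where
  "hcls H = {H'. labelled_multigraph (nlab H') H' \<and> stable_iso H H'}"

definition HH :: "nat \<Rightarrow> nat \<Rightarrow> hclass set" where
  "HH n k = hcls ` {H. labelled_multigraph k H \<and> size (edges H) = n \<and>
                       (\<forall>v\<in>unlabelled H. \<exists>e\<in>#edges H. v \<in> e)}"

definition Hall :: "hclass set" where
  "Hall = (\<Union>n k. HH n k)"

lemma fresh_vertex: "finite (V :: nat set) \<Longrightarrow> (LEAST v. v \<notin> V) \<notin> V"
  by (metis LeastI_ex ex_new_if_finite infinite_UNIV_nat)

lemma labelled_multigraph_add_label:
  assumes "labelled_multigraph k H"
  shows "labelled_multigraph (Suc k) (add_label H)"
proof -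
  define v where "v = (LEAST v. v \<notin> verts H)"
  have v: "v \<notin> verts H"
    unfolding v_def using assms by (intro fresh_vertex) (simp add: labelled_multigraph_def)
  have k: "nlab H = k" using assms by (simp add: labelled_multigraph_def)
  have eq: "(add_label H) = \<lparr>nlab = Suc k, verts = insert v (verts H), edges = edges H,
      lab = (lab H)(Suc k := v)\<rparr>"
    by (simp add: add_label_def v_def Let_def k)
  have inj: "inj_on (lab H) {1..k}" and v': "v \<notin> lab H ` {1..k}"
    using assms v unfolding labelled_multigraph_def by blast+
  have "inj_on ((lab H)(Suc k := v)) (insert (Suc k) {1..k})"
    using inj v' by (simp add: inj_on_insert inj_on_fun_updI)
  then have "inj_on ((lab H)(Suc k := v)) {1..Suc k}"
    by (simp add: atLeastAtMostSuc_conv)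
  then show ?thesis
    using assms v unfolding eq labelled_multigraph_def by (auto simp: atLeastAtMostSuc_conv)
qed

lemma add_label_cancel:
  assumes "labelled_multigraph k H" "labelled_multigraph k H'"
    and "lmg_iso (add_label H) (add_label H')"
  shows "lmg_iso H H'"
proof -
  define v where "v = (LEAST v. v \<notin> verts H)"
  define w where "w = (LEAST v. v \<notin> verts H')"
  have v: "v \<notin> verts H" and w: "w \<notin> verts H'"
    unfolding v_def w_def using assms(1,2)
    by (auto intro!: fresh_vertex simp: labelled_multigraph_def)
  have k: "nlab H = k" "nlab H' = k" using assms(1,2) by (auto simp: labelled_multigraph_def)
  have eq: "add_label H = \<lparr>nlab = Suc k, verts = insert v (verts H), edges = edges H,
      lab = (lab H)(Suc k := v)\<rparr>"
    "add_label H' = \<lparr>nlab = Suc k, verts = insert w (verts H'), edges = edges H',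
      lab = (lab H')(Suc k := w)\<rparr>"
    by (simp_all add: add_label_def v_def w_def Let_def k)
  obtain \<phi> where p: "bij_betw \<phi> (insert v (verts H)) (insert w (verts H'))"
      "image_mset ((`) \<phi>) (edges H) = edges H'"
      "\<forall>i\<in>{1..Suc k}. \<phi> (((lab H)(Suc k := v)) i) = ((lab H')(Suc k := w)) i"
    using assms(3) unfolding eq lmg_iso_def by auto
  have "\<phi> v = w" using p(3)[rule_format, of "Suc k"] by simp
  then have "bij_betw \<phi> (verts H) (verts H')"
    using p(1) v w notIn_Un_bij_betw3[of v "verts H" \<phi> "verts H'"] by simp
  moreover have "\<forall>i\<in>{1..k}. \<phi> (lab H i) = lab H' i"
  proof
    fix i assume "i \<in> {1..k}"
    then show "\<phi> (lab H i) = lab H' i" using p(3)[rule_format, of i] by (auto split: if_splits)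
  qed
  ultimately show ?thesis using p(2) k by (auto simp: lmg_iso_def)
qed

lemma stable_iso_iff_iso:
  assumes "labelled_multigraph k H" "labelled_multigraph k H'"
  shows "stable_iso H H' \<longleftrightarrow> lmg_iso H H'"
proof
  assume "lmg_iso H H'"
  then have "lmg_iso ((add_label ^^ 0) H) ((add_label ^^ 0) H')" by simp
  then show "stable_iso H H'" unfolding stable_iso_def by blast
next
  have nl: "labelled_multigraph (k + i) ((add_label ^^ i) G)" if "labelled_multigraph k G" for i G
    by (induction i) (auto simp: that labelled_multigraph_add_label)
  assume "stable_iso H H'"
  then obtain i j where ij: "lmg_iso ((add_label ^^ i) H) ((add_label ^^ j) H')"
    by (auto simp: stable_iso_def)
  then have "i = j"
    using nl[OF assms(1), of i] nl[OF assms(2), of j] by (auto simp: lmg_iso_def labelled_multigraph_def)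
  have "lmg_iso ((add_label ^^ i) H) ((add_label ^^ i) H') \<Longrightarrow> lmg_iso H H'"
    by (induction i) (auto dest: add_label_cancel[OF nl[OF assms(1)] nl[OF assms(2)]])
  then show "lmg_iso H H'" using ij \<open>i = j\<close> by simp
qed


section \<open>The product of labelled multigraphs\<close>

text \<open>
  For graphs with the same labels: the vertices of the disjoint union are the images of
  \<open>v \<mapsto> 2v\<close> and \<open>v \<mapsto> 2v+1\<close>, except that a labelled vertex of \<open>H2\<close> is sent
  to the image of the equally labelled vertex of \<open>H1\<close>.
\<close>

definition glue_right :: "lmgraph \<Rightarrow> lmgraph \<Rightarrow> nat \<Rightarrow> nat" where
  "glue_right H1 H2 v =
     (if v \<in> lab H2 ` {1..nlab H2}
      then 2 * lab H1 (inv_into {1..nlab H2} (lab H2) v) else 2 * v + 1)"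

definition glue :: "lmgraph \<Rightarrow> lmgraph \<Rightarrow> lmgraph" where
  "glue H1 H2 =
     \<lparr>nlab = nlab H1,
      verts = (\<lambda>v. 2 * v) ` verts H1 \<union> glue_right H1 H2 ` verts H2,
      edges = image_mset ((`) (\<lambda>v. 2 * v)) (edges H1) + image_mset ((`) (glue_right H1 H2)) (edges H2),
      lab = (\<lambda>i. 2 * lab H1 i)\<rparr>"

definition is_product :: "hclass \<Rightarrow> hclass \<Rightarrow> hclass \<Rightarrow> bool" where
  "is_product c1 c2 c \<longleftrightarrow> (\<exists>H1\<in>c1. \<exists>H2\<in>c2. nlab H1 = nlab H2 \<and> hcls (glue H1 H2) = c)"


section \<open>Formal series\<close>

type_synonym series = "hclass \<Rightarrow> real"

definition Qhat :: "nat \<Rightarrow> series set" where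
  "Qhat k = {a. \<forall>c. a c \<noteq> 0 \<longrightarrow> (\<exists>n. c \<in> HH n k)}"

definition Q :: "nat \<Rightarrow> series set" where
  "Q k = {a \<in> Qhat k. finite {c. a c \<noteq> 0}}"

definition QN :: "series set" where
  "QN = (\<Union>k. Q k)"

definition l1 :: "nat \<Rightarrow> series \<Rightarrow> nat \<Rightarrow> real" where
  "l1 k a n = (\<Sum>c\<in>HH n k. \<bar>a c\<bar>)"

text \<open>
  Radius of convergence greater than \<open>R\<close>; as no radius exceeds \<open>\<infinity>\<close>, for \<open>R = \<infinity>\<close> this is read as
  infinite radius (for \<open>R < \<infinity>\<close> the second disjunct is redundant).
\<close>

definition QR :: "nat \<Rightarrow> ereal \<Rightarrow> series set" where
  "QR k R = {a \<in> Qhat k. R < conv_radius (l1 k a) \<or> conv_radius (l1 k a) = \<infinity>}"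

definition QNR :: "ereal \<Rightarrow> series set" where
  "QNR R = (\<Union>k. QR k R)"

definition trunc :: "nat \<Rightarrow> series \<Rightarrow> series" where
  "trunc N a = (\<lambda>c. if \<exists>n<N. \<exists>k. c \<in> HH n k then a c else 0)"

definition sone :: series where
  "sone = (\<lambda>c. if c = hcls \<lparr>nlab = 0, verts = {}, edges = {#}, lab = (\<lambda>_. 0)\<rparr> then 1 else 0)"

definition smult :: "series \<Rightarrow> series \<Rightarrow> series" where
  "smult a b = (\<lambda>c. \<Sum>(c1, c2) | c1 \<in> Hall \<and> c2 \<in> Hall \<and> is_product c1 c2 c. a c1 * b c2)"


section \<open>Kernels and homomorphism densities\<close>

text \<open>
  Kernels are everywhere-defined and Borel measurable: the sections at the fixed points
  \<open>x i\<close>, which enter the densities, are then measurable too (this may fail for kernels that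
  are only Lebesgue measurable).
\<close>

definition W :: "real \<Rightarrow> (real \<times> real \<Rightarrow> real) set" where
  "W s = {f \<in> ({0..1} \<times> {0..1}) \<rightarrow>\<^sub>E {-s..s}.
            f \<in> borel_measurable (restrict_space borel ({0..1} \<times> {0..1})) \<and>
            (\<forall>u\<in>{0..1}. \<forall>v\<in>{0..1}. f (u, v) = f (v, u))}"

type_synonym wfun = "(real \<times> real \<Rightarrow> real) \<Rightarrow> real"

definition Func :: "real \<Rightarrow> wfun set" where
  "Func s = W s \<rightarrow>\<^sub>E UNIV"

definition point_of :: "(nat \<Rightarrow> real) \<Rightarrow> lmgraph \<Rightarrow> (nat \<Rightarrow> real) \<Rightarrow> nat \<Rightarrow> real" where
  "point_of x H y v =
     (if v \<in> lab H ` {1..nlab H} then x (inv_into {1..nlab H} (lab H) v) else y v)"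

text \<open>
  An edge \<open>e\<close> is oriented from \<open>Min e\<close> to \<open>Max e\<close>, which is immaterial for symmetric \<open>f\<close>.
\<close>

definition density :: "(nat \<Rightarrow> real) \<Rightarrow> lmgraph \<Rightarrow> (real \<times> real \<Rightarrow> real) \<Rightarrow> real" where
  "density x H f =
     (LINT y | (\<Pi>\<^sub>M v\<in>unlabelled H. restrict_space lborel {0..1}).
        (\<Prod>e\<in>#edges H. f (point_of x H y (Min e), point_of x H y (Max e))))"

text \<open>The density does not depend on the representative of the class.\<close>

definition tdens :: "(nat \<Rightarrow> real) \<Rightarrow> hclass \<Rightarrow> (real \<times> real \<Rightarrow> real) \<Rightarrow> real" where
  "tdens x c f = density x (SOME H. H \<in> c) f"

definition alpha :: "(nat \<Rightarrow> real) \<Rightarrow> real \<Rightarrow> series \<Rightarrow> wfun" where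
  "alpha x s a = (\<lambda>f\<in>W s. \<Sum>c | a c \<noteq> 0. a c * tdens x c f)"


section \<open>Algebra homomorphisms\<close>

definition subalgebra_series :: "series set \<Rightarrow> bool" where
  "subalgebra_series A \<longleftrightarrow> sone \<in> A \<and>
     (\<forall>a\<in>A. \<forall>b\<in>A. (\<lambda>c. a c + b c) \<in> A \<and> smult a b \<in> A) \<and>
     (\<forall>r. \<forall>a\<in>A. (\<lambda>c. r * a c) \<in> A)"

definition alg_hom :: "real \<Rightarrow> series set \<Rightarrow> (series \<Rightarrow> wfun) \<Rightarrow> bool" where
  "alg_hom s A \<beta> \<longleftrightarrow> subalgebra_series A \<and> (\<forall>a\<in>A. \<beta> a \<in> Func s) \<and>
     (\<forall>f\<in>W s. \<beta> sone f = 1 \<and>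
        (\<forall>r. \<forall>a\<in>A. \<beta> (\<lambda>c. r * a c) f = r * \<beta> a f) \<and>
        (\<forall>a\<in>A. \<forall>b\<in>A. \<beta> (\<lambda>c. a c + b c) f = \<beta> a f + \<beta> b f \<and>
                       \<beta> (smult a b) f = \<beta> a f * \<beta> b f))"

definition alg_embedding :: "real \<Rightarrow> series set \<Rightarrow> (series \<Rightarrow> wfun) \<Rightarrow> bool" where
  "alg_embedding s A \<beta> \<longleftrightarrow> alg_hom s A \<beta> \<and> inj_on \<beta> A"


section \<open>Topologies\<close>

text \<open>The topology of the grading by number of edges.\<close>

definition hat_top :: "nat \<Rightarrow> series topology" where
  "hat_top k = topology (\<lambda>U. U \<subseteq> Qhat k \<and>
     (\<forall>a\<in>U. \<exists>N. \<forall>b\<in>Qhat k. (\<forall>n<N. \<forall>c\<in>HH n k. b c = a c) \<longrightarrow> b \<in> U))"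

lemma openin_hat_top:
  "openin (hat_top k) U \<longleftrightarrow> U \<subseteq> Qhat k \<and>
     (\<forall>a\<in>U. \<exists>N. \<forall>b\<in>Qhat k. (\<forall>n<N. \<forall>c\<in>HH n k. b c = a c) \<longrightarrow> b \<in> U)"
proof -
  have "istopology (\<lambda>U. U \<subseteq> Qhat k \<and>
     (\<forall>a\<in>U. \<exists>N. \<forall>b\<in>Qhat k. (\<forall>n<N. \<forall>c\<in>HH n k. b c = a c) \<longrightarrow> b \<in> U))"
    unfolding istopology_def
  proof (intro conjI allI impI; (elim conjE)?)
    fix S T :: "series set"
    assume "S \<subseteq> Qhat k"
    then show "S \<inter> T \<subseteq> Qhat k" by blast
  next
    fix S T :: "series set"
    assume S: "\<forall>a\<in>S. \<exists>N. \<forall>b\<in>Qhat k. (\<forall>n<N. \<forall>c\<in>HH n k. b c = a c) \<longrightarrow> b \<in> S"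
      and T: "\<forall>a\<in>T. \<exists>N. \<forall>b\<in>Qhat k. (\<forall>n<N. \<forall>c\<in>HH n k. b c = a c) \<longrightarrow> b \<in> T"
    show "\<forall>a\<in>S \<inter> T. \<exists>N. \<forall>b\<in>Qhat k. (\<forall>n<N. \<forall>c\<in>HH n k. b c = a c) \<longrightarrow> b \<in> S \<inter> T"
    proof
      fix a assume a: "a \<in> S \<inter> T"
      obtain N where N: "\<forall>b\<in>Qhat k. (\<forall>n<N. \<forall>c\<in>HH n k. b c = a c) \<longrightarrow> b \<in> S"
        using S a by blast
      obtain M where M: "\<forall>b\<in>Qhat k. (\<forall>n<M. \<forall>c\<in>HH n k. b c = a c) \<longrightarrow> b \<in> T"
        using T a by blast
      show "\<exists>N. \<forall>b\<in>Qhat k. (\<forall>n<N. \<forall>c\<in>HH n k. b c = a c) \<longrightarrow> b \<in> S \<inter> T"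
        using N M by (intro exI[of _ "max N M"]) (simp add: less_max_iff_disj)
    qed
  next
    fix \<K> :: "series set set"
    assume K: "\<forall>K\<in>\<K>. K \<subseteq> Qhat k \<and>
      (\<forall>a\<in>K. \<exists>N. \<forall>b\<in>Qhat k. (\<forall>n<N. \<forall>c\<in>HH n k. b c = a c) \<longrightarrow> b \<in> K)"
    show "\<Union> \<K> \<subseteq> Qhat k"
      by (rule Union_least) (use K in blast)
  next
    fix \<K> :: "series set set"
    assume K: "\<forall>K\<in>\<K>. K \<subseteq> Qhat k \<and>
      (\<forall>a\<in>K. \<exists>N. \<forall>b\<in>Qhat k. (\<forall>n<N. \<forall>c\<in>HH n k. b c = a c) \<longrightarrow> b \<in> K)"
    show "\<forall>a\<in>\<Union> \<K>. \<exists>N. \<forall>b\<in>Qhat k. (\<forall>n<N. \<forall>c\<in>HH n k. b c = a c) \<longrightarrow> b \<in> \<Union> \<K>"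
    proof
      fix a assume "a \<in> \<Union> \<K>"
      then obtain L where L: "L \<in> \<K>" "a \<in> L" by blast
      obtain N where "\<forall>b\<in>Qhat k. (\<forall>n<N. \<forall>c\<in>HH n k. b c = a c) \<longrightarrow> b \<in> L"
        using K[rule_format, OF L(1)] L(2) by blast
      then show "\<exists>N. \<forall>b\<in>Qhat k. (\<forall>n<N. \<forall>c\<in>HH n k. b c = a c) \<longrightarrow> b \<in> \<Union> \<K>"
        using L(1) by (intro exI[of _ N]) auto
    qed
  qed
  then show ?thesis unfolding hat_top_def by (simp add: topology_inverse')
qed

text \<open>The topology of uniform convergence.\<close>

definition unif_top :: "real \<Rightarrow> wfun topology" where
  "unif_top s = topology (\<lambda>U. U \<subseteq> Func s \<and>
     (\<forall>g\<in>U. \<exists>\<epsilon>>0. \<forall>h\<in>Func s. (\<forall>f\<in>W s. \<bar>h f - g f\<bar> < \<epsilon>) \<longrightarrow> h \<in> U))"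

lemma openin_unif_top:
  "openin (unif_top s) U \<longleftrightarrow> U \<subseteq> Func s \<and>
     (\<forall>g\<in>U. \<exists>\<epsilon>>0. \<forall>h\<in>Func s. (\<forall>f\<in>W s. \<bar>h f - g f\<bar> < \<epsilon>) \<longrightarrow> h \<in> U)"
proof -
  have "istopology (\<lambda>U. U \<subseteq> Func s \<and>
     (\<forall>g\<in>U. \<exists>\<epsilon>>0. \<forall>h\<in>Func s. (\<forall>f\<in>W s. \<bar>h f - g f\<bar> < \<epsilon>) \<longrightarrow> h \<in> U))"
    unfolding istopology_def
  proof (intro conjI allI impI; (elim conjE)?)
    fix S T :: "wfun set"
    assume "S \<subseteq> Func s"
    then show "S \<inter> T \<subseteq> Func s" by blast
  next
    fix S T :: "wfun set"
    assume S: "\<forall>g\<in>S. \<exists>\<epsilon>>0. \<forall>h\<in>Func s. (\<forall>f\<in>W s. \<bar>h f - g f\<bar> < \<epsilon>) \<longrightarrow> h \<in> S"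
      and T: "\<forall>g\<in>T. \<exists>\<epsilon>>0. \<forall>h\<in>Func s. (\<forall>f\<in>W s. \<bar>h f - g f\<bar> < \<epsilon>) \<longrightarrow> h \<in> T"
    show "\<forall>g\<in>S \<inter> T. \<exists>\<epsilon>>0. \<forall>h\<in>Func s. (\<forall>f\<in>W s. \<bar>h f - g f\<bar> < \<epsilon>) \<longrightarrow> h \<in> S \<inter> T"
    proof
      fix g assume g: "g \<in> S \<inter> T"
      obtain d where d: "d > 0" "\<forall>h\<in>Func s. (\<forall>f\<in>W s. \<bar>h f - g f\<bar> < d) \<longrightarrow> h \<in> S"
        using S g by blast
      obtain e where e: "e > 0" "\<forall>h\<in>Func s. (\<forall>f\<in>W s. \<bar>h f - g f\<bar> < e) \<longrightarrow> h \<in> T"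
        using T g by blast
      show "\<exists>\<epsilon>>0. \<forall>h\<in>Func s. (\<forall>f\<in>W s. \<bar>h f - g f\<bar> < \<epsilon>) \<longrightarrow> h \<in> S \<inter> T"
        using d e by (intro exI[of _ "min d e"]) simp
    qed
  next
    fix \<K> :: "wfun set set"
    assume K: "\<forall>K\<in>\<K>. K \<subseteq> Func s \<and>
      (\<forall>g\<in>K. \<exists>\<epsilon>>0. \<forall>h\<in>Func s. (\<forall>f\<in>W s. \<bar>h f - g f\<bar> < \<epsilon>) \<longrightarrow> h \<in> K)"
    show "\<Union> \<K> \<subseteq> Func s"
      by (rule Union_least) (use K in blast)
  next
    fix \<K> :: "wfun set set"
    assume K: "\<forall>K\<in>\<K>. K \<subseteq> Func s \<and>
      (\<forall>g\<in>K. \<exists>\<epsilon>>0. \<forall>h\<in>Func s. (\<forall>f\<in>W s. \<bar>h f - g f\<bar> < \<epsilon>) \<longrightarrow> h \<in> K)"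
    show "\<forall>g\<in>\<Union> \<K>. \<exists>\<epsilon>>0. \<forall>h\<in>Func s. (\<forall>f\<in>W s. \<bar>h f - g f\<bar> < \<epsilon>) \<longrightarrow> h \<in> \<Union> \<K>"
    proof
      fix g assume "g \<in> \<Union> \<K>"
      then obtain L where L: "L \<in> \<K>" "g \<in> L" by blast
      obtain e where "e > 0" "\<forall>h\<in>Func s. (\<forall>f\<in>W s. \<bar>h f - g f\<bar> < e) \<longrightarrow> h \<in> L"
        using K[rule_format, OF L(1)] L(2) by blast
      then show "\<exists>\<epsilon>>0. \<forall>h\<in>Func s. (\<forall>f\<in>W s. \<bar>h f - g f\<bar> < \<epsilon>) \<longrightarrow> h \<in> \<Union> \<K>"
        using L(1) by (intro exI[of _ e]) auto
    qed
  qed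
  then show ?thesis unfolding unif_top_def by (simp add: topology_inverse')
qed

text \<open>
  The homomorphism is not continuous at 0 on the whole of \<open>Q k\<close> for these two topologies: for
  a graph \<open>H\<close> with \<open>n\<close> edges the series \<open>s\<^sup>-\<^sup>n H\<close> tends to 0 in \<open>hat_top k\<close> as \<open>n\<close> grows, but takes
  the value 1 at the constant kernel \<open>s\<close>. Continuity is therefore a statement about sets that
  are bounded for the weight \<open>r\<^sup>n\<close>, with some \<open>r > s\<close>; every element of \<open>QR k R\<close> with
  \<open>s < R\<close> lies, together with all its truncations, in such a set.
\<close>

definition weight_ball :: "nat \<Rightarrow> real \<Rightarrow> real \<Rightarrow> series set" where
  "weight_ball k r C = {a \<in> Qhat k. \<forall>n. l1 k a n * r ^ n \<le> C}"

definition continuous_extension ::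
    "(nat \<Rightarrow> real) \<Rightarrow> real \<Rightarrow> ereal \<Rightarrow> (series \<Rightarrow> wfun) \<Rightarrow> bool" where
  "continuous_extension x s R \<beta> \<longleftrightarrow>
     (\<forall>a\<in>QN. \<beta> a = alpha x s a) \<and>
     (\<forall>k r C. s < r \<longrightarrow>
        continuous_map (subtopology (hat_top k) (QR k R \<inter> weight_ball k r C)) (unif_top s) \<beta>) \<and>
     (\<forall>a\<in>QNR R. uniform_limit (W s) (\<lambda>N. alpha x s (trunc N a)) (\<beta> a) sequentially)"

end

theory Submission
  imports Defs "HOL-Probability.Probability"
begin

text \<open>
  A \<open>k\<close>-labelled multigraph without unlabelled isolated vertices is encoded by its multiset of
  edges, up to renaming of the unlabelled vertices. Since a graph with \<open>n\<close> edges has density at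
  most \<open>s\<^sup>n\<close> in absolute value on \<open>W s\<close>, series of radius larger than \<open>s\<close> converge absolutely and
  uniformly, which gives the extension; it is multiplicative by regrouping the double sum along
  the finite fibres of the product.

  For injectivity, replacing \<open>f\<close> by \<open>t f\<close> separates the homogeneous components. If a combination of
  graphs with \<open>n\<close> edges vanishes, let \<open>G\<close> be a graph occurring in it with the largest number of
  unlabelled vertices, and evaluate at step kernels supported on the edges of \<open>G\<close>, with the
  labelled vertices placed at the distinct points \<open>x i\<close> and the unlabelled ones at intervals. The
  result is a polynomial in the values of the kernel. The coefficient of the monomial \<open>G\<close> counts
  the maps of graphs \<open>H\<close> onto \<open>G\<close> that fix the labels; by maximality these are isomorphisms, so only
  \<open>H = G\<close> contributes.
\<close>

text \<open>The obstacle to a direct treatment is the number of labels: a class in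
  \<open>HH n k\<close> also contains graphs with other numbers of labels. The edge multiset does
  not see isolated labelled vertices, so one code serves all \<open>k\<close>, and the extension can
  be a single unordered sum over \<open>Hall\<close>; a value of \<open>k\<close> enters only the
  estimates. For injectivity, the cells of labels are single points, so a map sending a free vertex
  to a labelled one has volume zero. The maps that count therefore send the free vertices of
  \<open>H\<close> onto those of \<open>G\<close>. This is why the number of free vertices is the
  quantity to maximise: a surjection that cannot lower the number is a bijection. The kernel takes
  the values \<open>s * z ^ w e\<close> on the edges of \<open>G\<close>, with one parameter
  \<open>z\<close> and weights \<open>w\<close> that tell edge multisets apart; this replaces a
  polynomial in many variables by one in \<open>z\<close>.\<close>

text \<open>
  \<open>Inl i\<close> is the vertex with label \<open>i\<close>, \<open>Inr v\<close> an unlabelled vertex. Isolated labelled vertices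
  leave no trace, so that adding labels does not change the encoding.
\<close>

type_synonym edge_mset = "(nat + nat) set multiset"

section \<open>Edge multisets up to renaming of free vertices\<close>

definition free_verts :: "edge_mset \<Rightarrow> nat set" where
  "free_verts E = {v. \<exists>e\<in>#E. Inr v \<in> e}"

definition rename :: "(nat \<Rightarrow> nat) \<Rightarrow> edge_mset \<Rightarrow> edge_mset" where
  "rename \<pi> E = image_mset ((`) (map_sum id \<pi>)) E"

text \<open>Injectivity is asked only on the free vertices, so a renaming never has to be extended
  to a permutation of \<open>nat\<close>.\<close>

definition edge_equiv :: "edge_mset \<Rightarrow> edge_mset \<Rightarrow> bool" where
  "edge_equiv E E' \<longleftrightarrow> (\<exists>\<pi>. inj_on \<pi> (free_verts E) \<and> E' = rename \<pi> E)"

text \<open>Not every label has to occur: a label missing from all edges stands for an isolated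
  labelled vertex, so the condition weakens as \<open>k\<close> grows.\<close>

definition edges_on :: "nat \<Rightarrow> edge_mset \<Rightarrow> bool" where
  "edges_on k E \<longleftrightarrow> (\<forall>e\<in>#E. card e = 2 \<and> e \<subseteq> Inl ` {1..k} \<union> range Inr)"

lemma free_verts_rename: "free_verts (rename \<pi> E) = \<pi> ` free_verts E"
proof -
  have "Inr v \<in> map_sum id \<pi> ` e \<longleftrightarrow> (\<exists>u. Inr u \<in> e \<and> v = \<pi> u)" for v and e :: "(nat + nat) set"
  proof
    assume "Inr v \<in> map_sum id \<pi> ` e"
    then obtain p where "p \<in> e" "Inr v = map_sum id \<pi> p" by auto
    then show "\<exists>u. Inr u \<in> e \<and> v = \<pi> u" by (cases p) auto
  next
    assume "\<exists>u. Inr u \<in> e \<and> v = \<pi> u"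
    then obtain u where u: "Inr u \<in> e" "v = \<pi> u" by auto
    then have "Inr v = map_sum id \<pi> (Inr u)" by simp
    then show "Inr v \<in> map_sum id \<pi> ` e" using u by (metis image_eqI)
  qed
  then show ?thesis unfolding free_verts_def rename_def by auto
qed

lemma rename_cong:
  assumes "\<And>v. v \<in> free_verts E \<Longrightarrow> \<pi> v = \<rho> v"
  shows "rename \<pi> E = rename \<rho> E"
  unfolding rename_def
proof (rule image_mset_cong)
  fix e assume e: "e \<in># E"
  show "map_sum id \<pi> ` e = map_sum id \<rho> ` e"
  proof (rule image_cong[OF refl])
    fix p assume "p \<in> e"
    then show "map_sum id \<pi> p = map_sum id \<rho> p"
      using assms e by (cases p) (auto simp: free_verts_def)
  qed
qed

lemma rename_rename: "rename \<pi> (rename \<rho> E) = rename (\<pi> \<circ> \<rho>) E"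
  by (simp add: rename_def multiset.map_comp o_def image_image sum.map_comp id_def)

lemma rename_id: "rename (\<lambda>v. v) E = E"
  by (simp add: rename_def flip: id_def add: sum.map_id0)

lemma edge_equiv_sym: assumes "edge_equiv E E'" shows "edge_equiv E' E"
proof -
  obtain \<pi> where p: "inj_on \<pi> (free_verts E)" "E' = rename \<pi> E"
    using assms by (auto simp: edge_equiv_def)
  let ?r = "inv_into (free_verts E) \<pi>"
  have "rename ?r E' = rename (\<lambda>v. v) E"
    unfolding p(2) rename_rename by (rule rename_cong) (simp add: p(1))
  moreover have "inj_on ?r (free_verts E')"
    unfolding p(2) free_verts_rename by (rule inj_on_inv_into) simp
  ultimately show ?thesis unfolding edge_equiv_def by (metis rename_id)
qed

lemma edge_equiv_trans:
  assumes "edge_equiv E E'" "edge_equiv E' E''" shows "edge_equiv E E''"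
proof -
  obtain \<pi> where p: "inj_on \<pi> (free_verts E)" "E' = rename \<pi> E"
    using assms by (auto simp: edge_equiv_def)
  obtain \<rho> where r: "inj_on \<rho> (free_verts E')" "E'' = rename \<rho> E'"
    using assms by (auto simp: edge_equiv_def)
  have "inj_on (\<rho> \<circ> \<pi>) (free_verts E)"
    using p r by (auto simp: free_verts_rename intro: comp_inj_on)
  moreover have "E'' = rename (\<rho> \<circ> \<pi>) E" using p r by (simp add: rename_rename)
  ultimately show ?thesis unfolding edge_equiv_def by blast
qed

lemma finite_free_verts: assumes "edges_on k E" shows "finite (free_verts E)"
proof -
  have "free_verts E \<subseteq> (\<Union>e\<in>set_mset E. Inr -` e)" by (auto simp: free_verts_def)
  moreover have "finite (\<Union>e\<in>set_mset E. Inr -` e)"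
  proof (intro finite_UN_I finite_set_mset)
    fix e assume "e \<in># E"
    then have "finite e" using assms by (auto simp: edges_on_def intro: card_ge_0_finite)
    then show "finite (Inr -` e :: nat set)" by (rule finite_vimageI) simp
  qed
  ultimately show ?thesis by (rule finite_subset)
qed

lemma size_rename [simp]: "size (rename \<pi> E) = size E"
  by (simp add: rename_def)

lemma inj_on_map_sum:
  assumes "inj_on \<pi> (free_verts E)" "e \<in># E"
  shows "inj_on (map_sum id \<pi>) e"
proof (rule inj_onI)
  fix p q assume "p \<in> e" "q \<in> e" "map_sum id \<pi> p = map_sum id \<pi> q"
  then show "p = q" using assms
    by (cases p; cases q) (auto simp: free_verts_def dest: inj_onD)
qed

lemma edges_on_rename:
  assumes "edges_on k E" "inj_on \<pi> (free_verts E)" shows "edges_on k (rename \<pi> E)"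
  unfolding edges_on_def
proof
  fix e assume "e \<in># rename \<pi> E"
  then obtain d where d: "d \<in># E" "e = map_sum id \<pi> ` d" by (auto simp: rename_def)
  then have "card d = 2" "d \<subseteq> Inl ` {1..k} \<union> range Inr" using assms by (auto simp: edges_on_def)
  moreover have "card e = card d"
    using inj_on_map_sum[OF assms(2) d(1)] d(2) by (simp add: card_image)
  moreover have "map_sum id \<pi> p \<in> Inl ` {1..k} \<union> range Inr" if "p \<in> d" for p
    using that \<open>d \<subseteq> _\<close> by (cases p) auto
  ultimately show "card e = 2 \<and> e \<subseteq> Inl ` {1..k} \<union> range Inr" using d(2) by auto
qed

lemma edges_on_rename_iff:
  assumes "inj_on \<pi> (free_verts E)" shows "edges_on k (rename \<pi> E) \<longleftrightarrow> edges_on k E"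
proof
  have "edge_equiv (rename \<pi> E) E"
    by (rule edge_equiv_sym) (use assms in \<open>auto simp: edge_equiv_def\<close>)
  then obtain \<rho> where "inj_on \<rho> (free_verts (rename \<pi> E))" "E = rename \<rho> (rename \<pi> E)"
    unfolding edge_equiv_def by blast
  then show "edges_on k (rename \<pi> E) \<Longrightarrow> edges_on k E" using edges_on_rename by metis
qed (rule edges_on_rename[OF _ assms])

lemma edge_equiv_edges_on: "edge_equiv E E' \<Longrightarrow> edges_on k E \<longleftrightarrow> edges_on k E'"
  by (auto simp: edge_equiv_def edges_on_rename_iff)

lemma edge_equiv_size: "edge_equiv E E' \<Longrightarrow> size E = size E'"
  by (auto simp: edge_equiv_def)

lemma edges_on_mono: "edges_on k E \<Longrightarrow> k \<le> l \<Longrightarrow> edges_on l E"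
proof -
  assume E: "edges_on k E" and "k \<le> l"
  then have "Inl ` {1..k} \<union> range Inr \<subseteq> Inl ` {1..l} \<union> (range Inr :: (nat + nat) set)"
    by (intro Un_mono image_mono) auto
  then show "edges_on l E" using E unfolding edges_on_def by (meson subset_trans)
qed

section \<open>Encoding labelled multigraphs by edge multisets\<close>

definition vertex_code :: "lmgraph \<Rightarrow> nat \<Rightarrow> nat + nat" where
  "vertex_code H v =
     (if v \<in> lab H ` {1..nlab H} then Inl (inv_into {1..nlab H} (lab H) v) else Inr v)"

definition edge_code :: "lmgraph \<Rightarrow> edge_mset" where
  "edge_code H = image_mset ((`) (vertex_code H)) (edges H)"

text \<open>These are the graphs represented in \<open>HH\<close>. Up to isomorphism, the code of
  such a graph forgets nothing but isolated labelled vertices.\<close>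

definition reduced :: "lmgraph \<Rightarrow> bool" where
  "reduced H \<longleftrightarrow> labelled_multigraph (nlab H) H \<and> (\<forall>v\<in>unlabelled H. \<exists>e\<in>#edges H. v \<in> e)"

text \<open>\<open>inv_into\<close> picks a preimage of each vertex in the image of
  \<open>lab H\<close>, and distinct vertices have disjoint sets of preimages.\<close>

lemma inj_vertex_code: "inj_on (vertex_code H) A"
  by (rule inj_onI) (auto simp: vertex_code_def split: if_splits dest: inv_into_injective)

lemma vertex_code_lab:
  "inj_on (lab H) {1..nlab H} \<Longrightarrow> i \<in> {1..nlab H} \<Longrightarrow> vertex_code H (lab H i) = Inl i"
  unfolding vertex_code_def by (simp del: atLeastAtMost_iff)

lemma vertex_code_unlabelled: "v \<in> unlabelled H \<Longrightarrow> vertex_code H v = Inr v"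
  by (auto simp: vertex_code_def unlabelled_def)

lemma vertex_code_Inr_iff: "v \<in> verts H \<Longrightarrow> vertex_code H v = Inr u \<longleftrightarrow> u = v \<and> v \<in> unlabelled H"
  by (auto simp: vertex_code_def unlabelled_def)

lemma vertex_code_cases:
  assumes "v \<in> verts H" "inj_on (lab H) {1..nlab H}"
  obtains (lab) i where "i \<in> {1..nlab H}" "v = lab H i" "vertex_code H v = Inl i"
        | (unlab) "v \<in> unlabelled H" "vertex_code H v = Inr v"
proof (cases "v \<in> unlabelled H")
  case True then show ?thesis using unlab vertex_code_unlabelled by blast
next
  case False
  then obtain i where "i \<in> {1..nlab H}" "v = lab H i" using assms by (auto simp: unlabelled_def)
  then show ?thesis using lab vertex_code_lab[OF assms(2)] by blast
qed

lemma free_verts_edge_code: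
  assumes "labelled_multigraph (nlab H) H"
  shows "free_verts (edge_code H) = {v \<in> unlabelled H. \<exists>e\<in>#edges H. v \<in> e}"
proof -
  have "Inr v \<in> vertex_code H ` e \<longleftrightarrow> v \<in> e \<and> v \<in> unlabelled H" if "e \<in># edges H" for e v
  proof -
    have "e \<subseteq> verts H" using assms that by (auto simp: labelled_multigraph_def)
    then show ?thesis
      by (auto simp: image_iff vertex_code_unlabelled) (metis vertex_code_Inr_iff subsetD)+
  qed
  then show ?thesis by (auto simp: free_verts_def edge_code_def)
qed

lemma free_verts_reduced: "reduced H \<Longrightarrow> free_verts (edge_code H) = unlabelled H"
  by (auto simp: reduced_def free_verts_edge_code)

lemma edges_on_edge_code:
  assumes "labelled_multigraph k H" shows "edges_on k (edge_code H)"
  unfolding edges_on_def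
proof
  have k: "nlab H = k" and inj: "inj_on (lab H) {1..nlab H}"
    using assms by (auto simp: labelled_multigraph_def)
  fix d assume "d \<in># edge_code H"
  then obtain e where e: "e \<in># edges H" "d = vertex_code H ` e" by (auto simp: edge_code_def)
  have "card e = 2" "e \<subseteq> verts H" using assms e by (auto simp: labelled_multigraph_def)
  then have "card d = 2" using e by (simp add: card_image inj_vertex_code)
  moreover have "vertex_code H v \<in> Inl ` {1..k} \<union> range Inr" if "v \<in> e" for v
    using \<open>e \<subseteq> verts H\<close> that by (cases rule: vertex_code_cases[of v H, OF _ inj]) (auto simp: k)
  ultimately show "card d = 2 \<and> d \<subseteq> Inl ` {1..k} \<union> range Inr" using e by auto
qed

lemma size_edge_code [simp]: "size (edge_code H) = size (edges H)"
  by (simp add: edge_code_def)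

lemma add_label_unfold:
  assumes "labelled_multigraph k H"
  obtains v where "v \<notin> verts H" "add_label H = \<lparr>nlab = Suc k, verts = insert v (verts H),
    edges = edges H, lab = (lab H)(Suc k := v)\<rparr>"
proof -
  define v where "v = (LEAST v. v \<notin> verts H)"
  have "v \<notin> verts H"
    unfolding v_def using assms by (intro fresh_vertex) (simp add: labelled_multigraph_def)
  moreover have "nlab H = k" using assms by (simp add: labelled_multigraph_def)
  ultimately show ?thesis using that by (simp add: add_label_def v_def Let_def)
qed

text \<open>The new labelled vertex lies on no edge and the old vertices keep their labels.\<close>

lemma edge_code_add_label:
  assumes H: "labelled_multigraph k H"
  shows "edge_code (add_label H) = edge_code H"
proof -
  obtain v where v: "v \<notin> verts H" and eq: "add_label H = \<lparr>nlab = Suc k, verts = insert v (verts H),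
    edges = edges H, lab = (lab H)(Suc k := v)\<rparr>"
    using add_label_unfold[OF H] .
  have k: "nlab H = k" and inj: "inj_on (lab H) {1..nlab H}" and sub: "lab H ` {1..k} \<subseteq> verts H"
    using H by (auto simp: labelled_multigraph_def)
  have inj': "inj_on (lab (add_label H)) {1..nlab (add_label H)}"
    using labelled_multigraph_add_label[OF H] by (auto simp: labelled_multigraph_def)
  have "vertex_code (add_label H) u = vertex_code H u" if u: "u \<in> verts H" for u
    using u inj
  proof (cases rule: vertex_code_cases)
    case (lab i)
    then have "u = lab (add_label H) i" "i \<in> {1..nlab (add_label H)}" by (auto simp: eq k)
    then show ?thesis using vertex_code_lab[OF inj'] lab by metis
  next
    case unlab
    then have "u \<notin> lab (add_label H) ` {1..nlab (add_label H)}"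
      using u v by (auto simp: eq unlabelled_def k le_Suc_eq split: if_splits)
    then show ?thesis using unlab(2) by (simp add: vertex_code_def)
  qed
  moreover have "e \<subseteq> verts H" if "e \<in># edges H" for e
    using that H by (auto simp: labelled_multigraph_def)
  moreover have "edges (add_label H) = edges H" by (simp add: eq)
  ultimately show ?thesis unfolding edge_code_def
    by (auto intro!: image_mset_cong image_cong)
qed

lemma reduced_add_label:
  assumes H: "labelled_multigraph k H"
  shows "reduced (add_label H) \<longleftrightarrow> reduced H"
proof -
  obtain v where v: "v \<notin> verts H" and eq: "add_label H = \<lparr>nlab = Suc k, verts = insert v (verts H),
    edges = edges H, lab = (lab H)(Suc k := v)\<rparr>"
    using add_label_unfold[OF H] .
  have k: "nlab H = k" and sub: "lab H ` {1..k} \<subseteq> verts H"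
    using H by (auto simp: labelled_multigraph_def)
  have "unlabelled (add_label H) = unlabelled H"
    using v sub k unfolding unlabelled_def eq by (auto simp: image_iff le_Suc_eq)
  then show ?thesis
    using H labelled_multigraph_add_label[OF H] k by (auto simp: reduced_def eq)
qed

lemma labelled_multigraph_funpow:
  "labelled_multigraph k H \<Longrightarrow> labelled_multigraph (k + i) ((add_label ^^ i) H)"
  by (induction i) (auto simp: labelled_multigraph_add_label)

lemma edge_code_funpow:
  "labelled_multigraph k H \<Longrightarrow> edge_code ((add_label ^^ i) H) = edge_code H"
  by (induction i) (auto simp: edge_code_add_label[OF labelled_multigraph_funpow])

lemma reduced_funpow:
  "labelled_multigraph k H \<Longrightarrow> reduced ((add_label ^^ i) H) \<longleftrightarrow> reduced H"
  by (induction i) (auto simp: reduced_add_label[OF labelled_multigraph_funpow])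

section \<open>Isomorphism of graphs against equivalence of codes\<close>

lemma lmg_iso_facts:
  assumes H: "labelled_multigraph k H" and H': "labelled_multigraph k H'"
    and iso: "lmg_iso H H'"
  shows "edge_equiv (edge_code H) (edge_code H')" and "reduced H \<Longrightarrow> reduced H'"
proof -
  obtain \<phi> where p: "bij_betw \<phi> (verts H) (verts H')"
      "image_mset ((`) \<phi>) (edges H) = edges H'"
      "\<And>i. i\<in>{1..k} \<Longrightarrow> \<phi> (lab H i) = lab H' i"
    using iso H unfolding lmg_iso_def labelled_multigraph_def by auto
  have k: "nlab H = k" "nlab H' = k" using H H' by (auto simp: labelled_multigraph_def)
  have inj: "inj_on (lab H) {1..nlab H}" "inj_on (lab H') {1..nlab H'}"
    and sub: "lab H ` {1..k} \<subseteq> verts H"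
    using H H' by (auto simp: labelled_multigraph_def)
  have injp: "inj_on \<phi> (verts H)" using p(1) by (simp add: bij_betw_def)
  have im: "lab H' ` {1..k} = \<phi> ` lab H ` {1..k}"
    unfolding image_image using p(3) by (intro image_cong) auto
  \<comment> \<open>Labels are matched with labels, hence unlabelled vertices with unlabelled ones,
    and \<open>\<phi>\<close> itself renames the code.\<close>
  have un: "\<phi> ` unlabelled H = unlabelled H'"
    unfolding unlabelled_def k im using p(1) inj_on_image_set_diff[OF injp, of "verts H" "lab H ` {1..k}"] sub
    by (simp add: bij_betw_def)
  have vc: "vertex_code H' (\<phi> v) = map_sum id \<phi> (vertex_code H v)" if v: "v \<in> verts H" for v
    using v inj(1)
  proof (cases rule: vertex_code_cases)
    case (lab i)
    then have "vertex_code H' (lab H' i) = Inl i" using vertex_code_lab[OF inj(2)] k by simp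
    then show ?thesis using lab p(3)[of i] k by simp
  next
    case unlab
    then have "\<phi> v \<in> unlabelled H'" using un by blast
    then show ?thesis using unlab by (simp add: vertex_code_unlabelled)
  qed
  have ed: "e \<subseteq> verts H" if "e \<in># edges H" for e using that H by (auto simp: labelled_multigraph_def)
  have "edge_code H' = rename \<phi> (edge_code H)"
    unfolding edge_code_def rename_def p(2)[symmetric] multiset.map_comp
    using ed by (intro image_mset_cong) (auto simp: image_image vc subset_iff intro!: image_cong)
  moreover have "inj_on \<phi> (free_verts (edge_code H))"
    by (rule inj_on_subset[OF injp])
       (use H k in \<open>auto simp: free_verts_edge_code unlabelled_def\<close>)
  ultimately show "edge_equiv (edge_code H) (edge_code H')" unfolding edge_equiv_def by blast
  show "reduced H'" if g: "reduced H"
    unfolding reduced_def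
  proof (intro conjI ballI)
    fix v assume "v \<in> unlabelled H'"
    then obtain u where u: "u \<in> unlabelled H" "v = \<phi> u" using un by blast
    then obtain e where "e \<in># edges H" "u \<in> e" using g by (auto simp: reduced_def)
    then show "\<exists>e\<in>#edges H'. v \<in> e" using u(2) unfolding p(2)[symmetric] by auto
  qed (use H' k in simp)
qed

lemma edge_equiv_imp_lmg_iso:
  assumes H: "reduced H" and H': "reduced H'" and k: "nlab H = nlab H'"
    and eqv: "edge_equiv (edge_code H) (edge_code H')"
  shows "lmg_iso H H'"
proof -
  obtain \<pi> where pi: "inj_on \<pi> (free_verts (edge_code H))" "edge_code H' = rename \<pi> (edge_code H)"
    using eqv by (auto simp: edge_equiv_def)
  have fv: "free_verts (edge_code H) = unlabelled H" "free_verts (edge_code H') = unlabelled H'"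
    using H H' by (auto simp: free_verts_reduced)
  have un: "\<pi> ` unlabelled H = unlabelled H'"
    using fv pi(2) free_verts_rename by metis
  have L: "labelled_multigraph (nlab H) H" "labelled_multigraph (nlab H') H'"
    using H H' by (auto simp: reduced_def)
  have inj: "inj_on (lab H) {1..nlab H}" "inj_on (lab H') {1..nlab H'}"
    and sub: "lab H ` {1..nlab H} \<subseteq> verts H" "lab H' ` {1..nlab H'} \<subseteq> verts H'"
    using L by (auto simp: labelled_multigraph_def)
  \<comment> \<open>On a labelled vertex follow the label to \<open>H'\<close>, on an unlabelled one
    follow \<open>\<pi>\<close>.\<close>
  define \<phi> where "\<phi> v = case_sum (lab H') \<pi> (vertex_code H v)" for v
  have lab: "\<phi> (lab H i) = lab H' i" if "i \<in> {1..nlab H}" for i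
    using vertex_code_lab[OF inj(1) that] by (simp add: \<phi>_def)
  have ulb: "\<phi> v = \<pi> v" if "v \<in> unlabelled H" for v
    using vertex_code_unlabelled[OF that] by (simp add: \<phi>_def)
  have V: "verts H = lab H ` {1..nlab H} \<union> unlabelled H"
     "verts H' = lab H' ` {1..nlab H'} \<union> unlabelled H'"
     "lab H' ` {1..nlab H'} \<inter> unlabelled H' = {}"
    using sub by (auto simp: unlabelled_def)
  have im1: "\<phi> ` lab H ` {1..nlab H} = lab H' ` {1..nlab H'}"
    unfolding image_image using lab k by (intro image_cong) auto
  have im2: "\<phi> ` unlabelled H = unlabelled H'"
    using ulb un by (metis image_cong)
  have "inj_on \<phi> (lab H ` {1..nlab H})"
    using lab inj k by (intro inj_onI) (auto simp: inj_on_eq_iff)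
  moreover have "inj_on \<phi> (unlabelled H)"
    using pi(1) ulb fv by (simp add: inj_on_def)
  ultimately have bij: "bij_betw \<phi> (verts H) (verts H')"
    unfolding V(1) V(2)
    by (intro bij_betw_combine) (simp_all only: bij_betw_def im1 im2 V(3))
  have ed: "e \<subseteq> verts H" if "e \<in># edges H" for e using that L by (auto simp: labelled_multigraph_def)
  have vc: "vertex_code H' (\<phi> v) = map_sum id \<pi> (vertex_code H v)" if v: "v \<in> verts H" for v
    using v inj(1)
  proof (cases rule: vertex_code_cases)
    case (lab i)
    then have "vertex_code H' (lab H' i) = Inl i" using vertex_code_lab[OF inj(2)] k by simp
    then show ?thesis using lab \<open>\<And>i. i \<in> {1..nlab H} \<Longrightarrow> \<phi> (lab H i) = lab H' i\<close>[of i] by simp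
  next
    case unlab
    then have "\<phi> v \<in> unlabelled H'" using im2 by blast
    then show ?thesis using unlab ulb by (simp add: vertex_code_unlabelled)
  qed
  \<comment> \<open>The edges are compared after coding in \<open>H'\<close>; the map induced by the
    injective \<open>vertex_code H'\<close> can then be cancelled.\<close>
  have "image_mset ((`) (vertex_code H')) (image_mset ((`) \<phi>) (edges H)) =
      image_mset ((`) (vertex_code H')) (edges H')"
    using pi(2) unfolding edge_code_def rename_def multiset.map_comp
    by (simp only:) (use ed in \<open>auto simp: image_image vc subset_iff intro!: image_mset_cong image_cong\<close>)
  moreover have "inj (image_mset ((`) (vertex_code H')))"
    by (intro multiset.inj_map inj_on_image inj_vertex_code)
  ultimately have "image_mset ((`) \<phi>) (edges H) = edges H'" by (metis injD)
  then show ?thesis unfolding lmg_iso_def using bij lab k by blast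
qed

lemma stable_iso_iff_edge_equiv:
  assumes "reduced H" "reduced H'"
  shows "stable_iso H H' \<longleftrightarrow> edge_equiv (edge_code H) (edge_code H')"
proof
  have L: "labelled_multigraph (nlab H) H" "labelled_multigraph (nlab H') H'"
    using assms by (auto simp: reduced_def)
  assume "stable_iso H H'"
  then obtain i j where ij: "lmg_iso ((add_label ^^ i) H) ((add_label ^^ j) H')"
    by (auto simp: stable_iso_def)
  have "nlab H + i = nlab H' + j"
    using ij labelled_multigraph_funpow[OF L(1), of i] labelled_multigraph_funpow[OF L(2), of j]
    by (auto simp: lmg_iso_def labelled_multigraph_def)
  then show "edge_equiv (edge_code H) (edge_code H')"
    using lmg_iso_facts(1)[OF labelled_multigraph_funpow[OF L(1), of i] _ ij]
      labelled_multigraph_funpow[OF L(2), of j] edge_code_funpow L by metis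
next
  have L: "labelled_multigraph (nlab H) H" "labelled_multigraph (nlab H') H'"
    using assms by (auto simp: reduced_def)
  assume e: "edge_equiv (edge_code H) (edge_code H')"
  \<comment> \<open>Each graph receives as many labels as the other already has, so both end with
    \<open>nlab H + nlab H'\<close> labels.\<close>
  have "lmg_iso ((add_label ^^ nlab H') H) ((add_label ^^ nlab H) H')"
  proof (rule edge_equiv_imp_lmg_iso)
    show "nlab ((add_label ^^ nlab H') H) = nlab ((add_label ^^ nlab H) H')"
      using labelled_multigraph_funpow[OF L(1), of "nlab H'"]
        labelled_multigraph_funpow[OF L(2), of "nlab H"] by (simp add: labelled_multigraph_def)
  qed (use L assms e reduced_funpow edge_code_funpow in metis)+
  then show "stable_iso H H'" unfolding stable_iso_def by blast
qed

text \<open>Needed because \<open>hcls\<close> collects all stably isomorphic multigraphs: none of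
  them acquires an isolated unlabelled vertex.\<close>

lemma stable_iso_reduced:
  assumes "reduced H" "labelled_multigraph (nlab H') H'" "stable_iso H H'"
  shows "reduced H'"
proof -
  have L: "labelled_multigraph (nlab H) H" using assms by (auto simp: reduced_def)
  obtain i j where ij: "lmg_iso ((add_label ^^ i) H) ((add_label ^^ j) H')"
    using assms by (auto simp: stable_iso_def)
  have "nlab H + i = nlab H' + j"
    using ij labelled_multigraph_funpow[OF L(1), of i] labelled_multigraph_funpow[OF assms(2), of j]
    by (auto simp: lmg_iso_def labelled_multigraph_def)
  then show "reduced H'"
    using lmg_iso_facts(2)[OF labelled_multigraph_funpow[OF L(1), of i] _ ij]
      labelled_multigraph_funpow[OF assms(2), of j] reduced_funpow L assms by metis
qed

section \<open>Classes of edge multisets\<close>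

definition edge_class :: "edge_mset \<Rightarrow> hclass" where
  "edge_class E = {H. reduced H \<and> edge_equiv E (edge_code H)}"

text \<open>From here on classes are handled through codes. The same class arises for every
  admissible number of labels, which makes \<open>HH_mono\<close> a plain inclusion.\<close>

lemma hcls_reduced: "reduced H \<Longrightarrow> hcls H = edge_class (edge_code H)"
  unfolding hcls_def edge_class_def
  by (rule Collect_cong) (metis reduced_def stable_iso_reduced stable_iso_iff_edge_equiv)

text \<open>Unlabelled vertices \<open>v\<close> are moved to \<open>k + 1 + v\<close> to make room for the labels.\<close>

lemma edge_class_realised:
  assumes E: "edges_on k E"
  obtains H where "reduced H" "nlab H = k" "edge_equiv E (edge_code H)"
proof -
  define c where "c = case_sum id (\<lambda>v. k + 1 + v)"
  define H where "H = \<lparr>nlab = k, verts = {1..k} \<union> (\<lambda>v. k + 1 + v) ` free_verts E,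
     edges = image_mset ((`) c) E, lab = id\<rparr>"
  have inj: "inj_on c e" if "e \<in># E" for e
  proof (rule inj_onI)
    fix p q assume "p \<in> e" "q \<in> e" "c p = c q"
    moreover have "e \<subseteq> Inl ` {1..k} \<union> range Inr" using E that by (auto simp: edges_on_def)
    ultimately show "p = q" by (cases p; cases q) (auto simp: c_def)
  qed
  have sub: "c ` e \<subseteq> {1..k} \<union> (\<lambda>v. k + 1 + v) ` free_verts E" if "e \<in># E" for e
  proof
    fix u assume "u \<in> c ` e"
    then obtain p where "p \<in> e" "u = c p" by blast
    moreover have "e \<subseteq> Inl ` {1..k} \<union> range Inr" using E that by (auto simp: edges_on_def)
    ultimately show "u \<in> {1..k} \<union> (\<lambda>v. k + 1 + v) ` free_verts E"
      using that by (cases p) (auto simp: c_def free_verts_def)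
  qed
  have lm: "labelled_multigraph k H"
    unfolding labelled_multigraph_def
    using sub E finite_free_verts[OF E]
    by (auto simp: H_def edges_on_def card_image[OF inj])
  have un: "unlabelled H = (\<lambda>v. k + 1 + v) ` free_verts E"
    by (auto simp: H_def unlabelled_def)
  have g: "reduced H"
    unfolding reduced_def un
  proof (intro conjI ballI)
    fix v assume "v \<in> (\<lambda>v. k + 1 + v) ` free_verts E"
    then obtain u e where "v = k + 1 + u" "e \<in># E" "Inr u \<in> e" by (auto simp: free_verts_def)
    then have "v = c (Inr u)" by (simp add: c_def)
    then show "\<exists>e\<in>#edges H. v \<in> e" using \<open>e \<in># E\<close> \<open>Inr u \<in> e\<close> by (auto simp: H_def)
  qed (use lm in \<open>simp add: H_def\<close>)
  have vc: "vertex_code H (c p) = map_sum id (\<lambda>v. k + 1 + v) p"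
    if "p \<in> e" "e \<in># E" for p e
  proof (cases p)
    case (Inl i)
    moreover have "e \<subseteq> Inl ` {1..k} \<union> range Inr" using E that by (auto simp: edges_on_def)
    ultimately have "i \<in> {1..k}" using that by auto
    then show ?thesis using Inl vertex_code_lab[of H i] by (simp add: H_def c_def)
  next
    case (Inr v)
    then have "c p \<in> unlabelled H" using that by (auto simp: un c_def free_verts_def)
    then show ?thesis using Inr by (simp add: vertex_code_unlabelled c_def)
  qed
  have "edge_code H = rename (\<lambda>v. k + 1 + v) E"
    unfolding edge_code_def rename_def H_def lmgraph.simps multiset.map_comp
    using vc[unfolded H_def]
    by (intro image_mset_cong) (simp add: image_image del: atLeastAtMost_iff add_Suc_right cong: image_cong_simp)
  then have "edge_equiv E (edge_code H)"
    unfolding edge_equiv_def by (intro exI[of _ "\<lambda>v. k + 1 + v"]) (simp add: inj_on_def)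
  then show ?thesis using that g by (simp add: H_def)
qed

text \<open>Realisability of \<open>E\<close> makes its class nonempty; equal classes then share a
  graph, whose code links \<open>E\<close> to \<open>E'\<close>.\<close>

lemma edge_class_eq_iff:
  assumes "edges_on k E"
  shows "edge_class E = edge_class E' \<longleftrightarrow> edge_equiv E E'"
proof
  assume eq: "edge_class E = edge_class E'"
  obtain H where "reduced H" "edge_equiv E (edge_code H)"
    using edge_class_realised[OF assms] by metis
  then have "edge_equiv E' (edge_code H)" "edge_equiv E (edge_code H)"
    using eq unfolding edge_class_def by auto
  then show "edge_equiv E E'" using edge_equiv_sym edge_equiv_trans by blast
next
  assume "edge_equiv E E'"
  then show "edge_class E = edge_class E'"
    unfolding edge_class_def using edge_equiv_sym edge_equiv_trans by blast
qed

lemma HH_eq: "HH n k = edge_class ` {E. edges_on k E \<and> size E = n}"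
proof (intro subset_antisym subsetI)
  fix c assume "c \<in> HH n k"
  then obtain H where H: "labelled_multigraph k H" "size (edges H) = n"
     "\<forall>v\<in>unlabelled H. \<exists>e\<in>#edges H. v \<in> e" "c = hcls H" by (auto simp: HH_def)
  then have "nlab H = k" by (simp add: labelled_multigraph_def)
  then have "reduced H" using H by (auto simp: reduced_def)
  then show "c \<in> edge_class ` {E. edges_on k E \<and> size E = n}"
    using H edges_on_edge_code[OF H(1)] by (auto simp: hcls_reduced)
next
  fix c assume "c \<in> edge_class ` {E. edges_on k E \<and> size E = n}"
  then obtain E where E: "edges_on k E" "size E = n" "c = edge_class E" by auto
  obtain H where H: "reduced H" "nlab H = k" "edge_equiv E (edge_code H)"
    using edge_class_realised[OF E(1)] .
  then have "c = hcls H" using E edge_class_eq_iff by (simp add: hcls_reduced)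
  moreover have "size (edges H) = n" using edge_equiv_size[OF H(3)] E by simp
  ultimately show "c \<in> HH n k" using H unfolding HH_def reduced_def by auto
qed

lemma edge_class_in_HH_iff:
  assumes "edges_on l E"
  shows "edge_class E \<in> HH n k \<longleftrightarrow> edges_on k E \<and> size E = n"
proof
  assume "edge_class E \<in> HH n k"
  then obtain F where "edges_on k F" "size F = n" "edge_class E = edge_class F" by (auto simp: HH_eq)
  then show "edges_on k E \<and> size E = n"
    using edge_class_eq_iff[OF assms] edge_equiv_edges_on edge_equiv_size by metis
qed (auto simp: HH_eq)

lemma HH_mono: "k \<le> l \<Longrightarrow> HH n k \<subseteq> HH n l"
  unfolding HH_eq using edges_on_mono by blast

lemma HH_disjoint: "c \<in> HH n k \<Longrightarrow> c \<in> HH m l \<Longrightarrow> n = m"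
  by (auto simp: HH_eq edge_class_eq_iff dest: edge_equiv_size)

lemma Hall_E:
  assumes "c \<in> Hall" obtains k E where "edges_on k E" "c = edge_class E"
  using assms by (auto simp: Hall_def HH_eq)

text \<open>A multiset of \<open>n\<close> edges has at most \<open>2 * n\<close> free vertices.
  After renaming them below \<open>2 * n\<close> it comes from a list of length \<open>n\<close>
  over a finite stock \<open>S\<close> of possible edges.\<close>

lemma finite_HH: "finite (HH n k)"
proof -
  define S where "S = Pow (Inl ` {1..k} \<union> Inr ` {..<2 * n} :: (nat + nat) set)"
  have "finite (mset ` {es. set es \<subseteq> S \<and> length es = n})"
    unfolding S_def by (intro finite_imageI finite_lists_length_eq) auto
  moreover have "HH n k \<subseteq> edge_class ` mset ` {es. set es \<subseteq> S \<and> length es = n}"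
  proof
    fix c assume "c \<in> HH n k"
    then obtain E where E: "edges_on k E" "size E = n" "c = edge_class E" by (auto simp: HH_eq)
    have fin: "finite (free_verts E)" by (rule finite_free_verts[OF E(1)])
    have "free_verts E \<subseteq> (\<Union>e\<in>set_mset E. Inr -` e)" by (auto simp: free_verts_def)
    moreover have fe: "finite e" "card e = 2" if "e \<in># E" for e
      using that E by (auto simp: edges_on_def intro: card_ge_0_finite)
    then have fe': "finite (Inr -` e :: nat set)" if "e \<in># E" for e
      using that by (intro finite_vimageI) auto
    have "card (Inr -` e :: nat set) \<le> 2" if "e \<in># E" for e
      using card_vimage_inj_on_le[of "Inr" UNIV e] fe[OF that] by simp
    then have "(\<Sum>e\<in>set_mset E. card (Inr -` e :: nat set)) \<le> 2 * card (set_mset E)"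
      using sum_bounded_above[of "set_mset E" "\<lambda>e. card (Inr -` e)" 2] by simp
    ultimately have "card (free_verts E) \<le> 2 * card (set_mset E)"
      using card_UN_le[of "set_mset E" "\<lambda>e. Inr -` e :: nat set"]
        card_mono[of "\<Union>e\<in>set_mset E. Inr -` e" "free_verts E"] fe' by fastforce
    also have "card (set_mset E) \<le> n"
      using E(2) size_mset_mono[OF mset_set_set_mset_msubset[of E]] by simp
    finally have "card (free_verts E) \<le> 2 * n" by simp
    then obtain \<pi> where pi: "inj_on \<pi> (free_verts E)" "\<pi> ` free_verts E \<subseteq> {..<2 * n}"
      using card_le_inj[OF fin, of "{..<2*n}"] by auto
    let ?F = "rename \<pi> E"
    have F: "edges_on k ?F" "size ?F = n" "c = edge_class ?F" "free_verts ?F \<subseteq> {..<2 * n}"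
      using E pi edges_on_rename edge_class_eq_iff[OF E(1), of ?F]
      by (auto simp: edge_equiv_def free_verts_rename)
    have "e \<in> S" if "e \<in># ?F" for e
    proof -
      have "e \<subseteq> Inl ` {1..k} \<union> range Inr" using that F(1) by (auto simp: edges_on_def)
      moreover have "v < 2 * n" if "Inr v \<in> e" for v
        using that F(4) \<open>e \<in># ?F\<close> by (auto simp: free_verts_def)
      ultimately show ?thesis unfolding S_def by blast
    qed
    moreover obtain es where "mset es = ?F" using ex_mset by blast
    ultimately have "es \<in> {es. set es \<subseteq> S \<and> length es = n}"
      using F(2) by (auto simp flip: set_mset_mset size_mset)
    then show "c \<in> edge_class ` mset ` {es. set es \<subseteq> S \<and> length es = n}"
      unfolding F(3) \<open>mset es = ?F\<close>[symmetric] by (intro imageI)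
  qed
  ultimately show ?thesis by (meson finite_imageI finite_subset)
qed

section \<open>Products of classes\<close>

text \<open>Parity keeps the free vertices of the factors apart while labels are shared. It is the
  doubling used by \<open>glue\<close>, so the code of a glued graph is literally this join.\<close>

definition edge_join :: "edge_mset \<Rightarrow> edge_mset \<Rightarrow> edge_mset" where
  "edge_join E F = rename (\<lambda>v. 2 * v) E + rename (\<lambda>v. 2 * v + 1) F"

lemma free_verts_plus: "free_verts (E + F) = free_verts E \<union> free_verts F"
  by (auto simp: free_verts_def)

lemma rename_plus: "rename \<pi> (E + F) = rename \<pi> E + rename \<pi> F"
  by (simp add: rename_def)

lemma edges_on_plus: "edges_on k (E + F) \<longleftrightarrow> edges_on k E \<and> edges_on k F"
  by (auto simp: edges_on_def)

lemma edges_on_join: "edges_on k (edge_join E F) \<longleftrightarrow> edges_on k E \<and> edges_on k F"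
  unfolding edge_join_def edges_on_plus by (subst (1 2) edges_on_rename_iff) (auto simp: inj_on_def)

lemma size_join: "size (edge_join E F) = size E + size F"
  by (simp add: edge_join_def)

lemma edge_equiv_join:
  assumes "edge_equiv E E'" "edge_equiv F F'"
  shows "edge_equiv (edge_join E F) (edge_join E' F')"
proof -
  obtain \<pi> \<rho> where p: "inj_on \<pi> (free_verts E)" "E' = rename \<pi> E"
      "inj_on \<rho> (free_verts F)" "F' = rename \<rho> F"
    using assms unfolding edge_equiv_def by blast
  \<comment> \<open>Even vertices come from \<open>E\<close>, odd ones from \<open>F\<close>; each
    is renamed within its parity class.\<close>
  define \<sigma> where "\<sigma> v = (if even v then 2 * \<pi> (v div 2) else 2 * \<rho> (v div 2) + 1)" for v
  have "edge_join E' F' = rename \<sigma> (edge_join E F)"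
    unfolding edge_join_def rename_plus p rename_rename
    by (intro arg_cong2[where f="(+)"] rename_cong) (auto simp: \<sigma>_def)
  moreover have "inj_on \<sigma> (free_verts (edge_join E F))"
    unfolding edge_join_def free_verts_plus free_verts_rename
    using p(1,3) by (intro inj_onI) (auto simp: \<sigma>_def inj_on_eq_iff, presburger+)
  ultimately show ?thesis unfolding edge_equiv_def by blast
qed

lemma edge_code_glue:
  assumes H1: "reduced H1" and H2: "reduced H2" and k: "nlab H1 = nlab H2"
  shows "reduced (glue H1 H2)" "edge_code (glue H1 H2) = edge_join (edge_code H1) (edge_code H2)"
proof -
  have L: "labelled_multigraph (nlab H1) H1" "labelled_multigraph (nlab H2) H2"
    using H1 H2 by (auto simp: reduced_def)
  have inj: "inj_on (lab H1) {1..nlab H1}" "inj_on (lab H2) {1..nlab H2}"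
    and sub: "lab H1 ` {1..nlab H1} \<subseteq> verts H1" "lab H2 ` {1..nlab H2} \<subseteq> verts H2"
    using L by (auto simp: labelled_multigraph_def)
  let ?G = "glue H1 H2" and ?g = "glue_right H1 H2"
  have edges_glue: "edges ?G = image_mset ((`) (\<lambda>v. 2 * v)) (edges H1) + image_mset ((`) ?g) (edges H2)"
    by (simp add: glue_def)
  have simps: "nlab ?G = nlab H1" "lab ?G = (\<lambda>i. 2 * lab H1 i)" by (simp_all add: glue_def)
  have gl: "?g (lab H2 i) = 2 * lab H1 i" if "i \<in> {1..nlab H2}" for i
    using that inj(2) by (simp add: glue_right_def del: atLeastAtMost_iff)
  have gu: "?g v = 2 * v + 1" if "v \<in> unlabelled H2" for v
    using that by (auto simp: glue_right_def unlabelled_def)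
  have injG: "inj_on (lab ?G) {1..nlab ?G}"
    unfolding simps by (rule inj_onI) (use inj(1) in \<open>simp add: inj_on_eq_iff del: atLeastAtMost_iff\<close>)
  have vc1: "vertex_code ?G (2 * v) = map_sum id (\<lambda>v. 2 * v) (vertex_code H1 v)"
    if "v \<in> verts H1" for v using that inj(1)
  proof (cases rule: vertex_code_cases)
    case (lab i)
    then show ?thesis using vertex_code_lab[OF injG, of i] by (simp add: simps)
  next
    case unlab
    then show ?thesis by (auto simp: vertex_code_def simps unlabelled_def)
  qed
  have vc2: "vertex_code ?G (?g v) = map_sum id (\<lambda>v. 2 * v + 1) (vertex_code H2 v)"
    if "v \<in> verts H2" for v using that inj(2)
  proof (cases rule: vertex_code_cases)
    case (lab i)
    then show ?thesis using vertex_code_lab[OF injG, of i] gl[of i] by (simp add: simps k)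
  next
    case unlab
    moreover have "2 * v + 1 \<noteq> 2 * u" for u :: nat by presburger
    ultimately show ?thesis by (auto simp: gu vertex_code_def simps)
  qed
  have ed: "\<And>e. e \<in># edges H1 \<Longrightarrow> e \<subseteq> verts H1 \<and> card e = 2"
    "\<And>e. e \<in># edges H2 \<Longrightarrow> e \<subseteq> verts H2 \<and> card e = 2"
    using L by (auto simp: labelled_multigraph_def)
  have "image_mset ((`) (vertex_code ?G) \<circ> (`) (\<lambda>v. 2 * v)) (edges H1) =
      rename (\<lambda>v. 2 * v) (edge_code H1)"
    unfolding edge_code_def rename_def multiset.map_comp
    using ed(1) by (intro image_mset_cong) (auto simp: image_image vc1 subset_iff intro!: image_cong)
  moreover have "image_mset ((`) (vertex_code ?G) \<circ> (`) ?g) (edges H2) =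
      rename (\<lambda>v. 2 * v + 1) (edge_code H2)"
    unfolding edge_code_def rename_def multiset.map_comp
    using ed(2) by (intro image_mset_cong) (auto simp: image_image vc2 subset_iff intro!: image_cong)
  ultimately show "edge_code ?G = edge_join (edge_code H1) (edge_code H2)"
    
    unfolding edge_code_def[of ?G] edge_join_def edges_glue image_mset_union multiset.map_comp by simp
  \<comment> \<open>Labelled vertices go to even numbers and unlabelled ones to odd numbers, so
    gluing merges no two vertices of \<open>H2\<close> and its edges keep two ends.\<close>
  have "inj_on ?g (verts H2)"
  proof (rule inj_onI)
    fix u v assume u: "u \<in> verts H2" and v: "v \<in> verts H2" and e: "?g u = ?g v"
    have "2 * a \<noteq> 2 * b + 1" "2 * b + 1 \<noteq> 2 * a" for a b :: nat by presburger+
    with u v e inj show "u = v"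
      by (cases rule: vertex_code_cases[OF u inj(2)]; cases rule: vertex_code_cases[OF v inj(2)])
         (auto simp: gl gu k inj_on_eq_iff)
  qed
  then have c2: "card (?g ` e) = 2" if "e \<in># edges H2" for e
    using ed(2)[OF that] by (metis card_image inj_on_subset)
  have c1: "card ((\<lambda>v. 2 * v) ` e) = 2" if "e \<in># edges H1" for e :: "nat set"
    using ed(1)[OF that] by (subst card_image) (auto simp: inj_on_def)
  have LG: "labelled_multigraph (nlab ?G) ?G"
    unfolding labelled_multigraph_def
  proof (intro conjI)
    show "finite (verts ?G)" using L by (auto simp: glue_def labelled_multigraph_def)
    show "\<forall>e\<in>#edges ?G. e \<subseteq> verts ?G \<and> card e = 2"
      using ed c1 c2 by (fastforce simp: glue_def)
    show "lab ?G ` {1..nlab ?G} \<subseteq> verts ?G" using sub by (auto simp: glue_def)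
  qed (use injG in auto)
  show "reduced ?G"
    unfolding reduced_def
  proof (intro conjI ballI LG)
    fix w assume w: "w \<in> unlabelled ?G"
    then consider v where "v \<in> verts H1" "w = 2 * v" | v where "v \<in> verts H2" "w = ?g v"
      by (auto simp: glue_def unlabelled_def)
    then show "\<exists>e\<in>#edges ?G. w \<in> e"
    proof cases
      case 1
      then have "v \<in> unlabelled H1" using w by (auto simp: unlabelled_def simps)
      then obtain e where "e \<in># edges H1" "v \<in> e" using H1 unfolding reduced_def by blast
      then have "(\<lambda>v. 2 * v) ` e \<in># edges ?G" "w \<in> (\<lambda>v. 2 * v) ` e"
        using 1 by (auto simp: edges_glue)
      then show ?thesis by blast
    next
      case 2
      have "v \<in> unlabelled H2" using w 2 gl k by (auto simp: unlabelled_def simps)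
      then obtain e where "e \<in># edges H2" "v \<in> e" using H2 unfolding reduced_def by blast
      then show ?thesis using 2(2) unfolding edges_glue by (metis image_eqI image_mset_union set_image_mset union_iff)
    qed
  qed
qed

text \<open>Both classes have representatives with \<open>max k l\<close> labels, so a product
  exists, and \<open>edge_equiv_join\<close> makes it independent of the representatives.\<close>

lemma is_product_iff:
  assumes E: "edges_on k E" and F: "edges_on l F"
  shows "is_product (edge_class E) (edge_class F) c \<longleftrightarrow> c = edge_class (edge_join E F)"
proof -
  have *: "hcls (glue H1 H2) = edge_class (edge_join E F)"
    if "H1 \<in> edge_class E" "H2 \<in> edge_class F" "nlab H1 = nlab H2" for H1 H2
  proof -
    have g: "reduced H1" "reduced H2" "edge_equiv E (edge_code H1)" "edge_equiv F (edge_code H2)"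
      using that by (auto simp: edge_class_def)
    have m: "edges_on (max k l) (edge_join E F)"
      unfolding edges_on_join using E F edges_on_mono by (metis max.cobounded1 max.cobounded2)
    show ?thesis
      using edge_code_glue[OF g(1,2) that(3)] edge_equiv_join[OF g(3,4)] edge_class_eq_iff[OF m]
      by (metis hcls_reduced)
  qed
  obtain H1 where "reduced H1" "nlab H1 = max k l" "edge_equiv E (edge_code H1)"
    using edge_class_realised[OF edges_on_mono[OF E max.cobounded1]] .
  moreover obtain H2 where "reduced H2" "nlab H2 = max k l" "edge_equiv F (edge_code H2)"
    using edge_class_realised[OF edges_on_mono[OF F max.cobounded2]] .
  ultimately have "H1 \<in> edge_class E" "H2 \<in> edge_class F" "nlab H1 = nlab H2"
    by (auto simp: edge_class_def)
  then show ?thesis unfolding is_product_def using * by metis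
qed

lemma is_product_HH:
  assumes "c1 \<in> HH n k" "c2 \<in> HH m k" "is_product c1 c2 c"
  shows "c \<in> HH (n + m) k"
proof -
  obtain E F where EF: "edges_on k E" "size E = n" "c1 = edge_class E" "edges_on k F" "size F = m" "c2 = edge_class F"
    using assms(1,2) by (auto simp: HH_eq)
  then have "c = edge_class (edge_join E F)" using assms(3) is_product_iff by blast
  then show ?thesis using EF by (auto simp: HH_eq edges_on_join size_join)
qed

text \<open>The edges of a join, with their labels, come from its factors. This confines the factors
  of a given class to finitely many classes and makes the fibres of the product finite.\<close>

lemma is_product_HH_converse:
  assumes "c1 \<in> Hall" "c2 \<in> Hall" "is_product c1 c2 c" "c \<in> HH n k"
  shows "\<exists>i\<le>n. c1 \<in> HH i k \<and> c2 \<in> HH (n - i) k"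
proof -
  obtain l E where E: "edges_on l E" "c1 = edge_class E" using Hall_E[OF assms(1)] .
  obtain l' F where F: "edges_on l' F" "c2 = edge_class F" using Hall_E[OF assms(2)] .
  have c: "c = edge_class (edge_join E F)" using is_product_iff E F assms(3) by blast
  moreover have "edges_on (max l l') (edge_join E F)"
    unfolding edges_on_join using E F edges_on_mono by (metis max.cobounded1 max.cobounded2)
  ultimately have "edges_on k (edge_join E F)" "size (edge_join E F) = n"
    using assms(4) edge_class_in_HH_iff by blast+
  then have "c1 \<in> HH (size E) k" "c2 \<in> HH (n - size E) k" "size E \<le> n"
    using E F by (auto simp: HH_eq edges_on_join size_join)
  then show ?thesis by blast
qed

definition product :: "hclass \<Rightarrow> hclass \<Rightarrow> hclass" where
  "product c1 c2 = (THE c. is_product c1 c2 c)"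

lemma product_edge_class:
  assumes "edges_on k E" "edges_on l F"
  shows "product (edge_class E) (edge_class F) = edge_class (edge_join E F)"
  unfolding product_def is_product_iff[OF assms] by simp

lemma is_product_iff_product:
  assumes "c1 \<in> Hall" "c2 \<in> Hall" shows "is_product c1 c2 c \<longleftrightarrow> c = product c1 c2"
  using assms by (elim Hall_E) (auto simp: is_product_iff product_edge_class)

lemma product_in_Hall:
  assumes "c1 \<in> Hall" "c2 \<in> Hall" shows "product c1 c2 \<in> Hall"
proof -
  obtain n k where 1: "c1 \<in> HH n k" using assms by (auto simp: Hall_def)
  obtain m l where 2: "c2 \<in> HH m l" using assms by (auto simp: Hall_def)
  have "c1 \<in> HH n (max k l)" "c2 \<in> HH m (max k l)"
    using 1 2 HH_mono by (meson max.cobounded1 max.cobounded2 subsetD)+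
  then have "product c1 c2 \<in> HH (n + m) (max k l)"
    using is_product_HH is_product_iff_product assms by blast
  then show ?thesis by (auto simp: Hall_def)
qed

definition factor_pairs :: "hclass \<Rightarrow> (hclass \<times> hclass) set" where
  "factor_pairs c = {(c1, c2). c1 \<in> Hall \<and> c2 \<in> Hall \<and> product c1 c2 = c}"

lemma factor_pairs_HH:
  "c \<in> HH n k \<Longrightarrow> factor_pairs c \<subseteq> (\<Union>i\<le>n. HH i k \<times> HH (n - i) k)"
proof safe
  fix c1 c2 assume "c \<in> HH n k" "(c1, c2) \<in> factor_pairs c"
  then obtain i where "i \<le> n" "c1 \<in> HH i k" "c2 \<in> HH (n - i) k"
    using is_product_HH_converse[of c1 c2 c n k] is_product_iff_product
    by (auto simp: factor_pairs_def)
  then show "(c1, c2) \<in> (\<Union>i\<le>n. HH i k \<times> HH (n - i) k)" by blast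
qed

lemma finite_factor_pairs: "finite (factor_pairs c)"
proof (cases "c \<in> Hall")
  case True
  then obtain n k where "c \<in> HH n k" by (auto simp: Hall_def)
  then show ?thesis using factor_pairs_HH finite_HH
    by (meson finite_SigmaI finite_UN_I finite_atMost finite_subset)
next
  case False
  then have "factor_pairs c = {}" using product_in_Hall by (auto simp: factor_pairs_def)
  then show ?thesis by simp
qed

lemma smult_eq: "smult a b c = (\<Sum>(c1, c2)\<in>factor_pairs c. a c1 * b c2)"
  unfolding smult_def factor_pairs_def by (rule sum.cong) (auto simp: is_product_iff_product)

section \<open>Densities of edge multisets\<close>

abbreviation unit_measure :: "real measure" where
  "unit_measure \<equiv> restrict_space lborel {0..1}"

interpretation unit_measure: prob_space unit_measure
  by (rule prob_spaceI) (simp add: emeasure_restrict_space space_restrict_space)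

interpretation unit_product: product_sigma_finite "\<lambda>_. unit_measure"
  by standard

text \<open>Vertices have an arbitrary type here, so an edge is oriented by choice instead of by
  \<open>Min\<close> and \<open>Max\<close>; symmetric kernels do not see the difference.\<close>

definition edge_val :: "(real \<times> real \<Rightarrow> real) \<Rightarrow> ('v \<Rightarrow> real) \<Rightarrow> 'v set \<Rightarrow> real" where
  "edge_val f w e = (let p = SOME p. e = {fst p, snd p} in f (w (fst p), w (snd p)))"

lemma edge_val_pair:
  assumes "f (w u, w v) = f (w v, w u)" shows "edge_val f w {u, v} = f (w u, w v)"
proof -
  define p where "p = (SOME p. {u, v} = {fst p, snd p})"
  have "{u, v} = {fst p, snd p}" unfolding p_def
    by (rule someI[of _ "(u, v)"]) simp
  then consider "fst p = u" "snd p = v" | "fst p = v" "snd p = u" by (metis doubleton_eq_iff)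
  moreover have "edge_val f w {u, v} = f (w (fst p), w (snd p))"
    unfolding edge_val_def Let_def p_def ..
  ultimately show ?thesis using assms by cases simp_all
qed

text \<open>The chosen orientation depends on \<open>e\<close> alone, so both assignments are read
  in the same order.\<close>

lemma edge_val_cong:
  assumes "card e = 2" "\<And>p. p \<in> e \<Longrightarrow> w p = w' p" shows "edge_val f w e = edge_val f w' e"
proof -
  define p where "p = (SOME p. e = {fst p, snd p})"
  obtain u v where "e = {u, v}" using assms(1) by (auto simp: card_2_iff)
  then have "e = {fst p, snd p}" unfolding p_def using someI[of "\<lambda>p. e = {fst p, snd p}" "(u, v)"] by simp
  then have "fst p \<in> e" "snd p \<in> e" by blast+
  moreover have "edge_val f w e = f (w (fst p), w (snd p))" "edge_val f w' e = f (w' (fst p), w' (snd p))"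
    unfolding edge_val_def Let_def p_def by (rule refl)+
  ultimately show ?thesis using assms(2) by simp
qed

lemma W_sym: "f \<in> W s \<Longrightarrow> u \<in> {0..1} \<Longrightarrow> v \<in> {0..1} \<Longrightarrow> f (u, v) = f (v, u)"
  unfolding W_def by blast

lemma W_bound: "f \<in> W s \<Longrightarrow> u \<in> {0..1} \<Longrightarrow> v \<in> {0..1} \<Longrightarrow> \<bar>f (u, v)\<bar> \<le> s"
proof -
  assume "f \<in> W s" and uv: "u \<in> {0..1}" "v \<in> {0..1}"
  then have "f \<in> {0..1} \<times> {0..1} \<rightarrow> {-s..s}" by (simp add: W_def PiE_def)
  then have "f (u, v) \<in> {-s..s}" using uv by (blast intro: funcset_mem)
  then show ?thesis by auto
qed

text \<open>The choices made for \<open>e\<close> and for its image may orient them differently; the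
  symmetry of \<open>f\<close> absorbs this.\<close>

lemma edge_val_image:
  assumes f: "f \<in> W s" and e: "card e = 2" and w: "\<And>p. p \<in> e \<Longrightarrow> w (h p) \<in> {0..1}"
  shows "edge_val f w (h ` e) = edge_val f (\<lambda>p. w (h p)) e"
proof -
  obtain u v where uv: "e = {u, v}" using e by (auto simp: card_2_iff)
  then have "f (w (h u), w (h v)) = f (w (h v), w (h u))"
    using w by (intro W_sym[OF f]) auto
  then show ?thesis unfolding uv by (simp add: edge_val_pair)
qed

lemma edge_val_bound:
  assumes f: "f \<in> W s" and e: "card e = 2" and w: "\<And>p. p \<in> e \<Longrightarrow> w p \<in> {0..1}"
  shows "\<bar>edge_val f w e\<bar> \<le> s"
proof -
  obtain u v where uv: "e = {u, v}" using e by (auto simp: card_2_iff)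
  then have "f (w u, w v) = f (w v, w u)" "\<bar>f (w u, w v)\<bar> \<le> s"
    using w W_sym[OF f] W_bound[OF f] by auto
  then show ?thesis unfolding uv by (simp add: edge_val_pair)
qed

definition edge_prod ::
    "(nat \<Rightarrow> real) \<Rightarrow> edge_mset \<Rightarrow> (real \<times> real \<Rightarrow> real) \<Rightarrow> (nat \<Rightarrow> real) \<Rightarrow> real" where
  "edge_prod x E f y = (\<Prod>e\<in>#E. edge_val f (case_sum x y) e)"

definition edge_density :: "(nat \<Rightarrow> real) \<Rightarrow> edge_mset \<Rightarrow> (real \<times> real \<Rightarrow> real) \<Rightarrow> real" where
  "edge_density x E f =
     (LINT y | Pi\<^sub>M (free_verts E) (\<lambda>_. unit_measure). edge_prod x E f y)"

lemma edge_prod_plus: "edge_prod x (E + F) f y = edge_prod x E f y * edge_prod x F f y"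
  by (simp add: edge_prod_def)

lemma space_unit_product: "space (Pi\<^sub>M I (\<lambda>_. unit_measure)) = (\<Pi>\<^sub>E i\<in>I. {0..1})"
  by (simp add: space_PiM space_restrict_space)

lemma edge_prod_cong:
  assumes "edges_on k E" "\<And>v. v \<in> free_verts E \<Longrightarrow> y v = z v"
  shows "edge_prod x E f y = edge_prod x E f z"
  unfolding edge_prod_def
proof (intro arg_cong[where f = prod_mset] image_mset_cong edge_val_cong)
  fix e p assume e: "e \<in># E"
  then show "card e = 2" using assms(1) by (auto simp: edges_on_def)
  assume "p \<in> e"
  then show "case_sum x y p = case_sum x z p"
    using e assms(2) by (cases p) (auto simp: free_verts_def)
qed

lemma W_scale:
  assumes f: "f \<in> W s" and t: "\<bar>t\<bar> \<le> 1"
  shows "(\<lambda>p\<in>{0..1} \<times> {0..1}. t * f p) \<in> W s"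
proof -
  have "t * f (u, v) \<in> {-s..s}" if "u \<in> {0..1}" "v \<in> {0..1}" for u v
  proof -
    have "\<bar>t * f (u, v)\<bar> \<le> 1 * s"
      unfolding abs_mult using W_bound[OF f that] t by (intro mult_mono) auto
    then show ?thesis by auto
  qed
  moreover have "(\<lambda>p. t * f p) \<in> borel_measurable (restrict_space borel ({0..1} \<times> {0..1}))"
    using f by (auto simp: W_def)
  then have "(\<lambda>p\<in>{0..1} \<times> {0..1}. t * f p) \<in> borel_measurable (restrict_space borel ({0..1} \<times> {0..1}))"
    by (subst measurable_cong[where g = "\<lambda>p. t * f p"]) (auto simp: space_restrict_space)
  ultimately show ?thesis using W_sym[OF f] unfolding W_def by auto
qed

section \<open>Densities for labelled points in the unit interval\<close>

context
  fixes x :: "nat \<Rightarrow> real" and s :: real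
  assumes x: "\<forall>i\<ge>1. x i \<in> {0..1}"
begin

lemma case_sum_in_unit:
  assumes "edges_on k E" "e \<in># E" "p \<in> e" "\<And>v. v \<in> free_verts E \<Longrightarrow> y v \<in> {0..1}"
  shows "case_sum x y p \<in> {0..1}"
proof (cases p)
  case (Inl i)
  then have "Inl i \<in> Inl ` {1..k} \<union> (range Inr :: (nat + nat) set)"
    using assms(1-3) unfolding edges_on_def by blast
  then show ?thesis using x Inl by auto
next
  case (Inr v)
  then show ?thesis using assms by (auto simp: free_verts_def)
qed

lemma edge_prod_bound:
  assumes f: "f \<in> W s" and E: "edges_on k E" and y: "\<And>v. v \<in> free_verts E \<Longrightarrow> y v \<in> {0..1}"
  shows "\<bar>edge_prod x E f y\<bar> \<le> s ^ size E"
proof -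
  have *: "\<And>e. e \<in># E \<Longrightarrow> \<bar>edge_val f (case_sum x y) e\<bar> \<le> s"
    using case_sum_in_unit[OF E] y E by (intro edge_val_bound[OF f]) (auto simp: edges_on_def)
  have "(\<And>e. e \<in># F \<Longrightarrow> \<bar>g e\<bar> \<le> s) \<Longrightarrow> \<bar>\<Prod>e\<in>#F. g e\<bar> \<le> s ^ size F"
    for F :: "'v multiset" and g :: "'v \<Rightarrow> real"
  proof (induction F)
    case (add e F)
    then have "\<bar>g e\<bar> * \<bar>\<Prod>e\<in>#F. g e\<bar> \<le> s * s ^ size F"
      by (intro mult_mono) (auto intro: order_trans[OF abs_ge_zero])
    then show ?case by (simp add: abs_mult)
  qed simp
  then show ?thesis using * unfolding edge_prod_def by blast
qed

lemma edge_prod_measurable: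
  assumes f: "f \<in> W s" and E: "edges_on k E" and I: "free_verts E \<subseteq> I"
  shows "edge_prod x E f \<in> borel_measurable (Pi\<^sub>M I (\<lambda>_. unit_measure))"
proof -
  let ?M = "Pi\<^sub>M I (\<lambda>_. unit_measure)"
  have fm: "f \<in> borel_measurable (restrict_space borel ({0..1} \<times> {0..1}))"
    using f by (simp add: W_def)
  have um: "unit_measure \<rightarrow>\<^sub>M borel = (restrict_space borel {0..1} \<rightarrow>\<^sub>M (borel :: real measure))"
    by (intro measurable_cong_sets sets_restrict_space_cong) simp_all
  have cm: "(\<lambda>y. case_sum x y p) \<in> borel_measurable ?M" if "e \<in># E" "p \<in> e" for e p
  proof (cases p)
    case (Inr v)
    then have "v \<in> I" using that I by (auto simp: free_verts_def)
    then have "(\<lambda>y. y v) \<in> ?M \<rightarrow>\<^sub>M unit_measure" by (rule measurable_component_singleton)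
    moreover have "(\<lambda>r. r) \<in> unit_measure \<rightarrow>\<^sub>M borel"
      unfolding um by (intro measurable_restrict_space1) simp
    ultimately show ?thesis using Inr by (auto dest: measurable_compose)
  qed simp
  have ev: "(\<lambda>y. edge_val f (case_sum x y) e) \<in> borel_measurable ?M" if e: "e \<in># E" for e
  proof -
    have "card e = 2" using E e by (auto simp: edges_on_def)
    then obtain u v where uv: "e = {u, v}" by (auto simp: card_2_iff)
    have val: "case_sum x y u \<in> {0..1}" "case_sum x y v \<in> {0..1}" if "y \<in> space ?M" for y
      using that I uv by (auto intro!: case_sum_in_unit[OF E e] simp del: atLeastAtMost_iff simp: space_unit_product)
    \<comment> \<open>A kernel is measurable only as a function on the unit square, so the pair of
      end points has to be a map into the restricted space.\<close>
    have "(\<lambda>y. (case_sum x y u, case_sum x y v)) \<in> ?M \<rightarrow>\<^sub>M restrict_space borel ({0..1} \<times> {0..1})"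
      using cm[OF e] uv val by (intro measurable_restrict_space2 borel_measurable_Pair) auto
    from measurable_compose[OF this fm]
    have "(\<lambda>y. f (case_sum x y u, case_sum x y v)) \<in> borel_measurable ?M" .
    moreover have "edge_val f (case_sum x y) e = f (case_sum x y u, case_sum x y v)"
      if "y \<in> space ?M" for y
      unfolding uv using val[OF that] by (intro edge_val_pair W_sym[OF f])
    ultimately show ?thesis by (simp cong: measurable_cong)
  qed
  have "(\<And>e. e \<in># F \<Longrightarrow> g e \<in> borel_measurable ?M) \<Longrightarrow>
     (\<lambda>y. \<Prod>e\<in>#F. g e y) \<in> borel_measurable ?M"
    for F :: edge_mset and g :: "_ \<Rightarrow> _ \<Rightarrow> real"
    by (induction F) auto
  from this[OF ev] show ?thesis unfolding edge_prod_def by (simp add: fun_eq_iff)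
qed

lemma edge_prod_integrable:
  assumes f: "f \<in> W s" and E: "edges_on k E" and I: "free_verts E \<subseteq> I"
  shows "integrable (Pi\<^sub>M I (\<lambda>_. unit_measure)) (edge_prod x E f)"
proof -
  interpret P: prob_space "Pi\<^sub>M I (\<lambda>_. unit_measure)"
    by (intro prob_space_PiM unit_measure.prob_space_axioms)
  show ?thesis
  proof (rule P.integrable_const_bound[where B = "s ^ size E"])
    show "AE y in Pi\<^sub>M I (\<lambda>_. unit_measure). norm (edge_prod x E f y) \<le> s ^ size E"
      using I by (intro AE_I2) (auto simp: space_unit_product intro!: edge_prod_bound[OF f E])
  qed (rule edge_prod_measurable[OF assms])
qed

lemma edge_density_bound:
  assumes f: "f \<in> W s" and E: "edges_on k E"
  shows "\<bar>edge_density x E f\<bar> \<le> s ^ size E"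
proof -
  let ?M = "Pi\<^sub>M (free_verts E) (\<lambda>_. unit_measure)"
  interpret P: prob_space ?M
    by (intro prob_space_PiM unit_measure.prob_space_axioms)
  have i: "integrable ?M (edge_prod x E f)" by (rule edge_prod_integrable[OF f E order_refl])
  have "\<bar>edge_density x E f\<bar> \<le> (LINT y|?M. \<bar>edge_prod x E f y\<bar>)"
    unfolding edge_density_def by (rule integral_abs_bound)
  also have "\<dots> \<le> (LINT y|?M. s ^ size E)"
    using i by (intro integral_mono) (auto simp: space_unit_product intro!: edge_prod_bound[OF f E])
  also have "\<dots> = s ^ size E" by (simp add: P.prob_space)
  finally show ?thesis .
qed

text \<open>Along the injective \<open>\<pi>\<close> the coordinates are only reindexed, and a
  product of copies of one probability measure does not notice.\<close>

lemma edge_density_rename: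
  assumes f: "f \<in> W s" and E: "edges_on k E" and p: "inj_on \<pi> (free_verts E)"
  shows "edge_density x (rename \<pi> E) f = edge_density x E f"
proof -
  let ?I = "free_verts E" and ?K = "free_verts (rename \<pi> E)" and ?U = "\<lambda>_::nat. unit_measure"
  let ?T = "\<lambda>\<omega>. \<lambda>n\<in>?I. \<omega> (\<pi> n)"
  have pK: "\<pi> \<in> ?I \<rightarrow> ?K" by (auto simp: free_verts_rename)
  have T: "?T \<in> Pi\<^sub>M ?K ?U \<rightarrow>\<^sub>M Pi\<^sub>M ?I ?U"
    using pK by (intro measurable_restrict measurable_component_singleton) auto
  have "edge_density x E f = (LINT y | distr (Pi\<^sub>M ?K ?U) (Pi\<^sub>M ?I ?U) ?T. edge_prod x E f y)"
    unfolding edge_density_def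
    using distr_PiM_reindex[of ?K ?U \<pi> ?I, OF unit_measure.prob_space_axioms p pK] by simp
  also have "\<dots> = (LINT y | Pi\<^sub>M ?K ?U. edge_prod x E f (?T y))"
    by (rule integral_distr[OF T edge_prod_measurable[OF f E order_refl]])
  also have "\<dots> = edge_density x (rename \<pi> E) f"
    unfolding edge_density_def
  proof (rule Bochner_Integration.integral_cong[OF refl])
    fix y assume y: "y \<in> space (Pi\<^sub>M ?K ?U)"
    have "edge_prod x (rename \<pi> E) f y = (\<Prod>e\<in>#E. edge_val f (case_sum x y) (map_sum id \<pi> ` e))"
      by (simp add: edge_prod_def rename_def multiset.map_comp o_def)
    also have "\<dots> = (\<Prod>e\<in>#E. edge_val f (case_sum x (?T y)) e)"
    proof (intro arg_cong[where f = prod_mset] image_mset_cong)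
      fix e assume e: "e \<in># E"
      then have c: "card e = 2" using E by (auto simp: edges_on_def)
      have e': "map_sum id \<pi> ` e \<in># rename \<pi> E" using e by (auto simp: rename_def)
      have "edge_val f (case_sum x y) (map_sum id \<pi> ` e) =
          edge_val f (\<lambda>p. case_sum x y (map_sum id \<pi> p)) e"
        using y by (intro edge_val_image[OF f c] case_sum_in_unit[OF edges_on_rename[OF E p] e'])
          (auto simp: space_unit_product)
      also have "\<dots> = edge_val f (case_sum x (?T y)) e"
      proof (rule edge_val_cong[OF c])
        fix p assume "p \<in> e"
        then show "case_sum x y (map_sum id \<pi> p) = case_sum x (?T y) p"
          using e by (cases p) (auto simp: free_verts_def)
      qed
      finally show "edge_val f (case_sum x y) (map_sum id \<pi> ` e) = edge_val f (case_sum x (?T y)) e" .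
    qed
    finally show "edge_prod x E f (?T y) = edge_prod x (rename \<pi> E) f y"
      by (simp add: edge_prod_def)
  qed
  finally show ?thesis by simp
qed

text \<open>Fubini: with disjoint free vertices the integrand is a product of functions of separate
  variables.\<close>

lemma edge_density_plus:
  assumes f: "f \<in> W s" and E: "edges_on k E" and F: "edges_on k F"
    and disj: "free_verts E \<inter> free_verts F = {}"
  shows "edge_density x (E + F) f = edge_density x E f * edge_density x F f"
proof -
  let ?I = "free_verts E" and ?J = "free_verts F" and ?U = "\<lambda>_::nat. unit_measure"
  have EF: "edges_on k (E + F)" using E F by (simp add: edges_on_plus)
  have "edge_density x (E + F) f = (LINT y | Pi\<^sub>M (?I \<union> ?J) ?U. edge_prod x (E + F) f y)"
    by (simp add: edge_density_def free_verts_plus)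
  also have "\<dots> = (LINT a | Pi\<^sub>M ?I ?U. LINT b | Pi\<^sub>M ?J ?U. edge_prod x (E + F) f (merge ?I ?J (a, b)))"
    by (intro unit_product.product_integral_fold disj finite_free_verts[OF E] finite_free_verts[OF F]
        edge_prod_integrable[OF f EF]) (simp add: free_verts_plus)
  also have "\<dots> = (LINT a | Pi\<^sub>M ?I ?U. LINT b | Pi\<^sub>M ?J ?U. edge_prod x E f a * edge_prod x F f b)"
  proof -
    have "edge_prod x E f (merge ?I ?J (a, b)) = edge_prod x E f a" for a b
      by (rule edge_prod_cong[OF E]) (simp add: merge_def)
    moreover have "edge_prod x F f (merge ?I ?J (a, b)) = edge_prod x F f b" for a b
      using disj by (intro edge_prod_cong[OF F]) (auto simp: merge_def)
    ultimately show ?thesis by (simp add: edge_prod_plus)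
  qed
  also have "\<dots> = edge_density x E f * edge_density x F f"
    by (simp add: edge_density_def)
  finally show ?thesis .
qed

text \<open>\<open>point_of\<close> evaluates the coded vertex, so the integrands differ only in how
  edges are oriented.\<close>

lemma density_eq_edge_density:
  assumes f: "f \<in> W s" and H: "reduced H"
  shows "density x H f = edge_density x (edge_code H) f"
  unfolding density_def edge_density_def free_verts_reduced[OF H]
proof (rule Bochner_Integration.integral_cong[OF refl])
  fix y assume y: "y \<in> space (Pi\<^sub>M (unlabelled H) (\<lambda>_. unit_measure))"
  have L: "labelled_multigraph (nlab H) H" using H by (simp add: reduced_def)
  have E: "edges_on (nlab H) (edge_code H)" by (rule edges_on_edge_code[OF L])
  have pt: "point_of x H y v = case_sum x y (vertex_code H v)" for v
    by (simp add: point_of_def vertex_code_def)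
  have "edge_prod x (edge_code H) f y = (\<Prod>e\<in>#edges H. edge_val f (case_sum x y) (vertex_code H ` e))"
    by (simp add: edge_prod_def edge_code_def multiset.map_comp o_def)
  also have "\<dots> = (\<Prod>e\<in>#edges H. f (point_of x H y (Min e), point_of x H y (Max e)))"
  proof (intro arg_cong[where f = prod_mset] image_mset_cong)
    fix e assume e: "e \<in># edges H"
    then have "card e = 2" using L by (auto simp: labelled_multigraph_def)
    then obtain u v where uv: "e = {u, v}" "u < v" by (metis card_2_iff insert_commute nat_neq_iff)
    have e': "vertex_code H ` e \<in># edge_code H" using e by (auto simp: edge_code_def)
    have "case_sum x y p \<in> {0..1}" if "p \<in> vertex_code H ` e" for p
      using that y by (intro case_sum_in_unit[OF E e']) (auto simp: space_unit_product free_verts_reduced[OF H])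
    then have "case_sum x y (vertex_code H u) \<in> {0..1}" "case_sum x y (vertex_code H v) \<in> {0..1}"
      using uv by auto
    then have "edge_val f (case_sum x y) {vertex_code H u, vertex_code H v} =
        f (point_of x H y u, point_of x H y v)"
      unfolding pt by (intro edge_val_pair W_sym[OF f])
    then show "edge_val f (case_sum x y) (vertex_code H ` e) =
        f (point_of x H y (Min e), point_of x H y (Max e))"
      using uv by simp
  qed
  finally show "(\<Prod>e\<in>#edges H. f (point_of x H y (Min e), point_of x H y (Max e))) =
      edge_prod x (edge_code H) f y" by simp
qed

text \<open>All members of the class have equivalent codes, so it does not matter which one
  \<open>SOME\<close> selects in \<open>tdens\<close>.\<close>

lemma tdens_edge_class:
  assumes f: "f \<in> W s" and E: "edges_on k E"
  shows "tdens x (edge_class E) f = edge_density x E f"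
proof -
  define H where "H = (SOME H. H \<in> edge_class E)"
  have "\<exists>H. H \<in> edge_class E"
    using edge_class_realised[OF E] unfolding edge_class_def by (metis mem_Collect_eq)
  then have "H \<in> edge_class E" unfolding H_def by (rule someI_ex)
  then have H: "reduced H" "edge_equiv E (edge_code H)" by (auto simp: edge_class_def)
  obtain \<pi> where "inj_on \<pi> (free_verts E)" "edge_code H = rename \<pi> E"
    using H(2) by (auto simp: edge_equiv_def)
  then show ?thesis
    using edge_density_rename[OF f E] density_eq_edge_density[OF f H(1)]
    by (simp add: tdens_def H_def)
qed

lemma tdens_bound:
  assumes f: "f \<in> W s" and c: "c \<in> HH n k"
  shows "\<bar>tdens x c f\<bar> \<le> s ^ n"
  using c edge_density_bound[OF f] by (auto simp: HH_eq tdens_edge_class[OF f])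

lemma tdens_product:
  assumes f: "f \<in> W s" and c: "c1 \<in> Hall" "c2 \<in> Hall"
  shows "tdens x (product c1 c2) f = tdens x c1 f * tdens x c2 f"
proof -
  obtain k E where E: "edges_on k E" "c1 = edge_class E" using Hall_E[OF c(1)] .
  obtain l F where F: "edges_on l F" "c2 = edge_class F" using Hall_E[OF c(2)] .
  let ?m = "max k l"
  have m: "edges_on ?m E" "edges_on ?m F" using E F edges_on_mono by (meson max.cobounded1 max.cobounded2)+
  let ?E = "rename (\<lambda>v. 2 * v) E" and ?F = "rename (\<lambda>v. 2 * v + 1) F"
  have i: "inj_on (\<lambda>v::nat. 2 * v) A" "inj_on (\<lambda>v::nat. 2 * v + 1) A" for A
    by (auto simp: inj_on_def)
  have "tdens x (product c1 c2) f = edge_density x (?E + ?F) f"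
    using m product_edge_class[OF E(1) F(1)] E F
    by (simp add: tdens_edge_class[OF f, of ?m] edges_on_join) (simp add: edge_join_def)
  also have "\<dots> = edge_density x ?E f * edge_density x ?F f"
  proof (rule edge_density_plus[OF f])
    show "free_verts ?E \<inter> free_verts ?F = {}"
      unfolding free_verts_rename by (auto, presburger)
  qed (use m i edges_on_rename in blast)+
  also have "\<dots> = tdens x c1 f * tdens x c2 f"
    using edge_density_rename[OF f m(1) i(1)] edge_density_rename[OF f m(2) i(2)]
    by (simp add: E F tdens_edge_class[OF f m(1)] tdens_edge_class[OF f m(2)])
  finally show ?thesis .
qed

text \<open>Each edge contributes one factor \<open>t\<close>. Rescaling the kernel thus turns the
  evaluation of a series into a power series in \<open>t\<close> whose coefficients are its
  homogeneous parts.\<close>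

lemma tdens_scale:
  assumes f: "f \<in> W s" and t: "\<bar>t\<bar> \<le> 1" and c: "c \<in> HH n k"
  shows "tdens x c (\<lambda>p\<in>{0..1} \<times> {0..1}. t * f p) = t ^ n * tdens x c f"
proof -
  obtain E where E: "edges_on k E" "size E = n" "c = edge_class E" using c by (auto simp: HH_eq)
  let ?g = "\<lambda>p\<in>{0..1} \<times> {0..1}. t * f p"
  have g: "?g \<in> W s" by (rule W_scale[OF f t])
  have "edge_density x E ?g = (LINT y | Pi\<^sub>M (free_verts E) (\<lambda>_. unit_measure). t ^ n * edge_prod x E f y)"
    unfolding edge_density_def
  proof (rule Bochner_Integration.integral_cong[OF refl])
    fix y assume y: "y \<in> space (Pi\<^sub>M (free_verts E) (\<lambda>_. unit_measure))"
    have "edge_prod x E ?g y = (\<Prod>e\<in>#E. t * edge_val f (case_sum x y) e)"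
      unfolding edge_prod_def
    proof (intro arg_cong[where f = prod_mset] image_mset_cong)
      fix e assume e: "e \<in># E"
      then have "card e = 2" using E by (auto simp: edges_on_def)
      then obtain u v where uv: "e = {u, v}" by (auto simp: card_2_iff)
      have val: "case_sum x y u \<in> {0..1}" "case_sum x y v \<in> {0..1}"
        using y uv by (auto intro!: case_sum_in_unit[OF E(1) e] simp del: atLeastAtMost_iff simp: space_unit_product)
      show "edge_val ?g (case_sum x y) e = t * edge_val f (case_sum x y) e"
        unfolding uv using val W_sym[OF f val] by (subst (1 2) edge_val_pair) auto
    qed
    also have "\<dots> = t ^ size E * edge_prod x E f y"
      unfolding edge_prod_def prod_mset.distrib by (simp add: image_mset_const_eq)
    finally show "edge_prod x E ?g y = t ^ n * edge_prod x E f y" by (simp add: E)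
  qed
  also have "\<dots> = t ^ n * edge_density x E f" by (simp add: edge_density_def)
  finally show ?thesis using E by (simp add: tdens_edge_class[OF f] tdens_edge_class[OF g])
qed

lemma tdens_empty: "f \<in> W s \<Longrightarrow> tdens x (edge_class {#}) f = 1"
proof -
  assume f: "f \<in> W s"
  interpret P: prob_space "Pi\<^sub>M (free_verts {#}) (\<lambda>_. unit_measure)"
    by (intro prob_space_PiM unit_measure.prob_space_axioms)
  show ?thesis
    by (subst tdens_edge_class[OF f, of 0]) (simp_all add: edges_on_def edge_density_def edge_prod_def P.prob_space)
qed

end

lemma sone_eq: "sone = (\<lambda>c. if c = edge_class {#} then 1 else 0)"
proof -
  let ?H = "\<lparr>nlab = 0, verts = {}, edges = {#}, lab = (\<lambda>_. 0)\<rparr>"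
  have "reduced ?H" by (simp add: reduced_def labelled_multigraph_def unlabelled_def)
  then show ?thesis unfolding sone_def by (simp add: hcls_reduced edge_code_def)
qed

section \<open>Graded sums over classes\<close>

lemma HH_subset_Hall: "HH n k \<subseteq> Hall"
  by (auto simp: Hall_def)

lemma Qhat_mono: "k \<le> l \<Longrightarrow> Qhat k \<subseteq> Qhat l"
  unfolding Qhat_def using HH_mono by blast

lemma Qhat_vanish:
  assumes "a \<in> Qhat k" "c \<in> HH n l" "c \<notin> HH n k" shows "a c = 0"
proof (rule ccontr)
  assume "a c \<noteq> 0"
  then obtain m where m: "c \<in> HH m k" using assms(1) by (auto simp: Qhat_def)
  then have "m = n" using HH_disjoint assms(2) by blast
  then show False using m assms(3) by simp
qed

text \<open>A series in \<open>Qhat k\<close> vanishes on classes that use a label beyond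
  \<open>k\<close>, so its norms and its radius do not change when more labels are allowed.\<close>

lemma l1_label_mono:
  assumes "a \<in> Qhat k" "k \<le> l" shows "l1 l a = l1 k a"
  unfolding l1_def
  by (rule ext, rule sum.mono_neutral_right)
     (use Qhat_vanish[OF assms(1)] HH_mono[OF assms(2)] in \<open>auto simp: finite_HH\<close>)

lemma l1_nonneg: "l1 k a n \<ge> 0"
  by (simp add: l1_def sum_nonneg)

lemma QR_mono:
  assumes "k \<le> l" shows "QR k R \<subseteq> QR l R"
proof
  fix a assume "a \<in> QR k R"
  moreover from this have "a \<in> Qhat l" "l1 l a = l1 k a"
    using Qhat_mono[OF assms] l1_label_mono[OF _ assms] by (auto simp: QR_def)
  ultimately show "a \<in> QR l R" by (simp add: QR_def)
qed

lemma QR_subset_Qhat: "QR k R \<subseteq> Qhat k"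
  by (auto simp: QR_def)

text \<open>Passes from a series ordered by degree to an unordered sum over all classes, which does
  not mention \<open>k\<close> and may be regrouped along products.\<close>

lemma graded_has_sum:
  fixes g :: "hclass \<Rightarrow> real"
  assumes supp: "\<And>c. c \<in> Hall \<Longrightarrow> g c \<noteq> 0 \<Longrightarrow> \<exists>n. c \<in> HH n k"
    and sm: "summable (\<lambda>n. \<Sum>c\<in>HH n k. \<bar>g c\<bar>)"
  shows "(\<lambda>c. norm (g c)) summable_on Hall" and "(\<lambda>n. \<Sum>c\<in>HH n k. g c) sums (\<Sum>\<^sub>\<infinity>c\<in>Hall. g c)"
proof -
  let ?S = "\<Union>n. HH n k"
  have "(\<lambda>c. \<bar>g c\<bar>) summable_on ?S"
  proof (rule nonneg_bdd_above_summable_on)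
    show "bdd_above (sum (\<lambda>c. \<bar>g c\<bar>) ` {F. F \<subseteq> ?S \<and> finite F})"
    proof (rule bdd_aboveI2)
      fix F assume "F \<in> {F. F \<subseteq> ?S \<and> finite F}"
      then have F: "F \<subseteq> ?S" "finite F" by auto
      have "\<forall>c\<in>F. \<exists>n. c \<in> HH n k" using F(1) by blast
      then obtain m where m: "\<And>c. c \<in> F \<Longrightarrow> c \<in> HH (m c) k" using bchoice[of F "\<lambda>c n. c \<in> HH n k"] by auto
      \<comment> \<open>Beyond every degree that occurs in \<open>F\<close>, so that
        \<open>F\<close> lies in the first \<open>N\<close> layers; inserting 0 covers an empty
        \<open>F\<close>.\<close>
      define N where "N = Suc (Max (insert 0 (m ` F)))"
      have "m c < N" if "c \<in> F" for c
        unfolding N_def using that F(2) by (simp add: le_imp_less_Suc)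
      then have "F \<subseteq> (\<Union>n<N. HH n k)" using m by blast
      then have "(\<Sum>c\<in>F. \<bar>g c\<bar>) \<le> (\<Sum>c\<in>(\<Union>n<N. HH n k). \<bar>g c\<bar>)"
        by (intro sum_mono2) (auto simp: finite_HH)
      also have "\<dots> = (\<Sum>n<N. \<Sum>c\<in>HH n k. \<bar>g c\<bar>)"
        using HH_disjoint by (intro sum.UNION_disjoint) (auto simp: finite_HH)
      also have "\<dots> \<le> (\<Sum>n. \<Sum>c\<in>HH n k. \<bar>g c\<bar>)"
        by (intro sum_le_suminf sm) (auto intro: sum_nonneg)
      finally show "(\<Sum>c\<in>F. \<bar>g c\<bar>) \<le> (\<Sum>n. \<Sum>c\<in>HH n k. \<bar>g c\<bar>)" .
    qed
  qed simp
  then show abs: "(\<lambda>c. norm (g c)) summable_on Hall"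
    by (subst summable_on_cong_neutral[where T = ?S and g = "\<lambda>c. \<bar>g c\<bar>"])
       (use supp in \<open>auto simp: Hall_def\<close>)
  have "(g has_sum (\<Sum>\<^sub>\<infinity>c\<in>Hall. g c)) Hall"
    using abs_summable_summable[OF abs] by simp
  then have S: "(g has_sum (\<Sum>\<^sub>\<infinity>c\<in>Hall. g c)) ?S"
    by (subst has_sum_cong_neutral[where T = Hall and g = g])
       (use supp in \<open>auto simp: Hall_def\<close>)
  \<comment> \<open>A class has only one degree, so pairs of degree and class may replace the
    classes, and the sum can be taken degree by degree.\<close>
  have img: "snd ` Sigma UNIV (\<lambda>n. HH n k) = ?S" by force
  have inj: "inj_on snd (Sigma UNIV (\<lambda>n. HH n k))"
    using HH_disjoint by (intro inj_onI) auto
  have "((g \<circ> snd) has_sum (\<Sum>\<^sub>\<infinity>c\<in>Hall. g c)) (Sigma UNIV (\<lambda>n. HH n k))"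
    using S has_sum_reindex[OF inj, of g] unfolding img by simp
  then have "((\<lambda>n. \<Sum>c\<in>HH n k. g c) has_sum (\<Sum>\<^sub>\<infinity>c\<in>Hall. g c)) UNIV"
    by (rule has_sum_SigmaD) (auto simp: o_def finite_HH)
  then show "(\<lambda>n. \<Sum>c\<in>HH n k. g c) sums (\<Sum>\<^sub>\<infinity>c\<in>Hall. g c)"
    by (rule has_sum_imp_sums)
qed

text \<open>Both sides sum \<open>(g c1 * u c1) * (h c2 * u c2)\<close> over all pairs, once as an
  iterated sum and once by fibres of the product, where multiplicativity of \<open>u\<close> lets
  \<open>u c\<close> be factored out.\<close>

lemma infsum_regroup_products:
  fixes g h u :: "hclass \<Rightarrow> real"
  assumes g: "(\<lambda>c. norm (g c * u c)) summable_on Hall" and h: "(\<lambda>c. norm (h c * u c)) summable_on Hall"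
    and u: "\<And>c1 c2. c1 \<in> Hall \<Longrightarrow> c2 \<in> Hall \<Longrightarrow> u (product c1 c2) = u c1 * u c2"
  shows "(\<Sum>\<^sub>\<infinity>c\<in>Hall. smult g h c * u c) = (\<Sum>\<^sub>\<infinity>c\<in>Hall. g c * u c) * (\<Sum>\<^sub>\<infinity>c\<in>Hall. h c * u c)"
proof -
  let ?P = "\<lambda>(c1, c2). (g c1 * u c1) * (h c2 * u c2)"
  let ?A = "\<Sum>\<^sub>\<infinity>c\<in>Hall. g c * u c" and ?B = "\<Sum>\<^sub>\<infinity>c\<in>Hall. h c * u c"
  have "(\<lambda>p. norm (?P p)) summable_on Hall \<times> Hall"
  proof (subst Infinite_Sum.abs_summable_on_Sigma_iff, intro conjI ballI)
    fix c1
    show "(\<lambda>c2. norm (?P (c1, c2))) summable_on Hall"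
      using summable_on_cmult_right[OF h, of "norm (g c1 * u c1)"] by (simp only: norm_mult prod.case)
    have "(\<lambda>c1. norm (g c1 * u c1) * (\<Sum>\<^sub>\<infinity>c2\<in>Hall. norm (h c2 * u c2))) summable_on Hall"
      by (rule summable_on_cmult_left[OF g])
    then show "(\<lambda>c1. norm (\<Sum>\<^sub>\<infinity>c2\<in>Hall. norm (?P (c1, c2)))) summable_on Hall"
      by (simp add: norm_mult[of "g _ * u _"] infsum_cmult_right' infsum_nonneg abs_mult del: norm_mult)
  qed
  then have sm: "?P summable_on Hall \<times> Hall" by (rule abs_summable_summable)
  have "infsum ?P (Hall \<times> Hall) = (\<Sum>\<^sub>\<infinity>c1\<in>Hall. \<Sum>\<^sub>\<infinity>c2\<in>Hall. (g c1 * u c1) * (h c2 * u c2))"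
    using infsum_Sigma_banach[OF sm] by simp
  also have "\<dots> = ?A * ?B" by (simp only: infsum_cmult_right' infsum_cmult_left')
  finally have "(?P has_sum (?A * ?B)) (Hall \<times> Hall)"
    using has_sum_infsum[OF sm] by simp
  \<comment> \<open>Every pair has exactly one product, so the fibres \<open>factor_pairs c\<close>
    partition \<open>Hall \<times> Hall\<close>.\<close>
  moreover have "snd ` Sigma Hall factor_pairs = Hall \<times> Hall"
    using product_in_Hall by (force simp: factor_pairs_def image_iff)
  moreover have "inj_on snd (Sigma Hall factor_pairs)"
    by (intro inj_onI) (auto simp: factor_pairs_def)
  ultimately have "((?P \<circ> snd) has_sum (?A * ?B)) (Sigma Hall factor_pairs)"
    using has_sum_reindex[of snd "Sigma Hall factor_pairs" ?P] by simp
  then have "((\<lambda>c. smult g h c * u c) has_sum (?A * ?B)) Hall"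
  proof (rule has_sum_SigmaD)
    fix c assume "c \<in> Hall"
    have "(\<Sum>p\<in>factor_pairs c. ?P p) = (\<Sum>(c1, c2)\<in>factor_pairs c. g c1 * h c2 * u c)"
      by (rule sum.cong) (auto simp: factor_pairs_def u)
    also have "\<dots> = smult g h c * u c"
      by (simp add: smult_eq sum_distrib_right case_prod_unfold)
    finally show "((\<lambda>p. (?P \<circ> snd) (c, p)) has_sum (smult g h c * u c)) (factor_pairs c)"
      using has_sum_finite[OF finite_factor_pairs, of ?P c] by (simp add: o_def)
  qed
  then show ?thesis by (rule infsumI)
qed

section \<open>The algebras of series\<close>

lemma conv_radius_mono_norm:
  fixes f g :: "nat \<Rightarrow> real"
  assumes "\<And>n. \<bar>f n\<bar> \<le> g n" shows "conv_radius g \<le> conv_radius f"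
proof (rule conv_radius_geI_ex')
  fix r :: real assume r: "0 < r" "ereal r < conv_radius g"
  then have "summable (\<lambda>n. g n * r ^ n)" by (intro summable_in_conv_radius) simp
  moreover have "norm (f n * r ^ n) \<le> g n * r ^ n" for n
    using assms[of n] r by (simp add: abs_mult mult_right_mono)
  ultimately show "summable (\<lambda>n. f n * of_real r ^ n)"
    by (simp add: summable_comparison_test')
qed

lemma QR_I:
  assumes "a \<in> Qhat k" "\<And>n. l1 k a n \<le> g n" "R < conv_radius g \<or> conv_radius g = \<infinity>"
  shows "a \<in> QR k R"
proof -
  have "conv_radius g \<le> conv_radius (l1 k a)"
    using assms(2) l1_nonneg by (intro conv_radius_mono_norm) (metis abs_of_nonneg)
  then show ?thesis using assms unfolding QR_def by (auto intro: less_le_trans)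
qed

text \<open>The common end of the closure under sums and products, whose radius is at least the
  smaller of the two; the alternative \<open>M = \<infinity>\<close> covers
  \<open>R = \<infinity>\<close>.\<close>

lemma QR_min:
  assumes "a \<in> QR k R" "b \<in> QR k R"
    and "min (conv_radius (l1 k a)) (conv_radius (l1 k b)) \<le> M"
  shows "R < M \<or> M = \<infinity>"
proof -
  have "R < conv_radius (l1 k a) \<or> conv_radius (l1 k a) = \<infinity>"
    "R < conv_radius (l1 k b) \<or> conv_radius (l1 k b) = \<infinity>"
    using assms(1,2) by (auto simp: QR_def)
  then show ?thesis using assms(3) by (auto simp: min_def split: if_splits intro: less_le_trans)
qed

lemma Qhat_add:
  assumes "a \<in> Qhat k" "b \<in> Qhat k" shows "(\<lambda>c. a c + b c) \<in> Qhat k"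
proof -
  have "\<exists>n. c \<in> HH n k" if "a c + b c \<noteq> 0" for c
    using that assms by (cases "a c = 0") (auto simp: Qhat_def)
  then show ?thesis by (simp add: Qhat_def)
qed

lemma QR_add:
  assumes "a \<in> QR k R" "b \<in> QR k R" shows "(\<lambda>c. a c + b c) \<in> QR k R"
proof (rule QR_I)
  show "(\<lambda>c. a c + b c) \<in> Qhat k"
    using assms QR_subset_Qhat by (blast intro: Qhat_add)
  show "l1 k (\<lambda>c. a c + b c) n \<le> l1 k a n + l1 k b n" for n
    unfolding l1_def sum.distrib[symmetric] by (intro sum_mono) (rule abs_triangle_ineq)
  show "R < conv_radius (\<lambda>n. l1 k a n + l1 k b n) \<or> conv_radius (\<lambda>n. l1 k a n + l1 k b n) = \<infinity>"
    by (rule QR_min[OF assms conv_radius_add_ge])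
qed

lemma QR_scale:
  assumes "a \<in> QR k R" shows "(\<lambda>c. r * a c) \<in> QR k R"
proof (rule QR_I)
  show "(\<lambda>c. r * a c) \<in> Qhat k" using assms by (auto simp: QR_def Qhat_def)
  show "l1 k (\<lambda>c. r * a c) n \<le> \<bar>r\<bar> * l1 k a n" for n
    unfolding l1_def sum_distrib_left by (simp add: abs_mult)
  show "R < conv_radius (\<lambda>n. \<bar>r\<bar> * l1 k a n) \<or> conv_radius (\<lambda>n. \<bar>r\<bar> * l1 k a n) = \<infinity>"
    using assms by (cases "r = 0") (auto simp: QR_def conv_radius_cmult_left)
qed

lemma smult_Qhat:
  assumes "a \<in> Qhat k" "b \<in> Qhat k" shows "smult a b \<in> Qhat k"
  unfolding Qhat_def
proof (intro CollectI allI impI)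
  fix c assume "smult a b c \<noteq> 0"
  then obtain p where "p \<in> factor_pairs c" "(case p of (c1, c2) \<Rightarrow> a c1 * b c2) \<noteq> 0"
    unfolding smult_eq by (rule sum.not_neutral_contains_not_neutral)
  then obtain c1 c2 where c: "(c1, c2) \<in> factor_pairs c" "a c1 \<noteq> 0" "b c2 \<noteq> 0"
    by (cases p) auto
  then obtain n m where "c1 \<in> HH n k" "c2 \<in> HH m k" using assms unfolding Qhat_def by blast
  moreover have "is_product c1 c2 c" using c(1) by (auto simp: factor_pairs_def is_product_iff_product)
  ultimately show "\<exists>n. c \<in> HH n k" using is_product_HH by blast
qed

text \<open>A coefficient of the product sums over factorisations, and the degrees of the factors
  add up to \<open>n\<close>. The resulting bound is a Cauchy product, for which the radius of
  convergence is under control.\<close>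

lemma l1_smult_le: "l1 k (smult a b) n \<le> (\<Sum>i\<le>n. l1 k a i * l1 k b (n - i))"
proof -
  let ?g = "\<lambda>(c1, c2). \<bar>a c1\<bar> * \<bar>b c2\<bar>"
  have "l1 k (smult a b) n \<le> (\<Sum>c\<in>HH n k. \<Sum>p\<in>factor_pairs c. ?g p)"
    unfolding l1_def smult_eq
    by (intro sum_mono order_trans[OF sum_abs]) (auto simp: abs_mult intro!: sum_mono)
  also have "\<dots> = (\<Sum>p\<in>(\<Union>c\<in>HH n k. factor_pairs c). ?g p)"
    by (intro sum.UNION_disjoint[symmetric] ballI finite_HH finite_factor_pairs)
       (auto simp: factor_pairs_def)
  also have "\<dots> \<le> (\<Sum>p\<in>(\<Union>i\<le>n. HH i k \<times> HH (n - i) k). ?g p)"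
    by (intro sum_mono2 UN_least factor_pairs_HH) (auto simp: finite_HH)
  also have "\<dots> = (\<Sum>i\<le>n. \<Sum>p\<in>HH i k \<times> HH (n - i) k. ?g p)"
    using HH_disjoint by (intro sum.UNION_disjoint) (auto simp: finite_HH)
  also have "\<dots> = (\<Sum>i\<le>n. l1 k a i * l1 k b (n - i))"
    by (simp add: l1_def sum_product sum.cartesian_product)
  finally show ?thesis .
qed

lemma QR_smult:
  assumes "a \<in> QR k R" "b \<in> QR k R" shows "smult a b \<in> QR k R"
proof (rule QR_I)
  show "smult a b \<in> Qhat k" using assms QR_subset_Qhat smult_Qhat by blast
  show "R < conv_radius (\<lambda>n. \<Sum>i\<le>n. l1 k a i * l1 k b (n - i)) \<or>
      conv_radius (\<lambda>n. \<Sum>i\<le>n. l1 k a i * l1 k b (n - i)) = \<infinity>"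
    by (rule QR_min[OF assms conv_radius_mult_ge])
qed (rule l1_smult_le)

text \<open>Finite support leaves only finitely many nonzero degrees, so the radius of convergence
  is infinite.\<close>

lemma Q_subset_QR: "Q k \<subseteq> QR k R"
proof
  fix a assume a: "a \<in> Q k"
  have fin: "finite {c. a c \<noteq> 0}" using a by (simp add: Q_def)
  have "\<forall>c. \<exists>n. a c \<noteq> 0 \<longrightarrow> c \<in> HH n k"
    using a by (auto simp: Q_def Qhat_def)
  then obtain m where m: "\<And>c. a c \<noteq> 0 \<Longrightarrow> c \<in> HH (m c) k"
    using choice[of "\<lambda>c n. a c \<noteq> 0 \<longrightarrow> c \<in> HH n k"] by auto
  have "l1 k a n = 0" if n: "n > Max (insert 0 (m ` {c. a c \<noteq> 0}))" for n
  proof -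
    have "a c = 0" if c: "c \<in> HH n k" for c
    proof (rule ccontr)
      assume "a c \<noteq> 0"
      then have "m c = n" using m c HH_disjoint by blast
      moreover have "m c \<le> Max (insert 0 (m ` {c. a c \<noteq> 0}))"
        using \<open>a c \<noteq> 0\<close> fin by (intro Max_ge) auto
      ultimately show False using n by linarith
    qed
    then show ?thesis by (simp add: l1_def)
  qed
  then have "eventually (\<lambda>n. l1 k a n = 0) sequentially"
    using eventually_gt_at_top by (rule eventually_mono[rotated])
  then have "conv_radius (l1 k a) = conv_radius (\<lambda>_. 0 :: real)" by (rule conv_radius_cong')
  then show "a \<in> QR k R" using a by (simp add: QR_def Q_def)
qed

lemma QN_subset_QNR: "QN \<subseteq> QNR R"
  unfolding QN_def QNR_def using Q_subset_QR by blast

lemma Q_mono: "k \<le> l \<Longrightarrow> Q k \<subseteq> Q l"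
  using Qhat_mono by (auto simp: Q_def)

lemma sone_in_Q: "sone \<in> Q 0"
proof -
  have "edge_class {#} \<in> HH 0 0" by (simp add: HH_eq edges_on_def)
  then show ?thesis by (auto simp: sone_eq Q_def Qhat_def)
qed

lemma Q_smult:
  assumes "a \<in> Q k" "b \<in> Q k" shows "smult a b \<in> Q k"
proof -
  have "{c. smult a b c \<noteq> 0} \<subseteq> (\<lambda>(c1, c2). product c1 c2) ` ({c. a c \<noteq> 0} \<times> {c. b c \<noteq> 0})"
  proof
    fix c assume "c \<in> {c. smult a b c \<noteq> 0}"
    then obtain p where "p \<in> factor_pairs c" "(case p of (c1, c2) \<Rightarrow> a c1 * b c2) \<noteq> 0"
      unfolding smult_eq mem_Collect_eq by (rule sum.not_neutral_contains_not_neutral)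
    then show "c \<in> (\<lambda>(c1, c2). product c1 c2) ` ({c. a c \<noteq> 0} \<times> {c. b c \<noteq> 0})"
      by (cases p) (auto simp: factor_pairs_def)
  qed
  then have "finite {c. smult a b c \<noteq> 0}"
    using assms by (auto simp: Q_def intro: finite_subset)
  then show ?thesis using assms smult_Qhat by (auto simp: Q_def)
qed

text \<open>Any two elements lie in a common stage of the chain, where the operations are
  available.\<close>

lemma subalgebra_directed_union:
  assumes "\<And>k l. k \<le> l \<Longrightarrow> A k \<subseteq> A l" "sone \<in> A (0::nat)"
    and "\<And>k a b. a \<in> A k \<Longrightarrow> b \<in> A k \<Longrightarrow> (\<lambda>c. a c + b c) \<in> A k"
    and "\<And>k a b. a \<in> A k \<Longrightarrow> b \<in> A k \<Longrightarrow> smult a b \<in> A k"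
    and "\<And>k a r. a \<in> A k \<Longrightarrow> (\<lambda>c. r * a c) \<in> A k"
  shows "subalgebra_series (\<Union>k. A k)"
proof -
  have *: "\<exists>m. a \<in> A m \<and> b \<in> A m" if "a \<in> A k" "b \<in> A l" for a b k l
    using that assms(1)[of k "max k l"] assms(1)[of l "max k l"] by auto
  show ?thesis
    unfolding subalgebra_series_def
    using assms(2-) by (auto dest: *, (metis *)+)
qed

lemma subalgebra_QNR: "subalgebra_series (QNR R)"
  unfolding QNR_def
  by (rule subalgebra_directed_union[OF QR_mono _ QR_add QR_smult QR_scale])
     (use Q_subset_QR sone_in_Q in blast)+

lemma Q_add: "a \<in> Q k \<Longrightarrow> b \<in> Q k \<Longrightarrow> (\<lambda>c. a c + b c) \<in> Q k"
  by (auto simp: Q_def Qhat_add intro: finite_subset[of _ "{c. a c \<noteq> 0} \<union> {c. b c \<noteq> 0}"])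

lemma Q_scale: "a \<in> Q k \<Longrightarrow> (\<lambda>c. r * a c) \<in> Q k"
  by (auto simp: Q_def Qhat_def)

lemma subalgebra_QN: "subalgebra_series QN"
  unfolding QN_def
  by (rule subalgebra_directed_union) (fact Q_mono sone_in_Q Q_add Q_smult Q_scale)+

section \<open>Evaluation of series\<close>

text \<open>The sum runs over all classes at once, so the value does not depend on a number of
  labels chosen for \<open>a\<close>.\<close>

definition series_eval :: "(nat \<Rightarrow> real) \<Rightarrow> real \<Rightarrow> series \<Rightarrow> wfun" where
  "series_eval x s a = (\<lambda>f\<in>W s. \<Sum>\<^sub>\<infinity>c\<in>Hall. a c * tdens x c f)"

definition slice :: "(nat \<Rightarrow> real) \<Rightarrow> nat \<Rightarrow> series \<Rightarrow> (real \<times> real \<Rightarrow> real) \<Rightarrow> nat \<Rightarrow> real" where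
  "slice x k a f n = (\<Sum>c\<in>HH n k. a c * tdens x c f)"

lemma topspace_hat_top: "topspace (hat_top k) = Qhat k"
proof (rule subset_antisym)
  show "topspace (hat_top k) \<subseteq> Qhat k"
    using openin_topspace[of "hat_top k"] unfolding openin_hat_top by blast
  have "openin (hat_top k) (Qhat k)" by (simp add: openin_hat_top)
  then show "Qhat k \<subseteq> topspace (hat_top k)" by (rule openin_subset)
qed

lemma topspace_unif_top: "topspace (unif_top s) = Func s"
proof (rule subset_antisym)
  show "topspace (unif_top s) \<subseteq> Func s"
    using openin_topspace[of "unif_top s"] unfolding openin_unif_top by blast
  have "openin (unif_top s) (Func s)" by (auto simp: openin_unif_top intro: exI[of _ 1])
  then show "Func s \<subseteq> topspace (unif_top s)" by (rule openin_subset)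
qed

text \<open>Agreement below a fixed degree is an equivalence relation, so such a neighbourhood of
  \<open>a\<close> is a neighbourhood of all its points. The precision \<open>N a\<close> may vary
  with the centre, as it comes from continuity at single points.\<close>

lemma openin_hat_top_agree:
  "openin (hat_top k) {b \<in> Qhat k. \<exists>a\<in>P. \<forall>n<N a. \<forall>c\<in>HH n k. b c = a c}"
  unfolding openin_hat_top
proof (intro conjI ballI)
  fix b assume "b \<in> {b \<in> Qhat k. \<exists>a\<in>P. \<forall>n<N a. \<forall>c\<in>HH n k. b c = a c}"
  then obtain a where "a \<in> P" "\<forall>n<N a. \<forall>c\<in>HH n k. b c = a c" by blast
  then show "\<exists>M. \<forall>d\<in>Qhat k. (\<forall>n<M. \<forall>c\<in>HH n k. d c = b c) \<longrightarrow>
      d \<in> {b \<in> Qhat k. \<exists>a\<in>P. \<forall>n<N a. \<forall>c\<in>HH n k. b c = a c}"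
    by (intro exI[of _ "N a"]) auto
qed blast

lemma trunc_in_Q:
  assumes "a \<in> Qhat k" shows "trunc N a \<in> Q k"
proof -
  have "{c. trunc N a c \<noteq> 0} \<subseteq> (\<Union>n<N. HH n k)"
    using Qhat_vanish[OF assms] by (auto simp: trunc_def split: if_splits)
  then have "finite {c. trunc N a c \<noteq> 0}" by (rule finite_subset) (simp add: finite_HH)
  then show ?thesis using assms by (auto simp: Q_def Qhat_def trunc_def)
qed

lemma trunc_HH: "c \<in> HH n k \<Longrightarrow> trunc N a c = (if n < N then a c else 0)"
  unfolding trunc_def using HH_disjoint by metis

lemma series_eval_QN:
  assumes "a \<in> QN" shows "series_eval x s a = alpha x s a"
  unfolding series_eval_def alpha_def
proof (rule restrict_ext)
  fix f
  have "finite {c. a c \<noteq> 0}" "{c. a c \<noteq> 0} \<subseteq> Hall"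
    using assms unfolding QN_def Q_def Qhat_def Hall_def by blast+
  then show "(\<Sum>\<^sub>\<infinity>c\<in>Hall. a c * tdens x c f) = (\<Sum>c | a c \<noteq> 0. a c * tdens x c f)"
    by (subst infsum_cong_neutral[where T = "{c. a c \<noteq> 0}" and g = "\<lambda>c. a c * tdens x c f"]) auto
qed

context
  fixes x :: "nat \<Rightarrow> real" and s :: real and R :: ereal
  assumes x: "\<forall>i\<ge>1. x i \<in> {0..1}" and s: "0 < s" and sR: "ereal s < R"
begin

lemma summable_l1:
  assumes "a \<in> QR k R" shows "summable (\<lambda>n. l1 k a n * s ^ n)"
  using assms s sR by (intro summable_in_conv_radius) (auto simp: QR_def intro: less_trans)

lemma slice_bound:
  assumes "f \<in> W s" shows "(\<Sum>c\<in>HH n k. \<bar>a c * tdens x c f\<bar>) \<le> l1 k a n * s ^ n"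
  unfolding l1_def sum_distrib_right abs_mult
  using tdens_bound[OF x assms] by (intro sum_mono mult_left_mono) auto

lemma slice_le:
  assumes "f \<in> W s" shows "\<bar>slice x k a f n\<bar> \<le> l1 k a n * s ^ n"
  unfolding slice_def using slice_bound[OF assms] sum_abs by (rule order_trans[rotated])

lemma series_facts:
  assumes a: "a \<in> QR k R" and f: "f \<in> W s"
  shows "(\<lambda>c. norm (a c * tdens x c f)) summable_on Hall" and "slice x k a f sums series_eval x s a f"
proof -
  have 1: "\<exists>n. c \<in> HH n k" if "a c * tdens x c f \<noteq> 0" for c
    using that a by (auto simp: QR_def Qhat_def)
  have 2: "summable (\<lambda>n. \<Sum>c\<in>HH n k. \<bar>a c * tdens x c f\<bar>)"
    using slice_bound[OF f]
    by (intro summable_comparison_test'[OF summable_l1[OF a], where N = 0]) (simp add: sum_nonneg)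
  show "(\<lambda>c. norm (a c * tdens x c f)) summable_on Hall" "slice x k a f sums series_eval x s a f"
    using graded_has_sum[OF 1 2] f unfolding slice_def series_eval_def by auto
qed

lemma alg_hom_series_eval: "alg_hom s (QNR R) (series_eval x s)"
  unfolding alg_hom_def
proof (intro conjI ballI allI subalgebra_QNR)
  fix a show "series_eval x s a \<in> Func s" by (simp add: Func_def series_eval_def)
next
  fix f assume f: "f \<in> W s"
  have c: "edge_class {#} \<in> Hall" using HH_subset_Hall[of 0 0] by (auto simp: HH_eq edges_on_def)
  have "series_eval x s sone f = (\<Sum>\<^sub>\<infinity>c\<in>{edge_class {#}}. sone c * tdens x c f)"
    unfolding series_eval_def using f c
    by (simp del: infsum_finite) (rule infsum_cong_neutral, auto simp: sone_eq)
  then show "series_eval x s sone f = 1" by (simp add: sone_eq tdens_empty[OF x f])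
next
  fix f r a assume f: "f \<in> W s"
  then show "series_eval x s (\<lambda>c. r * a c) f = r * series_eval x s a f"
    by (simp add: series_eval_def mult.assoc infsum_cmult_right')
next
  fix f a b assume f: "f \<in> W s" and "a \<in> QNR R" "b \<in> QNR R"
  then obtain k l where "a \<in> QR k R" "b \<in> QR l R" unfolding QNR_def by blast
  then have a: "a \<in> QR (max k l) R" and b: "b \<in> QR (max k l) R"
    using QR_mono[of k "max k l" R] QR_mono[of l "max k l" R] by auto
  note sa = series_facts(1)[OF a f] and sb = series_facts(1)[OF b f]
  show "series_eval x s (\<lambda>c. a c + b c) f = series_eval x s a f + series_eval x s b f"
    using f infsum_add[OF abs_summable_summable[OF sa] abs_summable_summable[OF sb]]
    by (simp add: series_eval_def distrib_right)
  show "series_eval x s (smult a b) f = series_eval x s a f * series_eval x s b f"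
    using f infsum_regroup_products[OF sa sb tdens_product[OF x f]]
    by (simp add: series_eval_def)
qed

text \<open>The Weierstrass test: degree \<open>n\<close> is bounded by
  \<open>l1 k a n * s ^ n\<close> uniformly in the kernel, and truncations evaluate to partial
  sums.\<close>

lemma uniform_limit_trunc:
  assumes "a \<in> QNR R"
  shows "uniform_limit (W s) (\<lambda>N. alpha x s (trunc N a)) (series_eval x s a) sequentially"
proof -
  obtain k where a: "a \<in> QR k R" using assms by (auto simp: QNR_def)
  have "uniform_limit (W s) (\<lambda>N f. \<Sum>n<N. slice x k a f n) (\<lambda>f. \<Sum>n. slice x k a f n) sequentially"
    using slice_le by (intro Weierstrass_m_test[OF _ summable_l1[OF a]]) simp
  moreover have "alpha x s (trunc N a) f = (\<Sum>n<N. slice x k a f n)" if f: "f \<in> W s" for N f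
  proof -
    have t: "trunc N a \<in> Q k" using trunc_in_Q a QR_subset_Qhat by blast
    then have "slice x k (trunc N a) f sums series_eval x s (trunc N a) f"
      using Q_subset_QR f by (blast intro: series_facts)
    moreover have "slice x k (trunc N a) f = (\<lambda>n. if n \<in> {..<N} then slice x k a f n else 0)"
      by (rule ext) (simp add: slice_def trunc_HH cong: sum.cong)
    ultimately have "series_eval x s (trunc N a) f = (\<Sum>n\<in>{..<N}. slice x k a f n)"
      using sums_If_finite_set[of "{..<N}" "slice x k a f"] by (auto intro: sums_unique2)
    moreover have "trunc N a \<in> QN" using t by (auto simp: QN_def)
    ultimately show ?thesis by (simp add: series_eval_QN)
  qed
  moreover have "(\<Sum>n. slice x k a f n) = series_eval x s a f" if f: "f \<in> W s" for f
    using series_facts(2)[OF a f] by (rule sums_unique[symmetric])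
  ultimately show ?thesis by (simp cong: uniform_limit_cong')
qed

text \<open>On the ball the slices of all members obey one bound \<open>C * q ^ n\<close> with
  \<open>q = s / r < 1\<close>. Two series agreeing below degree \<open>N\<close> thus differ in
  value by at most a geometric tail, uniformly over \<open>W s\<close>.\<close>

lemma continuous_series_eval:
  assumes r: "s < r"
  shows "continuous_map (subtopology (hat_top k) (QR k R \<inter> weight_ball k r C)) (unif_top s)
           (series_eval x s)"
proof -
  let ?S = "QR k R \<inter> weight_ball k r C"
  define q where "q = s / r"
  have q: "0 < q" "q < 1" using s r by (auto simp: q_def)
  have est: "\<bar>series_eval x s b f - series_eval x s a f\<bar> \<le> 2 * C * q ^ N / (1 - q)"
    if a: "a \<in> ?S" and b: "b \<in> ?S" and f: "f \<in> W s"
      and ab: "\<forall>n<N. \<forall>c\<in>HH n k. b c = a c" for a b f N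
  proof -
    have term_bound: "\<bar>slice x k d f n\<bar> \<le> C * q ^ n" if "d \<in> ?S" for d n
    proof -
      have "\<bar>slice x k d f n\<bar> \<le> l1 k d n * s ^ n" by (rule slice_le[OF f])
      also have "\<dots> = (l1 k d n * r ^ n) * q ^ n" using r s by (simp add: q_def power_divide)
      also have "\<dots> \<le> C * q ^ n"
        using that q by (intro mult_right_mono) (auto simp: weight_ball_def)
      finally show ?thesis .
    qed
    let ?d = "\<lambda>n. slice x k b f n - slice x k a f n"
    have "?d sums (series_eval x s b f - series_eval x s a f)"
      using a b f by (intro sums_diff series_facts(2)) auto
    moreover have "(\<Sum>n<N. ?d n) = 0"
      using ab by (intro sum.neutral) (simp add: slice_def cong: sum.cong)
    ultimately have D: "(\<lambda>n. ?d (n + N)) sums (series_eval x s b f - series_eval x s a f)"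
      using sums_split_initial_segment[of ?d _ N] by simp
    have g: "(\<lambda>n. 2 * C * q ^ N * q ^ n) sums (2 * C * q ^ N * (1 / (1 - q)))"
      using q by (intro sums_mult geometric_sums) simp
    \<comment> \<open>Both series contribute a tail, whence the factor 2.\<close>
    have "norm (?d (n + N)) \<le> 2 * C * q ^ N * q ^ n" for n
      using term_bound[OF a, of "n + N"] term_bound[OF b, of "n + N"]
      by (simp add: power_add algebra_simps)
    then have "norm (\<Sum>n. ?d (n + N)) \<le> (\<Sum>n. 2 * C * q ^ N * q ^ n)"
      by (intro norm_suminf_le sums_summable[OF g])
    then show ?thesis using sums_unique[OF D] sums_unique[OF g] by simp
  qed
  have "(\<lambda>N. 2 * C * q ^ N / (1 - q)) \<longlonglongrightarrow> 2 * C * 0 / (1 - q)"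
    using q by (intro tendsto_intros LIMSEQ_power_zero) auto
  then have ex: "\<exists>N. 2 * C * q ^ N / (1 - q) < \<epsilon>" if "\<epsilon> > 0" for \<epsilon>
    using eventually_happens'[OF sequentially_bot order_tendstoD(2)] that by fastforce
  show ?thesis
    unfolding continuous_map_def topspace_subtopology topspace_hat_top topspace_unif_top
  proof (intro conjI allI impI)
    show "series_eval x s \<in> Qhat k \<inter> ?S \<rightarrow> Func s" by (auto simp: Func_def series_eval_def)
  next
    fix U assume U: "openin (unif_top s) U"
    define P where "P = {a \<in> ?S. series_eval x s a \<in> U}"
    have "\<exists>N. \<forall>b\<in>?S. (\<forall>n<N. \<forall>c\<in>HH n k. b c = a c) \<longrightarrow> b \<in> P" if "a \<in> P" for a
    proof -
      have "series_eval x s a \<in> U" "a \<in> ?S" using that by (auto simp: P_def)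
      then obtain \<epsilon> where e: "\<epsilon> > 0"
        "\<forall>h\<in>Func s. (\<forall>f\<in>W s. \<bar>h f - series_eval x s a f\<bar> < \<epsilon>) \<longrightarrow> h \<in> U"
        using U unfolding openin_unif_top by blast
      obtain N where N: "2 * C * q ^ N / (1 - q) < \<epsilon>" using ex[OF e(1)] by blast
      have "b \<in> P" if b: "b \<in> ?S" "\<forall>n<N. \<forall>c\<in>HH n k. b c = a c" for b
      proof -
        have "\<forall>f\<in>W s. \<bar>series_eval x s b f - series_eval x s a f\<bar> < \<epsilon>"
          using est[OF \<open>a \<in> ?S\<close> b(1) _ b(2)] N by (meson le_less_trans)
        moreover have "series_eval x s b \<in> Func s" by (simp add: Func_def series_eval_def)
        ultimately show ?thesis using e(2) b(1) by (auto simp: P_def)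
      qed
      then show ?thesis by blast
    qed
    then obtain N where N: "\<And>a b. a \<in> P \<Longrightarrow> b \<in> ?S \<Longrightarrow> \<forall>n<N a. \<forall>c\<in>HH n k. b c = a c \<Longrightarrow> b \<in> P"
      by metis
    \<comment> \<open>A union of neighbourhoods around all points of the preimage: open in the whole
      space, with the preimage as its trace on \<open>?S\<close>.\<close>
    let ?V = "{b \<in> Qhat k. \<exists>a\<in>P. \<forall>n<N a. \<forall>c\<in>HH n k. b c = a c}"
    have "?V \<inter> ?S = {a \<in> Qhat k \<inter> ?S. series_eval x s a \<in> U}"
    proof (intro subset_antisym subsetI)
      fix b assume "b \<in> ?V \<inter> ?S"
      then have "b \<in> P" using N by blast
      then show "b \<in> {a \<in> Qhat k \<inter> ?S. series_eval x s a \<in> U}"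
        using QR_subset_Qhat by (auto simp: P_def)
    next
      fix b assume "b \<in> {a \<in> Qhat k \<inter> ?S. series_eval x s a \<in> U}"
      then have "b \<in> P" "b \<in> Qhat k" "b \<in> ?S" by (auto simp: P_def)
      then show "b \<in> ?V \<inter> ?S" by blast
    qed
    then show "openin (subtopology (hat_top k) ?S) {a \<in> Qhat k \<inter> ?S. series_eval x s a \<in> U}"
      unfolding openin_subtopology
      by (intro exI[of _ ?V] conjI openin_hat_top_agree) simp
  qed
qed

end

section \<open>Linear independence of densities\<close>

text \<open>A polynomial vanishing on an interval is zero; terms with equal exponents collect in one
  coefficient.\<close>

lemma exponential_sum_coeffs_zero:
  fixes C :: "'j \<Rightarrow> real" and w :: "'j \<Rightarrow> nat"
  assumes J: "finite J" and zero: "\<And>z. 0 < z \<Longrightarrow> z \<le> 1 \<Longrightarrow> (\<Sum>j\<in>J. C j * z ^ w j) = 0"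
  shows "(\<Sum>j\<in>{j\<in>J. w j = m}. C j) = 0"
proof -
  define p where "p = (\<Sum>j\<in>J. monom (C j) (w j))"
  have "poly p z = (\<Sum>j\<in>J. C j * z ^ w j)" for z
    by (simp add: p_def poly_sum poly_monom)
  then have "{0<..1} \<subseteq> {z. poly p z = 0}" using zero by auto
  moreover have "infinite {0<..1::real}" by simp
  ultimately have "infinite {z. poly p z = 0}" by (rule infinite_super)
  then have "p = 0" using poly_roots_finite by blast
  then have "(\<Sum>j\<in>J. if w j = m then C j else 0) = 0"
    by (simp add: p_def coeff_sum[symmetric] flip: coeff_monom)
  then show ?thesis using J by (simp add: sum.inter_filter)
qed

text \<open>With the lower coefficients gone, division by \<open>t ^ n\<close> leaves a power series
  that vanishes for \<open>t \<noteq> 0\<close>, and its limit at 0 is the coefficient.\<close>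

lemma power_series_coeffs_zero:
  fixes a :: "nat \<Rightarrow> real"
  assumes zero: "\<And>t. \<bar>t\<bar> < 1 \<Longrightarrow> (\<lambda>n. a n * t ^ n) sums 0"
  shows "a n = 0"
proof (induction n rule: less_induct)
  case (less n)
  have "(\<lambda>i. a (i + n) * t ^ i) sums 0" if t: "t \<noteq> 0" "norm t < 1" for t
  proof -
    have "(\<lambda>i. a (i + n) * t ^ (i + n)) sums (0 - (\<Sum>i<n. a i * t ^ i))"
      using t by (intro sums_split_initial_segment[of "\<lambda>i. a i * t ^ i"] zero) simp
    then have "(\<lambda>i. a (i + n) * t ^ (i + n)) sums 0" using less by simp
    from sums_mult2[OF this, of "inverse (t ^ n)"] show ?thesis
      using t by (simp add: power_add field_simps)
  qed
  from powser_limit_0_strong[of 1 "\<lambda>i. a (i + n)" "\<lambda>_. 0", OF _ this]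
  have "((\<lambda>_. 0) \<longlongrightarrow> a n) (at (0::real))" by simp
  then show "a n = 0" by (simp add: tendsto_const_iff)
qed

text \<open>Kronecker substitution: a multiset is recovered from the digits of
  its weight in base \<open>n + 1\<close>.\<close>

lemma ex_separating_weight:
  assumes "finite S"
  shows "\<exists>w :: 'a \<Rightarrow> nat. \<forall>F F'. set_mset F \<subseteq> S \<and> set_mset F' \<subseteq> S \<and> size F \<le> n \<and> size F' \<le> n \<and>
           (\<Sum>e\<in>#F. w e) = (\<Sum>e\<in>#F'. w e) \<longrightarrow> F = F'"
  using assms
proof (induction S)
  case empty
  then show ?case by auto
next
  case (insert a S)
  then obtain w :: "'a \<Rightarrow> nat" where w: "\<And>F F'. set_mset F \<subseteq> S \<Longrightarrow> set_mset F' \<subseteq> S \<Longrightarrow>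
      size F \<le> n \<Longrightarrow> size F' \<le> n \<Longrightarrow> (\<Sum>e\<in>#F. w e) = (\<Sum>e\<in>#F'. w e) \<Longrightarrow> F = F'" by metis
  \<comment> \<open>\<open>count F a\<close> is at most \<open>n\<close> and becomes the last digit;
    all other weights are shifted by one digit.\<close>
  define w' where "w' e = (if e = a then 1 else (n + 1) * w e)" for e
  have split: "(\<Sum>e\<in>#F. w' e) = (n + 1) * (\<Sum>e\<in>#filter_mset (\<lambda>e. e \<noteq> a) F. w e) + count F a" for F
    by (induction F) (auto simp: w'_def algebra_simps)
  have "F = F'" if F: "set_mset F \<subseteq> insert a S" "set_mset F' \<subseteq> insert a S" "size F \<le> n" "size F' \<le> n"
    "(\<Sum>e\<in>#F. w' e) = (\<Sum>e\<in>#F'. w' e)" for F F'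
  proof -
    let ?f = "filter_mset (\<lambda>e. e \<noteq> a)"
    have c: "count F a < n + 1" "count F' a < n + 1"
      using F(3,4) count_le_size[of F a] count_le_size[of F' a] by linarith+
    have eq: "(n + 1) * (\<Sum>e\<in>#?f F. w e) + count F a = (n + 1) * (\<Sum>e\<in>#?f F'. w e) + count F' a"
      using F(5) unfolding split .
    have "count F a = count F' a"
      using arg_cong[OF eq, of "\<lambda>m. m mod (n + 1)"] c by (simp only: mod_mult_self4 mod_less)
    moreover have "?f F = ?f F'"
    proof (rule w)
      show "size (?f F) \<le> n" "size (?f F') \<le> n"
        using F(3,4) size_filter_mset_lesseq le_trans by blast+
      show "(\<Sum>e\<in>#?f F. w e) = (\<Sum>e\<in>#?f F'. w e)"
        using eq \<open>count F a = count F' a\<close> by (metis add_right_cancel add_is_0 mult_cancel1 one_neq_zero)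
    qed (use F(1,2) in auto)
    ultimately have "count F e = count F' e" for e
      by (cases "e = a") (simp, metis (mono_tags, lifting) count_filter_mset)
    then show "F = F'" by (rule multiset_eqI)
  qed
  then show ?case by blast
qed

text \<open>
  Labelled vertices occupy the points \<open>x i\<close>, unlabelled ones intervals of length \<open>1/L\<close>. An
  unlabelled vertex that is mapped to a labelled one contributes a null set.
\<close>

fun cell :: "(nat \<Rightarrow> real) \<Rightarrow> nat \<Rightarrow> nat \<Rightarrow> nat + nat \<Rightarrow> real set" where
  "cell x k L (Inl i) = {x i}"
| "cell x k L (Inr j) = {real j / L..<real (j + 1) / L} - x ` {1..k}"

definition cell_indices :: "nat \<Rightarrow> nat \<Rightarrow> (nat + nat) set" where
  "cell_indices k L = Inl ` {1..k} \<union> Inr ` {..<L}"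

lemma finite_cell_indices [simp]: "finite (cell_indices k L)"
  by (simp add: cell_indices_def)

lemma Inl_in_cell_indices [simp]: "Inl i \<in> cell_indices k L \<longleftrightarrow> i \<in> {1..k}"
  and Inr_in_cell_indices [simp]: "Inr j \<in> cell_indices k L \<longleftrightarrow> j < L"
  by (auto simp: cell_indices_def)

fun cell_measure :: "nat \<Rightarrow> nat + nat \<Rightarrow> real" where
  "cell_measure L (Inl i) = 0"
| "cell_measure L (Inr j) = 1 / L"

text \<open>Indexing the values by unordered pairs builds in the symmetry; a singleton index gives
  the value on a diagonal block.\<close>

definition step_kernel ::
    "(nat \<Rightarrow> real) \<Rightarrow> nat \<Rightarrow> nat \<Rightarrow> ((nat + nat) set \<Rightarrow> real) \<Rightarrow> real \<times> real \<Rightarrow> real" where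
  "step_kernel x k L h = (\<lambda>(u, v)\<in>{0..1} \<times> {0..1}.
     \<Sum>p\<in>cell_indices k L. \<Sum>q\<in>cell_indices k L.
       h {p, q} * (indicator (cell x k L p) u * indicator (cell x k L q) v))"

text \<open>The image of a graph under a choice of cells for its free vertices. Unlike
  \<open>rename\<close>, it may send free vertices to labels and collapse an edge to a
  singleton.\<close>

definition push :: "(nat \<Rightarrow> nat + nat) \<Rightarrow> edge_mset \<Rightarrow> edge_mset" where
  "push \<phi> E = image_mset ((`) (case_sum Inl \<phi>)) E"

lemma size_push [simp]: "size (push \<phi> E) = size E"
  by (simp add: push_def)

lemma cell_borel: "cell x k L p \<in> sets borel"
  by (cases p) (auto intro!: sets.Diff borel_closed[of "x ` {_.._}"] finite_imp_closed)

section \<open>Step kernels and their densities\<close>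

context
  fixes x :: "nat \<Rightarrow> real" and k L :: nat and s :: real
  assumes x: "\<forall>i\<ge>1. x i \<in> {0..1}" and inj: "inj_on x {1..}" and L: "L > 0"
begin

text \<open>Distinctness of the points \<open>x i\<close> enters here: different labels have
  different singleton cells, and these points were removed from the intervals.\<close>

lemma cell_disjoint:
  assumes "p \<in> cell_indices k L" "q \<in> cell_indices k L" "u \<in> cell x k L p" "u \<in> cell x k L q"
  shows "p = q"
proof -
  have iv: "i = j" if "real i / L \<le> u" "u < real (i + 1) / L" "real j / L \<le> u" "u < real (j + 1) / L"
    for i j :: nat
  proof -
    have "real i < real (j + 1)" "real j < real (i + 1)"
      using that L by (auto simp: field_simps)
    then show "i = j" by linarith
  qed
  show ?thesis
  proof (cases p; cases q)
    fix i j assume "p = Inl i" "q = Inl j"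
    then show ?thesis using assms inj by (auto simp: inj_on_def)
  next
    fix i j assume "p = Inr i" "q = Inr j"
    then show ?thesis using assms iv[of i j] by auto
  qed (use assms in auto)
qed

lemma cell_subset_unit: "p \<in> cell_indices k L \<Longrightarrow> cell x k L p \<subseteq> {0..1}"
proof (cases p)
  case (Inr j)
  moreover assume "p \<in> cell_indices k L"
  ultimately have j: "real (j + 1) \<le> real L" by auto
  have "u \<in> {0..1}" if "real j / L \<le> u" "u < real (j + 1) / L" for u
  proof -
    have "real (j + 1) / L \<le> 1" using j L by simp
    moreover have "0 \<le> real j / L" by simp
    ultimately show ?thesis using that unfolding atLeastAtMost_iff by linarith
  qed
  then show ?thesis using Inr by auto
qed (use x in auto)

lemma measure_cell:
  assumes p: "p \<in> cell_indices k L"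
  shows "measure unit_measure (cell x k L p) = cell_measure L p"
proof -
  have "measure unit_measure (cell x k L p) = measure lborel (cell x k L p)"
    using cell_subset_unit[OF p] by (intro measure_restrict_space) auto
  also have "\<dots> = cell_measure L p"
  proof (cases p)
    case (Inr j)
    have "x ` {1..k} \<in> null_sets lborel" by (intro finite_imp_null_set_lborel) simp
    then have "measure lborel (cell x k L p) = measure lborel {real j / L..<real (j + 1) / L}"
      unfolding Inr cell.simps by (intro measure_Diff_null_set) auto
    also have "\<dots> = real (j + 1) / L - real j / L"
      by (intro measure_lborel_Ico divide_right_mono) auto
    also have "\<dots> = 1 / L" by (simp add: diff_divide_distrib[symmetric])
    finally show ?thesis using Inr by simp
  qed simp
  finally show ?thesis .
qed

lemma step_kernel_cell:
  assumes "p \<in> cell_indices k L" "q \<in> cell_indices k L" "u \<in> cell x k L p" "v \<in> cell x k L q"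
  shows "step_kernel x k L h (u, v) = h {p, q}"
proof -
  have "indicator (cell x k L p') u * indicator (cell x k L q') v =
      (if p' = p then if q' = q then 1 else 0 else (0::real))"
    if "p' \<in> cell_indices k L" "q' \<in> cell_indices k L" for p' q'
    using that assms cell_disjoint by (auto simp: indicator_def)
  then have "(\<Sum>p'\<in>cell_indices k L. \<Sum>q'\<in>cell_indices k L.
       h {p', q'} * (indicator (cell x k L p') u * indicator (cell x k L q') v)) =
     (\<Sum>p'\<in>cell_indices k L. \<Sum>q'\<in>cell_indices k L. if p' = p then if q' = q then h {p', q'} else 0 else 0)"
    by (intro sum.cong refl) auto
  also have "\<dots> = (\<Sum>p'\<in>cell_indices k L. if p' = p then h {p', q} else 0)"
    using assms(2) by (intro sum.cong refl) (auto simp: sum.delta[OF finite_cell_indices])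
  also have "\<dots> = h {p, q}" using assms(1) by (simp add: sum.delta[OF finite_cell_indices])
  finally show ?thesis
    using assms cell_subset_unit unfolding step_kernel_def by (simp add: subset_iff)
qed

text \<open>The cells miss at most the point 1 of the unit interval: the intervals are half-open,
  and the removed points reappear as labelled cells.\<close>

lemma step_kernel_outside:
  assumes "u \<in> {0..1}" "v \<in> {0..1}"
    "u \<notin> (\<Union>p\<in>cell_indices k L. cell x k L p) \<or> v \<notin> (\<Union>p\<in>cell_indices k L. cell x k L p)"
  shows "step_kernel x k L h (u, v) = 0"
proof -
  have "indicator (cell x k L p) u * indicator (cell x k L q) v = (0::real)"
    if "p \<in> cell_indices k L" "q \<in> cell_indices k L" for p q
    using that assms(3) by (auto simp: indicator_def)
  then have "(\<Sum>p\<in>cell_indices k L. \<Sum>q\<in>cell_indices k L.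
      h {p, q} * (indicator (cell x k L p) u * indicator (cell x k L q) v)) = 0"
    by (intro sum.neutral ballI) simp
  then show ?thesis using assms(1,2) by (simp add: step_kernel_def)
qed

lemma step_kernel_in_W:
  assumes h: "\<And>e. \<bar>h e\<bar> \<le> s" shows "step_kernel x k L h \<in> W s"
proof -
  have s: "0 \<le> s" using h[of "{}"] by linarith
  have "step_kernel x k L h (u, v) \<in> {-s..s}" if uv: "u \<in> {0..1}" "v \<in> {0..1}" for u v
  proof (cases "u \<notin> (\<Union>p\<in>cell_indices k L. cell x k L p) \<or> v \<notin> (\<Union>p\<in>cell_indices k L. cell x k L p)")
    case True
    then show ?thesis using step_kernel_outside[OF uv True] s by simp
  next
    case False
    then obtain p q where "p \<in> cell_indices k L" "q \<in> cell_indices k L"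
      "u \<in> cell x k L p" "v \<in> cell x k L q" by blast
    then have "step_kernel x k L h (u, v) = h {p, q}" by (rule step_kernel_cell)
    then show ?thesis using h[of "{p, q}"] by auto
  qed
  moreover have "step_kernel x k L h (u, v) = step_kernel x k L h (v, u)"
    if uv: "u \<in> {0..1}" "v \<in> {0..1}" for u v
  proof -
    have "(\<Sum>p\<in>cell_indices k L. \<Sum>q\<in>cell_indices k L.
        h {p, q} * (indicator (cell x k L p) u * indicator (cell x k L q) v)) =
      (\<Sum>p\<in>cell_indices k L. \<Sum>q\<in>cell_indices k L.
        h {p, q} * (indicator (cell x k L p) v * indicator (cell x k L q) u))"
      by (subst sum.swap, intro sum.cong refl) (simp only: insert_commute mult.commute)
    then show ?thesis using uv by (simp add: step_kernel_def)
  qed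
  moreover have "step_kernel x k L h \<in> borel_measurable (restrict_space borel ({0..1} \<times> {0..1}))"
  proof -
    have "(\<lambda>r. \<Sum>p\<in>cell_indices k L. \<Sum>q\<in>cell_indices k L.
       h {p, q} * (indicator (cell x k L p) (fst r) * indicator (cell x k L q) (snd r)))
       \<in> borel_measurable (borel \<Otimes>\<^sub>M borel)"
      using cell_borel by measurable
    then have "(\<lambda>r. \<Sum>p\<in>cell_indices k L. \<Sum>q\<in>cell_indices k L.
       h {p, q} * (indicator (cell x k L p) (fst r) * indicator (cell x k L q) (snd r)))
       \<in> borel_measurable (restrict_space borel ({0..1} \<times> {0..1}))"
      unfolding borel_prod by (rule measurable_restrict_space1)
    then show ?thesis
      by (rule measurable_cong[THEN iffD1, rotated])
         (auto simp: step_kernel_def space_restrict_space)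
  qed
  moreover have "step_kernel x k L h \<in> extensional ({0..1} \<times> {0..1})"
    by (simp add: step_kernel_def)
  ultimately show ?thesis unfolding W_def PiE_def by auto
qed

text \<open>By disjointness, a point \<open>y\<close> in the cells selects one cell for each free
  vertex, so a single \<open>\<phi>\<close> survives in the sum and the kernel reads
  \<open>h\<close> on the pushed edges.\<close>

lemma edge_prod_step_kernel:
  assumes h: "\<And>e. \<bar>h e\<bar> \<le> s" and E: "edges_on k E" and y: "\<And>v. v \<in> free_verts E \<Longrightarrow> y v \<in> {0..1}"
  shows "edge_prod x E (step_kernel x k L h) y =
    (\<Sum>\<phi>\<in>free_verts E \<rightarrow>\<^sub>E cell_indices k L.
       (\<Prod>v\<in>free_verts E. indicator (cell x k L (\<phi> v)) (y v)) * (\<Prod>e\<in>#push \<phi> E. h e))"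
    (is "?lhs = (\<Sum>\<phi>\<in>?I. ?ind \<phi> * ?h \<phi>)")
proof -
  let ?f = "step_kernel x k L h"
  have fin: "finite (free_verts E)" by (rule finite_free_verts[OF E])
  have f: "?f \<in> W s" by (rule step_kernel_in_W[OF h])
  have edge: "\<exists>u v. e = {u, v} \<and> case_sum x y u \<in> {0..1} \<and> case_sum x y v \<in> {0..1} \<and>
      edge_val ?f (case_sum x y) e = ?f (case_sum x y u, case_sum x y v)" if e: "e \<in># E" for e
  proof -
    have "card e = 2" using E e by (auto simp: edges_on_def)
    then obtain u v where uv: "e = {u, v}" by (auto simp: card_2_iff)
    then have "case_sum x y u \<in> {0..1}" "case_sum x y v \<in> {0..1}"
      using y by (auto intro!: case_sum_in_unit[OF x E e] simp del: atLeastAtMost_iff)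
    moreover from this have "edge_val ?f (case_sum x y) e = ?f (case_sum x y u, case_sum x y v)"
      unfolding uv by (intro edge_val_pair W_sym[OF f])
    ultimately show ?thesis using uv by blast
  qed
  show ?thesis
  proof (cases "\<forall>v\<in>free_verts E. \<exists>p\<in>cell_indices k L. y v \<in> cell x k L p")
    case True
    then obtain \<psi> where psi: "\<And>v. v \<in> free_verts E \<Longrightarrow> \<psi> v \<in> cell_indices k L \<and> y v \<in> cell x k L (\<psi> v)"
      using bchoice[of "free_verts E" "\<lambda>v p. p \<in> cell_indices k L \<and> y v \<in> cell x k L p"] by blast
    define \<phi>0 where "\<phi>0 = restrict \<psi> (free_verts E)"
    have p0: "\<phi>0 \<in> ?I" "\<And>v. v \<in> free_verts E \<Longrightarrow> y v \<in> cell x k L (\<phi>0 v)"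
      using psi by (auto simp: \<phi>0_def)
    have "?ind \<phi> = (if \<phi> = \<phi>0 then 1 else 0)" if phi: "\<phi> \<in> ?I" for \<phi>
    proof (cases "\<phi> = \<phi>0")
      case False
      then obtain v where v: "v \<in> free_verts E" "\<phi> v \<noteq> \<phi>0 v" using phi p0(1) by (meson PiE_ext)
      then have "y v \<notin> cell x k L (\<phi> v)"
        using cell_disjoint[of "\<phi> v" "\<phi>0 v"] phi p0 by (metis PiE_mem)
      then have "?ind \<phi> = 0" using v fin by (intro prod_zero bexI[of _ v]) auto
      then show ?thesis using False by simp
    qed (simp add: p0(2))
    then have "(\<Sum>\<phi>\<in>?I. ?ind \<phi> * ?h \<phi>) = (\<Sum>\<phi>\<in>?I. if \<phi> = \<phi>0 then ?h \<phi> else 0)"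
      by (intro sum.cong refl) auto
    also have "\<dots> = ?h \<phi>0"
      using p0(1) finite_PiE[OF fin finite_cell_indices] by (simp add: sum.delta)
    also have "\<dots> = (\<Prod>e\<in>#E. h (case_sum Inl \<phi>0 ` e))"
      by (simp add: push_def multiset.map_comp o_def)
    also have "\<dots> = ?lhs"
      unfolding edge_prod_def
    proof (intro arg_cong[where f = prod_mset] image_mset_cong)
      fix e assume e: "e \<in># E"
      then obtain u v where uv: "e = {u, v}"
        "edge_val ?f (case_sum x y) e = ?f (case_sum x y u, case_sum x y v)" using edge by blast
      have "case_sum Inl \<phi>0 p \<in> cell_indices k L \<and> case_sum x y p \<in> cell x k L (case_sum Inl \<phi>0 p)"
        if p: "p \<in> e" for p
      proof (cases p)
        case (Inl i)
        moreover have "p \<in> Inl ` {1..k} \<union> range Inr" using p e E unfolding edges_on_def by blast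
        ultimately show ?thesis by auto
      next
        case (Inr v)
        then have "v \<in> free_verts E" using p e by (auto simp: free_verts_def)
        then show ?thesis using Inr p0 by (auto simp: PiE_mem)
      qed
      then have "?f (case_sum x y u, case_sum x y v) = h {case_sum Inl \<phi>0 u, case_sum Inl \<phi>0 v}"
        using uv(1) by (intro step_kernel_cell) blast+
      then show "h (case_sum Inl \<phi>0 ` e) = edge_val ?f (case_sum x y) e" using uv by simp
    qed
    finally show ?thesis by simp
  next
    case False
    then obtain v where v: "v \<in> free_verts E" "y v \<notin> (\<Union>p\<in>cell_indices k L. cell x k L p)" by blast
    have "?ind \<phi> = 0" if "\<phi> \<in> ?I" for \<phi>
      using PiE_mem[OF that v(1)] v fin by (intro prod_zero bexI[of _ v]) auto
    then have "(\<Sum>\<phi>\<in>?I. ?ind \<phi> * ?h \<phi>) = 0" by (intro sum.neutral ballI) simp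
    \<comment> \<open>A free vertex lies on some edge, and the factor of this edge vanishes.\<close>
    moreover obtain e where e: "e \<in># E" "Inr v \<in> e" using v(1) by (auto simp: free_verts_def)
    obtain u w where uw: "e = {u, w}" "case_sum x y u \<in> {0..1}" "case_sum x y w \<in> {0..1}"
      "edge_val ?f (case_sum x y) e = ?f (case_sum x y u, case_sum x y w)" using edge[OF e(1)] by blast
    have "u = Inr v \<or> w = Inr v" using e(2) uw(1) by auto
    then have "edge_val ?f (case_sum x y) e = 0"
      unfolding uw(4) using v(2) uw(2,3) by (intro step_kernel_outside) (auto simp del: atLeastAtMost_iff)
    then have "?lhs = 0" unfolding edge_prod_def using e(1) by (force simp: prod_mset_zero_iff)
    ultimately show ?thesis by simp
  qed
qed

text \<open>Term by term the integral splits into one-dimensional ones. The density becomes a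
  polynomial in the values of \<open>h\<close>, a count of maps into the cells weighted by
  volume.\<close>

lemma edge_density_step_kernel:
  assumes h: "\<And>e. \<bar>h e\<bar> \<le> s" and E: "edges_on k E"
  shows "edge_density x E (step_kernel x k L h) =
    (\<Sum>\<phi>\<in>free_verts E \<rightarrow>\<^sub>E cell_indices k L.
       (\<Prod>v\<in>free_verts E. cell_measure L (\<phi> v)) * (\<Prod>e\<in>#push \<phi> E. h e))"
proof -
  let ?V = "free_verts E"
  let ?M = "Pi\<^sub>M ?V (\<lambda>_. unit_measure)" and ?I = "?V \<rightarrow>\<^sub>E cell_indices k L"
  have fin: "finite ?V" by (rule finite_free_verts[OF E])
  have ind: "integrable unit_measure (indicator (cell x k L p) :: real \<Rightarrow> real)"
    if "p \<in> cell_indices k L" for p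
    using cell_borel cell_subset_unit[OF that]
    by (intro integrable_real_indicator) (auto simp: sets_restrict_space_iff less_top[symmetric])
  have "edge_density x E (step_kernel x k L h) =
     (LINT y | ?M. (\<Sum>\<phi>\<in>?I. (\<Prod>v\<in>?V. indicator (cell x k L (\<phi> v)) (y v)) * (\<Prod>e\<in>#push \<phi> E. h e)))"
    unfolding edge_density_def
    by (intro Bochner_Integration.integral_cong refl edge_prod_step_kernel[OF h E])
       (auto simp: space_unit_product)
  also have "\<dots> = (\<Sum>\<phi>\<in>?I. (LINT y | ?M. (\<Prod>v\<in>?V. indicator (cell x k L (\<phi> v)) (y v))) * (\<Prod>e\<in>#push \<phi> E. h e))"
    using ind by (subst Bochner_Integration.integral_sum)
      (auto intro!: integrable_mult_left unit_product.product_integrable_prod fin dest: PiE_mem)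
  also have "\<dots> = (\<Sum>\<phi>\<in>?I. (\<Prod>v\<in>?V. cell_measure L (\<phi> v)) * (\<Prod>e\<in>#push \<phi> E. h e))"
  proof (intro sum.cong refl arg_cong2[where f = "(*)"])
    fix \<phi> assume phi: "\<phi> \<in> ?I"
    have "(LINT y | ?M. (\<Prod>v\<in>?V. indicator (cell x k L (\<phi> v)) (y v) :: real)) =
        (\<Prod>v\<in>?V. LINT u | unit_measure. indicator (cell x k L (\<phi> v)) u)"
      using phi by (intro unit_product.product_integral_prod fin ind) (auto simp: PiE_mem)
    also have "\<dots> = (\<Prod>v\<in>?V. cell_measure L (\<phi> v))"
      using measure_cell[OF PiE_mem[OF phi]] cell_subset_unit[OF PiE_mem[OF phi]]
      by (intro prod.cong refl) (simp add: space_restrict_space Int_absorb2)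
    finally show "(LINT y | ?M. (\<Prod>v\<in>?V. indicator (cell x k L (\<phi> v)) (y v))) =
        (\<Prod>v\<in>?V. cell_measure L (\<phi> v))" .
  qed
  finally show ?thesis .
qed

end

section \<open>Extracting the coefficient of one graph\<close>

lemma prod_mset_supported_power:
  fixes s z :: real
  shows "(\<Prod>e\<in>#F. if e \<in> S then s * z ^ w e else 0) =
    (if set_mset F \<subseteq> S then s ^ size F * z ^ (\<Sum>e\<in>#F. w e) else 0)"
  by (induction F) (auto simp: power_add)

theorem densities_linearly_independent:
  fixes x :: "nat \<Rightarrow> real" and s :: real and d :: "hclass \<Rightarrow> real"
  assumes x: "\<forall>i\<ge>1. x i \<in> {0..1}" and inj: "inj_on x {1..}" and s: "0 < s"
    and zero: "\<And>f. f \<in> W s \<Longrightarrow> (\<Sum>c\<in>HH n k. d c * tdens x c f) = 0"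
    and c: "c \<in> HH n k"
  shows "d c = 0"
proof (rule ccontr)
  assume dc: "d c \<noteq> 0"
  have "\<exists>E. edges_on k E \<and> size E = n \<and> c = edge_class E" if "c \<in> HH n k" for c
    using that by (auto simp: HH_eq)
  then obtain rep where rep: "\<And>c. c \<in> HH n k \<Longrightarrow> edges_on k (rep c) \<and> size (rep c) = n \<and> c = edge_class (rep c)"
    by metis
  define V where "V c = free_verts (rep c)" for c
  define D where "D = {c \<in> HH n k. d c \<noteq> 0}"
  have D: "finite D" "D \<noteq> {}" using c dc finite_HH by (auto simp: D_def)
  then have "Max ((\<lambda>c. card (V c)) ` D) \<in> (\<lambda>c. card (V c)) ` D" by (intro Max_in) auto
  then obtain c0 where c0: "c0 \<in> D" "card (V c0) = Max ((\<lambda>c. card (V c)) ` D)" by auto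
  have cmax: "card (V c) \<le> card (V c0)" if "c \<in> D" for c
    unfolding c0(2) using that D by (intro Max_ge) auto
  have c0H: "c0 \<in> HH n k" "d c0 \<noteq> 0" using c0 by (auto simp: D_def)
  define G where "G = rep c0"
  have G: "edges_on k G" "size G = n" "c0 = edge_class G" "free_verts G = V c0"
    using rep[OF c0H(1)] by (auto simp: G_def V_def)
  have finV: "finite (V c)" if "c \<in> HH n k" for c
    unfolding V_def using rep[OF that] by (auto intro: finite_free_verts)
  \<comment> \<open>With these \<open>L\<close> intervals each free vertex of \<open>G\<close> can
    serve as the index of its own cell.\<close>
  obtain L where L: "L > 0" "V c0 \<subseteq> {..<L}"
    using finV[OF c0H(1)] unfolding finite_nat_set_iff_bounded
    by (metis gr0I lessThan_iff less_zeroE subsetI lessI empty_iff)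
  obtain w :: "(nat + nat) set \<Rightarrow> nat" where w: "\<And>F F'. set_mset F \<subseteq> set_mset G \<Longrightarrow>
      set_mset F' \<subseteq> set_mset G \<Longrightarrow> size F \<le> n \<Longrightarrow> size F' \<le> n \<Longrightarrow>
      (\<Sum>e\<in>#F. w e) = (\<Sum>e\<in>#F'. w e) \<Longrightarrow> F = F'"
    using ex_separating_weight[of "set_mset G" n] by (metis finite_set_mset)
  define wt :: "edge_mset \<Rightarrow> nat" where "wt F = (\<Sum>e\<in>#F. w e)" for F
  define I where "I c = V c \<rightarrow>\<^sub>E cell_indices k L" for c
  define m where "m c \<phi> = (\<Prod>v\<in>V c. cell_measure L (\<phi> v))" for c \<phi>
  define J where "J = Sigma (HH n k) I"
  define F where "F = (\<lambda>(c, \<phi>). push \<phi> (rep c))"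
  \<comment> \<open>The contribution of a class and a map to the coefficient of
    \<open>z ^ wt (F j)\<close>; a map that leaves the edges of \<open>G\<close> meets a kernel
    value 0.\<close>
  define C where "C = (\<lambda>(c, \<phi>). if set_mset (push \<phi> (rep c)) \<subseteq> set_mset G then d c * m c \<phi> else 0)"
  have sizeF: "size (F j) = n" if "j \<in> J" for j
    using that rep by (auto simp: J_def F_def)
  have finI: "finite (I c)" if "c \<in> HH n k" for c
    unfolding I_def using finV[OF that] by (intro finite_PiE) auto
  have finJ: "finite J" unfolding J_def using finI finite_HH by blast
  have "(\<Sum>j\<in>J. C j * z ^ wt (F j)) = 0" if z: "0 < z" "z \<le> 1" for z
  proof -
    \<comment> \<open>Supported on the edges of \<open>G\<close>; since \<open>z\<close> is at most
      1, the values stay between 0 and \<open>s\<close>.\<close>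
    define h where "h e = (if e \<in> set_mset G then s * z ^ w e else 0)" for e
    have hs: "\<bar>h e\<bar> \<le> s" for e
      using s z by (auto simp: h_def abs_mult power_le_one)
    let ?f = "step_kernel x k L h"
    have f: "?f \<in> W s" by (rule step_kernel_in_W[OF x inj L(1) hs])
    have "s ^ n * (\<Sum>j\<in>J. C j * z ^ wt (F j)) = (\<Sum>j\<in>J. s ^ n * (C j * z ^ wt (F j)))"
      by (rule sum_distrib_left)
    also have "\<dots> = (\<Sum>c\<in>HH n k. \<Sum>\<phi>\<in>I c. d c * (m c \<phi> * (\<Prod>e\<in>#push \<phi> (rep c). h e)))"
      unfolding J_def
    proof (subst sum.Sigma[OF finite_HH], use finI in blast, intro sum.cong refl, clarify)
      fix c \<phi> assume "c \<in> HH n k" "\<phi> \<in> I c"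
      then have "size (push \<phi> (rep c)) = n" using rep by simp
      then show "s ^ n * (C (c, \<phi>) * z ^ wt (F (c, \<phi>))) = d c * (m c \<phi> * (\<Prod>e\<in>#push \<phi> (rep c). h e))"
        unfolding h_def prod_mset_supported_power by (simp add: C_def F_def wt_def)
    qed
    also have "\<dots> = (\<Sum>c\<in>HH n k. d c * tdens x c ?f)"
    proof (intro sum.cong refl)
      fix c assume "c \<in> HH n k"
      then have E: "edges_on k (rep c)" "c = edge_class (rep c)" using rep by auto
      have "tdens x c ?f = edge_density x (rep c) ?f" using tdens_edge_class[OF x f E(1)] E(2) by simp
      also have "\<dots> = (\<Sum>\<phi>\<in>I c. m c \<phi> * (\<Prod>e\<in>#push \<phi> (rep c). h e))"
        unfolding edge_density_step_kernel[OF x inj L(1) hs E(1)] I_def m_def V_def ..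
      finally show "(\<Sum>\<phi>\<in>I c. d c * (m c \<phi> * (\<Prod>e\<in>#push \<phi> (rep c). h e))) = d c * tdens x c ?f"
        by (simp add: sum_distrib_left)
    qed
    also have "\<dots> = 0" by (rule zero[OF f])
    finally show ?thesis using s by simp
  qed
  from exponential_sum_coeffs_zero[OF finJ this, of "wt G"]
  have sum0: "(\<Sum>j\<in>{j\<in>J. wt (F j) = wt G}. C j) = 0" .
  \<comment> \<open>What remains of \<open>C\<close> after division by \<open>d c0\<close>: the
    volumes of the maps of \<open>G\<close> that reproduce \<open>G\<close>.\<close>
  define B where "B = (\<lambda>(c, \<phi>). if c = c0 \<and> push \<phi> G = G then m c \<phi> else 0)"
  have CB: "C j = d c0 * B j" if j: "j \<in> J" "wt (F j) = wt G" for j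
  proof (cases j)
    case (Pair c \<phi>)
    have c: "c \<in> HH n k" "\<phi> \<in> I c" using j Pair by (auto simp: J_def)
    \<comment> \<open>Support in \<open>G\<close>, size \<open>n\<close> and the weight of
      \<open>G\<close> determine the multiset.\<close>
    have pushG: "push \<phi> (rep c) = G" if "set_mset (push \<phi> (rep c)) \<subseteq> set_mset G"
      using w[OF that order_refl] j sizeF[OF j(1)] G(2) Pair by (simp add: F_def wt_def)
    show ?thesis
    proof (cases "C j = 0")
      case True
      have "B j = 0"
      proof (rule ccontr)
        assume "B j \<noteq> 0"
        then have "c = c0" "push \<phi> (rep c) = G" "m c \<phi> \<noteq> 0"
          using Pair by (auto simp: B_def G_def split: if_splits)
        then show False using True Pair c0H by (simp add: C_def)
      qed
      then show ?thesis using True by simp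
    next
      case False
      then have sub: "set_mset (push \<phi> (rep c)) \<subseteq> set_mset G" and dm: "d c \<noteq> 0" "m c \<phi> \<noteq> 0"
        using Pair by (auto simp: C_def split: if_splits)
      \<comment> \<open>A labelled cell has measure zero, so a map of nonzero volume keeps free
        vertices free.\<close>
      have "\<exists>i. \<phi> v = Inr i" if "v \<in> V c" for v
        using that dm(2) finV[OF c(1)] by (cases "\<phi> v") (auto simp: m_def)
      then obtain \<pi> where pi: "\<And>v. v \<in> V c \<Longrightarrow> \<phi> v = Inr (\<pi> v)" by metis
      have "push \<phi> (rep c) = rename \<pi> (rep c)"
        unfolding push_def rename_def
      proof (intro image_mset_cong image_cong refl)
        fix e p assume "e \<in># rep c" "p \<in> e"
        then show "case_sum Inl \<phi> p = map_sum id \<pi> p"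
          using pi by (cases p) (auto simp: V_def free_verts_def)
      qed
      then have ren: "G = rename \<pi> (rep c)" using pushG[OF sub] by simp
      then have img: "\<pi> ` V c = V c0" using G(4) by (simp add: free_verts_rename V_def)
      have "c \<in> D" using c dm by (simp add: D_def)
      then have "card (V c) \<le> card (\<pi> ` V c)" using cmax img by simp
      \<comment> \<open>\<open>\<pi>\<close> maps \<open>V c\<close> onto \<open>V c0\<close>, which
        by the choice of \<open>c0\<close> is at least as large.\<close>
      then have "inj_on \<pi> (V c)"
        using finV[OF c(1)] by (metis card_image_le eq_card_imp_inj_on le_antisym)
      then have "edge_equiv (rep c) G" using ren by (auto simp: edge_equiv_def V_def)
      then have "c = c0" using rep[OF c(1)] G(3) edge_class_eq_iff by metis
      then show ?thesis using Pair sub pushG[OF sub] by (simp add: C_def B_def G_def)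
    qed
  qed
  \<comment> \<open>The identity is one of the maps counted, so the nonnegative volumes in
    \<open>B\<close> have a positive sum.\<close>
  define \<iota> where "\<iota> = (\<lambda>v\<in>V c0. Inr v :: nat + nat)"
  have "push \<iota> G = rename (\<lambda>v. v) G"
    unfolding push_def rename_def
  proof (intro image_mset_cong image_cong refl)
    fix e p assume "e \<in># G" "p \<in> e"
    then show "case_sum Inl \<iota> p = map_sum id (\<lambda>v. v) p"
      using G(4) by (cases p) (auto simp: \<iota>_def free_verts_def)
  qed
  then have iG: "push \<iota> G = G" by (simp add: rename_id)
  have "\<iota> \<in> I c0" using L(2) by (auto simp: \<iota>_def I_def)
  then have j0: "(c0, \<iota>) \<in> {j\<in>J. wt (F j) = wt G}"
    using c0H iG by (simp add: J_def F_def G_def)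
  have "m c0 \<iota> > 0" unfolding m_def \<iota>_def using L(1) by (intro prod_pos) auto
  then have "B (c0, \<iota>) > 0" using iG by (simp add: B_def)
  moreover have "B j \<ge> 0" for j
  proof -
    have "cell_measure L p \<ge> 0" for p by (cases p) auto
    then show ?thesis by (cases j) (auto simp: B_def m_def intro: prod_nonneg)
  qed
  ultimately have "(\<Sum>j\<in>{j\<in>J. wt (F j) = wt G}. B j) > 0"
    using j0 finJ by (intro sum_pos2[of _ "(c0, \<iota>)"]) auto
  moreover have "d c0 * (\<Sum>j\<in>{j\<in>J. wt (F j) = wt G}. B j) = 0"
    using sum0 CB by (simp add: sum_distrib_left)
  ultimately show False using c0H(2) by simp
qed

section \<open>Injectivity\<close>

context
  fixes x :: "nat \<Rightarrow> real" and s :: real and R :: ereal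
  assumes x: "\<forall>i\<ge>1. x i \<in> {0..1}" and s: "0 < s" and sR: "ereal s < R"
begin

lemma series_eval_eq_zero:
  assumes inj: "inj_on x {1..}" and d: "d \<in> QR k R" and zero: "\<And>f. f \<in> W s \<Longrightarrow> series_eval x s d f = 0"
  shows "d c = 0"
proof (rule ccontr)
  assume "d c \<noteq> 0"
  then obtain n where c: "c \<in> HH n k" using d by (auto simp: QR_def Qhat_def)
  have "slice x k d f n = 0" if f: "f \<in> W s" for f
  proof (rule power_series_coeffs_zero)
    fix t :: real assume t: "\<bar>t\<bar> < 1"
    \<comment> \<open>The rescaled kernel lies in \<open>W s\<close> again, so the hypothesis makes
      a power series in \<open>t\<close> vanish; its coefficients are the slices of \<open>d\<close>
      at \<open>f\<close>.\<close>
    let ?f = "\<lambda>p\<in>{0..1} \<times> {0..1}. t * f p"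
    have g: "?f \<in> W s" using t by (intro W_scale[OF f]) auto
    have "slice x k d ?f = (\<lambda>n. slice x k d f n * t ^ n)"
      using t unfolding slice_def
      by (intro ext) (simp add: tdens_scale[OF x f _] sum_distrib_left mult_ac)
    then show "(\<lambda>n. slice x k d f n * t ^ n) sums 0"
      using series_facts(2)[OF x s sR d g] zero[OF g] by simp
  qed
  then have "d c = 0"
    using densities_linearly_independent[OF x inj s _ c, of d] by (simp add: slice_def)
  then show False using \<open>d c \<noteq> 0\<close> by simp
qed

lemma inj_on_series_eval:
  assumes inj: "inj_on x {1..}" shows "inj_on (series_eval x s) (QNR R)"
proof (rule inj_onI)
  fix a b assume ab: "a \<in> QNR R" "b \<in> QNR R" and eq: "series_eval x s a = series_eval x s b"
  \<comment> \<open>Written with the factor -1 so that additivity and homogeneity of the evaluation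
    apply directly.\<close>
  let ?d = "\<lambda>c. a c + (-1) * b c"
  have hom: "series_eval x s (\<lambda>c. u c + v c) f = series_eval x s u f + series_eval x s v f"
    "series_eval x s (\<lambda>c. r * u c) f = r * series_eval x s u f"
    if "u \<in> QNR R" "v \<in> QNR R" "f \<in> W s" for u v r f
    using alg_hom_series_eval[OF x s sR] that unfolding alg_hom_def by simp_all
  have sub: "(\<lambda>c. u c + v c) \<in> QNR R" "(\<lambda>c. r * u c) \<in> QNR R"
    if "u \<in> QNR R" "v \<in> QNR R" for u v r
    using subalgebra_QNR that unfolding subalgebra_series_def by simp_all
  have nb: "(\<lambda>c. (-1) * b c) \<in> QNR R" by (rule sub(2)[OF ab(2) ab(2)])
  have "?d \<in> QNR R" by (rule sub(1)[OF ab(1) nb])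
  then obtain k where d: "?d \<in> QR k R" by (auto simp: QNR_def)
  have "series_eval x s ?d f = 0" if f: "f \<in> W s" for f
  proof -
    have "series_eval x s ?d f = series_eval x s a f + series_eval x s (\<lambda>c. (-1) * b c) f"
      by (rule hom(1)[OF ab(1) nb f])
    also have "series_eval x s (\<lambda>c. (-1) * b c) f = (-1) * series_eval x s b f"
      by (rule hom(2)[OF ab(2) ab(2) f])
    finally show ?thesis using eq by simp
  qed
  then have "?d c = 0" for c by (rule series_eval_eq_zero[OF inj d])
  then show "a = b" by (auto simp: fun_eq_iff)
qed

text \<open>If \<open>x i = x j\<close>, the edges joining \<open>i\<close> and \<open>j\<close> to
  a third label are different graphs with the same density.\<close>

lemma not_inj_on_alpha:
  assumes "\<not> inj_on x {1..}" shows "\<not> inj_on (alpha x s) QN"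
proof
  assume inj: "inj_on (alpha x s) QN"
  obtain i j where ij: "i \<ge> 1" "j \<ge> 1" "x i = x j" "i \<noteq> j"
    using assms by (auto simp: inj_on_def)
  \<comment> \<open>Both labels are at least 1, so \<open>i + j\<close> differs from each of them;
    it also bounds them, so both graphs are \<open>m\<close>-labelled.\<close>
  define m where "m = i + j"
  let ?E = "\<lambda>i. {#{Inl i, Inl m}#} :: edge_mset"
  let ?a = "\<lambda>i c. if c = edge_class (?E i) then 1 else 0 :: real"
  have m: "m \<noteq> i" "m \<noteq> j" "i \<le> m" "j \<le> m" using ij by (auto simp: m_def)
  have edges_on: "edges_on m (?E i)" "edges_on m (?E j)" using m ij by (auto simp: edges_on_def card_insert_if)
  have free: "free_verts (?E l) = {}" for l by (auto simp: free_verts_def)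
  have "\<not> edge_equiv (?E i) (?E j)"
  proof
    assume "edge_equiv (?E i) (?E j)"
    then have "?E j = ?E i" unfolding edge_equiv_def by (auto simp: rename_def)
    then show False using m ij by (auto simp: doubleton_eq_iff)
  qed
  then have ne: "edge_class (?E i) \<noteq> edge_class (?E j)" using edge_class_eq_iff[OF edges_on(1)] by simp
  have QN: "?a i \<in> QN" "?a j \<in> QN"
  proof -
    have "edge_class (?E i) \<in> HH 1 m" "edge_class (?E j) \<in> HH 1 m" using edges_on by (auto simp: HH_eq)
    then have "?a i \<in> Q m" "?a j \<in> Q m" by (auto simp: Q_def Qhat_def)
    then show "?a i \<in> QN" "?a j \<in> QN" by (auto simp: QN_def)
  qed
  have al: "alpha x s (?a l) f = tdens x (edge_class (?E l)) f" if "f \<in> W s" for f l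
    using that by (simp add: alpha_def cong: conj_cong)
  have "tdens x (edge_class (?E i)) f = tdens x (edge_class (?E j)) f" if f: "f \<in> W s" for f
  proof -
    have "x i \<in> {0..1}" "x j \<in> {0..1}" "x m \<in> {0..1}" using x ij m by auto
    then have "edge_prod x (?E i) f y = edge_prod x (?E j) f y" for y
      using ij(3) W_sym[OF f] by (simp add: edge_prod_def edge_val_pair del: atLeastAtMost_iff)
    then show ?thesis
      unfolding tdens_edge_class[OF x f edges_on(1)] tdens_edge_class[OF x f edges_on(2)] edge_density_def free
      by presburger
  qed
  then have "alpha x s (?a i) = alpha x s (?a j)"
    using al by (intro extensionalityI[of _ "W s"]) (auto simp: alpha_def)
  then have "?a i = ?a j" using inj QN by (simp only: inj_on_def)
  then show False using ne by (metis zero_neq_one)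
qed

text \<open>On \<open>QN\<close> the finite sums are values of the extension, so the laws are
  inherited from \<open>QNR R\<close>.\<close>

lemma alg_hom_alpha: "alg_hom s QN (alpha x s)"
proof -
  have sub: "sone \<in> QN" "\<And>a b. a \<in> QN \<Longrightarrow> b \<in> QN \<Longrightarrow> (\<lambda>c. a c + b c) \<in> QN"
    "\<And>a b. a \<in> QN \<Longrightarrow> b \<in> QN \<Longrightarrow> smult a b \<in> QN" "\<And>r a. a \<in> QN \<Longrightarrow> (\<lambda>c. r * a c) \<in> QN"
    using subalgebra_QN unfolding subalgebra_series_def by blast+
  have "alg_hom s QN (series_eval x s)"
    using alg_hom_series_eval[OF x s sR] subalgebra_QN QN_subset_QNR
    unfolding alg_hom_def by (meson subsetD)
  then show ?thesis unfolding alg_hom_def by (simp add: series_eval_QN sub)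
qed

end

theorem theorem4p40:
  fixes x :: "nat \<Rightarrow> real" and s :: real and R :: ereal
  assumes "\<forall>i\<ge>1. x i \<in> {0..1}"
    and "0 < s" and "ereal s < R"
  shows "\<exists>\<beta>. alg_hom s (QNR R) \<beta> \<and> continuous_extension x s R \<beta> \<and>
             (alg_embedding s (QNR R) \<beta> \<longleftrightarrow> inj_on x {1..}) \<and>
             (alg_embedding s QN (alpha x s) \<longleftrightarrow> inj_on x {1..})"
proof (intro exI conjI)
  note hom = alg_hom_series_eval[OF assms] alg_hom_alpha[OF assms]
  show "alg_hom s (QNR R) (series_eval x s)" by (rule hom)
  show "continuous_extension x s R (series_eval x s)"
    unfolding continuous_extension_def
    using series_eval_QN continuous_series_eval[OF assms] uniform_limit_trunc[OF assms] by blast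
  \<comment> \<open>Both equivalences follow from the two extreme implications: distinct points give
    injectivity on the large algebra \<open>QNR R\<close>, and a repeated point destroys it already
    on \<open>QN\<close>.\<close>
  have eq: "inj_on (series_eval x s) QN \<longleftrightarrow> inj_on (alpha x s) QN"
    by (rule inj_on_cong) (rule series_eval_QN)
  have sub: "inj_on (series_eval x s) (QNR R) \<Longrightarrow> inj_on (series_eval x s) QN"
    using QN_subset_QNR by (rule inj_on_subset[rotated])
  show "alg_embedding s (QNR R) (series_eval x s) \<longleftrightarrow> inj_on x {1..}"
    unfolding alg_embedding_def
    using hom eq sub inj_on_series_eval[OF assms] not_inj_on_alpha[OF assms] by blast
  show "alg_embedding s QN (alpha x s) \<longleftrightarrow> inj_on x {1..}"
    unfolding alg_embedding_def
    using hom eq sub inj_on_series_eval[OF assms] not_inj_on_alpha[OF assms] by blast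
qed

end
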